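(* Let $Q$ be an acyclic cluster quiver with at least one multiple edge, and let $Q'$ be its ME-free version. The maximal green sequences of $Q$ are exactly the $Q$-ME-free maximal green sequences $(C_0,C_1,\dots,C_m)$ of $Q'$ satisfying the following condition: for every multiple edge from a vertex $i$ to a vertex $j$ in $Q$ and for every $C$-matrix $C_t$ in the sequence such that $C_t$ has a negative $c$-vector whose support contains $i$, the mutation performed on $C_t$ in the sequence is not done at any negative $c$-vector whose support contains $j$.
   Context: A cluster quiver is a finite quiver without loops or oriented 2-cycles; multiple arrows are allowed. Mutation at a vertex $k$: (1) for each pair of arrows $i\to k$, $k\to j$ add an arrow $i\to j$; (2) reverse all arrows incident to $k$; (3) delete all 2-cycles created. The framed quiver $\hat Q$ is obtained by adding, for each vertex $i$, a frozen (non-mutable) vertex $i'$ and an arrow $i\to i'$. In a quiver obtained from $\hat Q$ by mutations at non-frozen vertices, a non-frozen vertex $j$ is green if there is no arrow from a frozen vertex to $j$. A maximal green sequence (MGS) is a sequence of mutations, each at a green vertex, after which no green vertex remains. The $C$-matrix of a mutated framed quiver is the $n\times n$ matrix with $(i,j)$ entry (number of arrows $i'\to j$) $-$ (number of arrows $j\to i'$); its columns are $c$-vectors. Initially $C_0=-I_n$, and green vertices are exactly those whose $c$-vector is nonpositive ("negative"). An MGS is recorded as its sequence of $C$-matrices $(C_0,\dots,C_m)$; MGSs of quivers on the same vertex set are identified when they have the same initial $C$-matrix and mutate on the same sequence of $c$-vectors. A multiple edge from $i$ to $j$ means at least two arrows $i\to j$. The ME-free version $Q'$ of $Q$ has the same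 vertices and is obtained by deleting all arrows between pairs of vertices joined by a multiple edge, keeping single arrows. The support of $c\in\mathbb{Z}^n$ is $\{i:c_i\neq0\}$. A $c$-vector is $Q$-ME-free if its support contains no two vertices joined by a multiple edge in $Q$; an MGS of $Q'$ is $Q$-ME-free if all $c$-vectors in all its $C$-matrices are $Q$-ME-free. *)

theory Defs
  imports Main
begin

text \<open>A quiver on the vertex set {0..<n} is encoded by its arrow-count function:
  Q i j = number of arrows from i to j.\<close>

type_synonym quiver = "nat \<Rightarrow> nat \<Rightarrow> nat"

definition cluster_quiver :: "nat \<Rightarrow> quiver \<Rightarrow> bool" where
  "cluster_quiver n Q \<longleftrightarrow>
     (\<forall>i j. 0 < Q i j \<longrightarrow> i < n \<and> j < n) \<and>
     (\<forall>i. Q i i = 0) \<and>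
     (\<forall>i j. Q i j = 0 \<or> Q j i = 0)"

definition acyclic_quiver :: "quiver \<Rightarrow> bool" where
  "acyclic_quiver Q \<longleftrightarrow> acyclic {(i, j). 0 < Q i j}"

definition mut_step1 :: "nat \<Rightarrow> quiver \<Rightarrow> quiver" where
  "mut_step1 k Q = (\<lambda>i j. Q i j + Q i k * Q k j)"

definition mut_step2 :: "nat \<Rightarrow> quiver \<Rightarrow> quiver" where
  "mut_step2 k Q = (\<lambda>i j. if i = k \<or> j = k then Q j i else Q i j)"

definition mut_step3 :: "quiver \<Rightarrow> quiver" where
  "mut_step3 Q = (\<lambda>i j. Q i j - min (Q i j) (Q j i))"

definition mutate :: "nat \<Rightarrow> quiver \<Rightarrow> quiver" where
  "mutate k Q = mut_step3 (mut_step2 k (mut_step1 k Q))"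

text \<open>Framed quiver on 2n vertices: vertex i' is n + i.\<close>
definition framed :: "nat \<Rightarrow> quiver \<Rightarrow> quiver" where
  "framed n Q = (\<lambda>i j. if i < n \<and> j < n then Q i j
                        else if i < n \<and> j = n + i then 1 else 0)"

definition green :: "nat \<Rightarrow> quiver \<Rightarrow> nat \<Rightarrow> bool" where
  "green n R j \<longleftrightarrow> (\<forall>i<n. R (n + i) j = 0)"

fun mut_trace :: "quiver \<Rightarrow> nat list \<Rightarrow> quiver list" where
  "mut_trace R [] = [R]"
| "mut_trace R (k # ks) = R # mut_trace (mutate k R) ks"

definition quiver_seq :: "nat \<Rightarrow> quiver \<Rightarrow> nat list \<Rightarrow> quiver list" where
  "quiver_seq n Q ks = mut_trace (framed n Q) ks"

definition is_MGS :: "nat \<Rightarrow> quiver \<Rightarrow> nat list \<Rightarrow> bool" where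
  "is_MGS n Q ks \<longleftrightarrow>
     (let Rs = quiver_seq n Q ks in
       (\<forall>t<length ks. ks ! t < n \<and> green n (Rs ! t) (ks ! t)) \<and>
       (\<forall>j<n. \<not> green n (last Rs) j))"

definition cmat :: "nat \<Rightarrow> quiver \<Rightarrow> nat \<Rightarrow> nat \<Rightarrow> int" where
  "cmat n R i j = int (R (n + i) j) - int (R j (n + i))"

definition cvec :: "nat \<Rightarrow> quiver \<Rightarrow> nat \<Rightarrow> int list" where
  "cvec n R j = map (\<lambda>i. cmat n R i j) [0..<n]"

definition supp :: "int list \<Rightarrow> nat set" where
  "supp c = {i. i < length c \<and> c ! i \<noteq> 0}"

definition neg_vec :: "int list \<Rightarrow> bool" where
  "neg_vec c \<longleftrightarrow> (\<forall>x\<in>set c. x \<le> 0)"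

text \<open>The sequence of c-vectors at which an MGS mutates (its identifying data,
  together with the initial C-matrix -I which is common to all).\<close>
definition cvec_seq :: "nat \<Rightarrow> quiver \<Rightarrow> nat list \<Rightarrow> int list list" where
  "cvec_seq n Q ks =
     (let Rs = quiver_seq n Q ks in map (\<lambda>t. cvec n (Rs ! t) (ks ! t)) [0..<length ks])"

definition multiple_edge :: "quiver \<Rightarrow> nat \<Rightarrow> nat \<Rightarrow> bool" where
  "multiple_edge Q i j \<longleftrightarrow> 2 \<le> Q i j"

definition ME_free_version :: "quiver \<Rightarrow> quiver" where
  "ME_free_version Q = (\<lambda>i j. if multiple_edge Q i j \<or> multiple_edge Q j i then 0 else Q i j)"

definition ME_free_cvec :: "quiver \<Rightarrow> int list \<Rightarrow> bool" where
  "ME_free_cvec Q c \<longleftrightarrow>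
     \<not> (\<exists>i j. i \<in> supp c \<and> j \<in> supp c \<and> (multiple_edge Q i j \<or> multiple_edge Q j i))"

definition ME_free_MGS :: "nat \<Rightarrow> quiver \<Rightarrow> quiver \<Rightarrow> nat list \<Rightarrow> bool" where
  "ME_free_MGS n Q Q' ks \<longleftrightarrow>
     (\<forall>R\<in>set (quiver_seq n Q' ks). \<forall>j<n. ME_free_cvec Q (cvec n R j))"

definition ME_condition :: "nat \<Rightarrow> quiver \<Rightarrow> quiver \<Rightarrow> nat list \<Rightarrow> bool" where
  "ME_condition n Q Q' ks \<longleftrightarrow>
     (let Rs = quiver_seq n Q' ks in
      \<forall>i j. multiple_edge Q i j \<longrightarrow>
        (\<forall>t<length ks.
           (\<exists>l<n. neg_vec (cvec n (Rs ! t) l) \<and> i \<in> supp (cvec n (Rs ! t) l)) \<longrightarrow>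
           \<not> (neg_vec (cvec n (Rs ! t) (ks ! t)) \<and> j \<in> supp (cvec n (Rs ! t) (ks ! t)))))"

end

theory Submission
  imports Defs "HOL-Library.FuncSet"
begin

text \<open>
  Let \<open>d\<^sub>j\<close> be minus the c-vector at \<open>j\<close> and \<open>\<omega>\<close> the skew form of the quiver. A green mutation at \<open>k\<close> sends
  \<open>d\<^sub>k\<close> to \<open>- d\<^sub>k\<close> and \<open>d\<^sub>j\<close> to \<open>d\<^sub>j + max 0 (\<omega> d\<^sub>j d\<^sub>k) d\<^sub>k\<close>. Along a green sequence the \<open>d\<^sub>j\<close> are, up to
  sign, the dimension vectors of an exceptional sequence of representations of the acyclic quiver, and
  the recursion is the mutation of simple-minded collections; this gives sign-coherence. Working over
  the field with two elements makes all spaces finite, so that dimensions become cardinalities and a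
  brick has no endomorphisms but zero and the identity.

  Call a mutation bad for a multiple edge from \<open>a\<close> to \<open>b\<close> if some green vector contains \<open>a\<close> while the
  mutated vector contains \<open>b\<close>. A bad mutation cannot occur in a maximal green sequence: it creates a
  module that lies in all later torsion classes, whereas the last torsion class is zero. Without bad
  mutations the recursions for a quiver and for its ME-free version coincide: the two skew forms
  differ by a term that can only matter if the next vectors contain both ends of a multiple edge or
  have mixed signs.
\<close>

section \<open>Vector spaces over the field with two elements\<close>

text \<open>The heart of a torsion pair is never formed: simplicity in it is expressed by
  \<open>Splus\<close> and \<open>Sminus\<close>, which speak of modules and \<open>orth Ms\<close>
  only. Exceptionality and simplicity are carried together because each supplies what the other
  lacks. Exceptionality turns Euler numbers into multiplicities, so that the coefficient in the
  recursion becomes the number of copies of \<open>k\<close> in an approximation or extension;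
  simplicity makes nonzero maps from torsion modules onto, with torsion kernel. The last torsion
  class is zero because a mutation step is invertible: the vectors \<open>dd ks j\<close> still
  span, and a module whose Euler pairing with all of them vanishes has dimension vector zero. Two
  arrows matter because a module glued along one of them lets the other act as zero. Switching the
  other one on is a self-extension that does not split, whereas all mutated modules are rigid. In
  the comparison, each direction knows only on its own side that the next vectors avoid multiple
  edges. One of the two cases is settled by this alone, the other also needs that of two green
  modules one has vanishing Euler pairing with the other.\<close>

typedef vec = "UNIV :: (nat \<Rightarrow> bool) set" ..

instantiation vec :: ab_group_add
begin

definition zero_vec :: vec where "0 = Abs_vec (\<lambda>_. False)"
definition plus_vec :: "vec \<Rightarrow> vec \<Rightarrow> vec" where
  "x + y = Abs_vec (\<lambda>m. Rep_vec x m \<noteq> Rep_vec y m)"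
definition uminus_vec :: "vec \<Rightarrow> vec" where "- x = (x::vec)"
definition minus_vec :: "vec \<Rightarrow> vec \<Rightarrow> vec" where "x - y = (x::vec) + y"

instance
proof
  fix a b c :: vec
  show "a + b + c = a + (b + c)"
    unfolding plus_vec_def Abs_vec_inverse[OF UNIV_I] by (rule arg_cong[of _ _ Abs_vec]) auto
  show "a + b = b + a"
    unfolding plus_vec_def by (rule arg_cong[of _ _ Abs_vec]) auto
  show "0 + a = a"
    unfolding plus_vec_def zero_vec_def Abs_vec_inverse[OF UNIV_I] by (simp add: Rep_vec_inverse)
  show "- a + a = 0"
    unfolding plus_vec_def zero_vec_def uminus_vec_def by simp
  show "a - b = a + - b"
    by (simp add: minus_vec_def uminus_vec_def)
qed

end

lemma Rep_vec_plus: "Rep_vec (x + y) m \<longleftrightarrow> Rep_vec x m \<noteq> Rep_vec y m"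
  by (simp add: plus_vec_def Abs_vec_inverse)

lemma Rep_vec_zero: "\<not> Rep_vec 0 m"
  by (simp add: zero_vec_def Abs_vec_inverse)

lemma vec_eqI: "(\<And>m. Rep_vec x m = Rep_vec y m) \<Longrightarrow> x = y"
  by (subst Rep_vec_inject[symmetric]) (rule ext)

lemma vec_self [simp]: "(x::vec) + x = 0"
  by (rule vec_eqI) (simp add: Rep_vec_plus Rep_vec_zero)

lemma vec_self_left [simp]: "(x::vec) + (x + y) = y"
  by (simp flip: add.assoc)

lemma vec_add_eq_0: "(x::vec) + y = 0 \<longleftrightarrow> x = y"
  by (metis add.right_neutral vec_self_left vec_self)

text \<open>Interleaving identifies \<open>vec\<close> with its own square, so the spaces of an
  extension of two representations are again sets of elements of \<open>vec\<close>.\<close>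

definition pr :: "vec \<Rightarrow> vec \<Rightarrow> vec" where
  "pr x y = Abs_vec (\<lambda>m. if even m then Rep_vec x (m div 2) else Rep_vec y (m div 2))"
definition fs :: "vec \<Rightarrow> vec" where "fs z = Abs_vec (\<lambda>m. Rep_vec z (2 * m))"
definition sn :: "vec \<Rightarrow> vec" where "sn z = Abs_vec (\<lambda>m. Rep_vec z (2 * m + 1))"

lemma fs_pr [simp]: "fs (pr x y) = x"
  by (rule vec_eqI) (simp add: fs_def pr_def Abs_vec_inverse)

lemma sn_pr [simp]: "sn (pr x y) = y"
  by (rule vec_eqI) (simp add: sn_def pr_def Abs_vec_inverse)

lemma pr_fs_sn [simp]: "pr (fs z) (sn z) = z"
  by (rule vec_eqI) (auto simp add: sn_def fs_def pr_def Abs_vec_inverse odd_two_times_div_two_succ)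

lemma fs_add [simp]: "fs (x + y) = fs x + fs y"
  by (rule vec_eqI) (simp add: fs_def Abs_vec_inverse Rep_vec_plus)

lemma sn_add [simp]: "sn (x + y) = sn x + sn y"
  by (rule vec_eqI) (simp add: sn_def Abs_vec_inverse Rep_vec_plus)

lemma fs_0 [simp]: "fs 0 = 0"
  by (rule vec_eqI) (simp add: fs_def Abs_vec_inverse Rep_vec_zero)

lemma sn_0 [simp]: "sn 0 = 0"
  by (rule vec_eqI) (simp add: sn_def Abs_vec_inverse Rep_vec_zero)

lemma vec_pair_eqI: "fs z = fs z' \<Longrightarrow> sn z = sn z' \<Longrightarrow> z = z'"
  by (metis pr_fs_sn)

lemma pr_add: "pr x y + pr x' y' = pr (x + x') (y + y')"
  by (rule vec_pair_eqI) simp_all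

lemma pr_0 [simp]: "pr 0 0 = 0"
  by (rule vec_pair_eqI) simp_all

lemma pr_eq_0 [simp]: "pr x y = 0 \<longleftrightarrow> x = 0 \<and> y = 0"
  by (metis fs_0 fs_pr pr_0 sn_0 sn_pr)

text \<open>Over the two-element field closure under addition already gives a subspace, and an
  additive map is linear, so scalars never appear here or in \<open>lin\<close>.\<close>

definition subg :: "vec set \<Rightarrow> bool" where
  "subg U \<longleftrightarrow> finite U \<and> 0 \<in> U \<and> (\<forall>x\<in>U. \<forall>y\<in>U. x + y \<in> U)"

definition lin :: "vec set \<Rightarrow> vec set \<Rightarrow> (vec \<Rightarrow> vec) \<Rightarrow> bool" where
  "lin U V f \<longleftrightarrow> (\<forall>x\<in>U. f x \<in> V) \<and> (\<forall>x\<in>U. \<forall>y\<in>U. f (x + y) = f x + f y)"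

lemma subgD: "subg U \<Longrightarrow> finite U" "subg U \<Longrightarrow> 0 \<in> U" "subg U \<Longrightarrow> x \<in> U \<Longrightarrow> y \<in> U \<Longrightarrow> x + y \<in> U"
  by (auto simp: subg_def)

lemma subg_cancel: "subg U \<Longrightarrow> x \<in> U \<Longrightarrow> x + y \<in> U \<longleftrightarrow> y \<in> U"
  by (metis subgD(3) vec_self_left)

lemma linD: "lin U V f \<Longrightarrow> x \<in> U \<Longrightarrow> f x \<in> V"
  "lin U V f \<Longrightarrow> x \<in> U \<Longrightarrow> y \<in> U \<Longrightarrow> f (x + y) = f x + f y"
  by (auto simp: lin_def)

lemma lin_0: "lin U V f \<Longrightarrow> 0 \<in> U \<Longrightarrow> f 0 = 0"
  by (metis add_cancel_left_left linD(2) vec_self)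

lemma subg_0 [simp]: "subg {0}"
  by (simp add: subg_def)

lemma subg_pair [simp]: "subg {0, v}"
  by (auto simp: subg_def)

lemma subg_coset_union:
  assumes "subg U" shows "subg (U \<union> (+) v ` U)"
  unfolding subg_def
proof (intro conjI ballI)
  show "finite (U \<union> (+) v ` U)" "0 \<in> U \<union> (+) v ` U" using assms by (auto simp: subgD)
  fix x y assume "x \<in> U \<union> (+) v ` U" "y \<in> U \<union> (+) v ` U"
  then have x: "x \<in> U \<or> v + x \<in> U" and y: "y \<in> U \<or> v + y \<in> U" by auto
  have "x + y \<in> U \<or> v + (x + y) \<in> U"
  proof (cases "x \<in> U"; cases "y \<in> U")
    assume "x \<notin> U" "y \<notin> U"
    then have "(v + x) + (v + y) \<in> U" using x y subgD(3)[OF assms] by blast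
    then show ?thesis by (simp add: ac_simps)
  next
    assume "x \<notin> U" "y \<in> U"
    then have "(v + x) + y \<in> U" using x y subgD(3)[OF assms] by blast
    then show ?thesis by (simp add: ac_simps)
  next
    assume "x \<in> U" "y \<notin> U"
    then have "x + (v + y) \<in> U" using x y subgD(3)[OF assms] by blast
    then show ?thesis by (simp add: ac_simps)
  qed (simp add: subgD[OF assms])
  then show "x + y \<in> U \<union> (+) v ` U" by (metis UnCI image_eqI vec_self_left)
qed

text \<open>Adjoining one vector to \<open>W\<close> adds a single coset, so growing
  \<open>U\<close> to \<open>V\<close> coset by coset replaces the choice of a basis.\<close>

lemma subg_induct [consumes 3, case_names base step]:
  assumes "subg V" "subg U" "U \<subseteq> V" and base: "P U"
    and step: "\<And>W v. subg W \<Longrightarrow> U \<subseteq> W \<Longrightarrow> W \<subseteq> V \<Longrightarrow> v \<in> V \<Longrightarrow> v \<notin> W \<Longrightarrow> P W \<Longrightarrow> P (W \<union> (+) v ` W)"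
  shows "P V"
proof -
  \<comment> \<open>The claim for a bound \<open>m\<close> larger than \<open>card V\<close> leaves
    only the alternative \<open>W = V\<close>.\<close>
  have "\<exists>W. subg W \<and> U \<subseteq> W \<and> W \<subseteq> V \<and> P W \<and> (W = V \<or> card W \<ge> m)" for m
  proof (induction m)
    case 0 show ?case using assms by blast
  next
    case (Suc m)
    then obtain W where W: "subg W" "U \<subseteq> W" "W \<subseteq> V" "P W" "W = V \<or> card W \<ge> m" by blast
    show ?case
    proof (cases "W = V")
      case True then show ?thesis using W by blast
    next
      case False
      then obtain v where v: "v \<in> V" "v \<notin> W" using W by blast
      let ?W = "W \<union> (+) v ` W"
      have "W \<subset> ?W" using v subgD(2)[OF W(1)] by (metis UnI2 Un_upper1 add.right_neutral imageI psubsetI)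
      then have "card W < card ?W"
        using subgD(1)[OF subg_coset_union[OF W(1)]] by (metis psubset_card_mono)
      moreover have "?W \<subseteq> V" using W(3) v(1) assms(1) by (auto simp: subgD(3) subset_iff)
      ultimately show ?thesis
        using W v step[OF W(1,2,3) v W(4)] subg_coset_union[OF W(1), of v] False
        by (intro exI[of _ ?W]) auto
    qed
  qed
  from this[of "Suc (card V)"] obtain W where "W \<subseteq> V" "P W" "W = V \<or> card W \<ge> Suc (card V)" by blast
  then show ?thesis using card_mono[OF subgD(1)[OF assms(1)], of W] by auto
qed

text \<open>On the new coset \<open>v + x\<close> lies back in \<open>U\<close>, since every vector
  is its own negative; this dictates the formula for \<open>g\<close>.\<close>

lemma lin_coset_extend:
  assumes "subg U" "v \<notin> U" "lin U W f" "subg W" "w \<in> W"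
  defines "g \<equiv> (\<lambda>x. if x \<in> U then f x else w + f (v + x))"
  shows "lin (U \<union> (+) v ` U) W g" "\<And>x. x \<in> U \<Longrightarrow> g x = f x" "g v = w"
proof -
  show "lin (U \<union> (+) v ` U) W g" unfolding lin_def
  proof (intro conjI ballI)
    fix x assume "x \<in> U \<union> (+) v ` U"
    then show "g x \<in> W" using assms by (auto simp: g_def linD subgD)
  next
    fix x y assume "x \<in> U \<union> (+) v ` U" "y \<in> U \<union> (+) v ` U"
    then have x: "x \<in> U \<or> v + x \<in> U" and y: "y \<in> U \<or> v + y \<in> U" by auto
    have c: "x + y \<in> U \<longleftrightarrow> y \<in> U" if "x \<in> U" for x y
      using subg_cancel[OF assms(1) that] .
    show "g (x + y) = g x + g y"
    proof (cases "x \<in> U"; cases "y \<in> U")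
      assume "x \<in> U" "y \<in> U"
      then show ?thesis using assms(3) c by (simp add: g_def linD)
    next
      assume a: "x \<in> U" "y \<notin> U"
      then have "v + y \<in> U" "x + y \<notin> U" using y c by auto
      moreover have "v + (x + y) = x + (v + y)" by (simp add: ac_simps)
      ultimately show ?thesis using linD(2)[OF assms(3), of x "v + y"] a by (simp add: g_def add.left_commute)
    next
      assume a: "x \<notin> U" "y \<in> U"
      then have "v + x \<in> U" "x + y \<notin> U" using x c[of y x] by (auto simp: add.commute)
      moreover have "v + (x + y) = (v + x) + y" by (simp add: ac_simps)
      ultimately show ?thesis using linD(2)[OF assms(3), of "v + x" y] a by (simp add: g_def add.assoc)
    next
      assume a: "x \<notin> U" "y \<notin> U"
      then have vx: "v + x \<in> U" "v + y \<in> U" using x y by auto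
      have eq: "(v + x) + (v + y) = x + y" by (simp add: ac_simps)
      have "x + y \<in> U" using subgD(3)[OF assms(1) vx] unfolding eq .
      moreover have "f (x + y) = f (v + x) + f (v + y)" using linD(2)[OF assms(3) vx] unfolding eq .
      moreover have "w + f (v + x) + (w + f (v + y)) = f (v + x) + f (v + y)" by (simp add: ac_simps)
      ultimately show ?thesis using a by (simp add: g_def)
    qed
  qed
  show "g x = f x" if "x \<in> U" for x using that by (simp add: g_def)
  show "g v = w" using assms(1,2,3) lin_0[OF assms(3)] by (simp add: g_def subgD)
qed

lemma lin_extend:
  assumes "subg V" "subg U" "U \<subseteq> V" "lin U W f" "subg W"
  shows "\<exists>g. lin V W g \<and> (\<forall>x\<in>U. g x = f x)"
  using assms(1,2,3)
proof (induction rule: subg_induct)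
    case base then show ?case using assms(4) by blast
  next
    case (step S v)
    then obtain g where g: "lin S W g" "\<forall>x\<in>U. g x = f x" by blast
    note e = lin_coset_extend[OF step(1,5) g(1) assms(5) subgD(2)[OF assms(5)]]
    have "\<forall>x\<in>U. (if x \<in> S then g x else 0 + g (v + x)) = f x" using g(2) step(2) by auto
    with e(1) show ?case by blast
qed

lemma lin_comp: "lin U V f \<Longrightarrow> lin V W g \<Longrightarrow> lin U W (\<lambda>x. g (f x))"
  by (auto simp: lin_def)

lemma lin_sum: "lin U V f \<Longrightarrow> lin U V g \<Longrightarrow> subg V \<Longrightarrow> lin U V (\<lambda>x. f x + g x)"
  by (auto simp: lin_def subgD ac_simps)

lemma subg_image: "subg U \<Longrightarrow> lin U V f \<Longrightarrow> subg (f ` U)"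
proof -
  assume U: "subg U" "lin U V f"
  have "0 \<in> f ` U" using lin_0[OF U(2)] subgD(2)[OF U(1)] by (metis imageI)
  moreover have "f x + f y \<in> f ` U" if "x \<in> U" "y \<in> U" for x y
    using linD(2)[OF U(2) that] subgD(3)[OF U(1) that] by (metis imageI)
  ultimately show ?thesis using U(1) by (auto simp: subg_def)
qed

lemma lin_inj_eq: "lin U V f \<Longrightarrow> subg U \<Longrightarrow> (\<And>x. x \<in> U \<Longrightarrow> f x = 0 \<Longrightarrow> x = 0) \<Longrightarrow> x \<in> U \<Longrightarrow> y \<in> U \<Longrightarrow>
  f x = f y \<longleftrightarrow> x = y"
  by (metis linD(2) subgD(3) vec_add_eq_0)

definition splitting where
  "splitting A B C i p s r \<longleftrightarrow> lin C B s \<and> lin B A r \<and> (\<forall>a\<in>A. r (i a) = a) \<and> (\<forall>c\<in>C. p (s c) = c) \<and>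
    (\<forall>c\<in>C. r (s c) = 0) \<and> (\<forall>b\<in>B. i (r b) + s (p b) = b)"

text \<open>The retraction extends the inverse of \<open>i\<close> from the image. The section
  corrects a preimage \<open>b\<close> to \<open>b + i (r b)\<close>, which depends only on
  \<open>p b\<close> because two preimages differ by an element of the image of
  \<open>i\<close>.\<close>

lemma lin_split:
  assumes "subg A" "subg B" "subg C" "lin A B i" "lin B C p"
    and inj: "\<And>x. x \<in> A \<Longrightarrow> i x = 0 \<Longrightarrow> x = 0"
    and surj: "\<And>c. c \<in> C \<Longrightarrow> \<exists>b\<in>B. p b = c"
    and ex: "\<And>b. b \<in> B \<Longrightarrow> p b = 0 \<longleftrightarrow> b \<in> i ` A"
  shows "\<exists>s r. splitting A B C i p s r"
proof -
  define j where "j = inv_into A i"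
  have inj': "i x = i y \<longleftrightarrow> x = y" if "x \<in> A" "y \<in> A" for x y
    using lin_inj_eq[OF assms(4,1) inj] that by blast
  have ji: "j (i a) = a" if "a \<in> A" for a
    unfolding j_def using inj' that by (simp add: inj_on_def inv_into_f_f)
  have "lin (i ` A) A j" unfolding lin_def
  proof (intro conjI ballI)
    fix x y assume "x \<in> i ` A" "y \<in> i ` A"
    then show "j (x + y) = j x + j y"
      using assms(1,4) by (auto simp: ji subgD simp flip: linD(2))
  qed (auto simp: ji)
  then obtain r where r: "lin B A r" "\<And>x. x \<in> i ` A \<Longrightarrow> r x = j x"
    using lin_extend[OF assms(2) subg_image[OF assms(1,4)] _ _ assms(1), of j] linD(1)[OF assms(4)]
    by blast
  have ri: "r (i a) = a" if "a \<in> A" for a using r(2) that ji by simp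
  define q where "q = (\<lambda>b. b + i (r b))"
  have q0: "q b \<in> B" "p (q b) = p b" "r (q b) = 0" if "b \<in> B" for b
  proof -
    have b: "r b \<in> A" "i (r b) \<in> B" using r(1) assms(4) that by (auto simp: linD)
    then show "q b \<in> B" using that assms(2) by (simp add: q_def subgD)
    have "p (i (r b)) = 0" using ex b by blast
    then show "p (q b) = p b" using assms(5) b that by (simp add: q_def linD(2))
    show "r (q b) = 0" using b that r(1) ri by (simp add: q_def linD(2))
  qed
  have qeq: "q b = q b'" if "b \<in> B" "b' \<in> B" "p b = p b'" for b b'
  proof -
    have "p (b + b') = 0" using linD(2)[OF assms(5) that(1,2)] that(3) by simp
    then have "b + b' \<in> i ` A" using ex[of "b + b'"] subgD(3)[OF assms(2) that(1,2)] by blast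
    then obtain a where a: "a \<in> A" "b + b' = i a" by blast
    have "r (b + b') = a" using a ri by simp
    then have "r b + r b' = a" using linD(2)[OF r(1) that(1,2)] by simp
    then have "i (r b) + i (r b') = b + b'"
      using linD(2)[OF assms(4), of "r b" "r b'"] linD(1)[OF r(1)] that a by simp
    then have "(b + i (r b)) + (b' + i (r b')) = 0" by (simp add: ac_simps)
    then show ?thesis by (simp add: q_def vec_add_eq_0)
  qed
  define s where "s = (\<lambda>c. q (inv_into B p c))"
  have iv: "inv_into B p c \<in> B" "p (inv_into B p c) = c" if "c \<in> C" for c
    using surj[OF that] by (auto intro: inv_into_into f_inv_into_f)
  have sp: "s (p b) = q b" if "b \<in> B" for b
    unfolding s_def using iv[of "p b"] linD(1)[OF assms(5) that] that by (intro qeq) auto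
  show ?thesis
  unfolding splitting_def
  proof (rule exI[of _ s], rule exI[of _ r], intro conjI ballI)
    show "lin C B s" unfolding lin_def
    proof (intro conjI ballI)
      fix c assume "c \<in> C" then show "s c \<in> B" using q0(1) iv by (simp add: s_def)
    next
      fix c c' assume "c \<in> C" "c' \<in> C"
      then obtain b b' where b: "b \<in> B" "b' \<in> B" "c = p b" "c' = p b'" using surj by metis
      have "s (c + c') = q (b + b')"
        using sp[OF subgD(3)[OF assms(2) b(1,2)]] linD(2)[OF assms(5) b(1,2)] b by simp
      also have "\<dots> = q b + q b'"
        using linD(2)[OF r(1) b(1,2)] linD(2)[OF assms(4) linD(1)[OF r(1) b(1)] linD(1)[OF r(1) b(2)]]
        by (simp add: q_def ac_simps)
      finally show "s (c + c') = s c + s c'" using b sp by simp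
    qed
    show "lin B A r" by fact
    show "r (i a) = a" if "a \<in> A" for a by (rule ri[OF that])
    show "p (s c) = c" "r (s c) = 0" if "c \<in> C" for c using q0 iv[OF that] by (simp_all add: s_def)
    show "i (r b) + s (p b) = b" if "b \<in> B" for b using sp[OF that] by (simp add: q_def ac_simps)
  qed
qed

lemma card_exact:
  assumes "subg A" "subg B" "subg C" "lin A B i" "lin B C p"
    and "\<And>x. x \<in> A \<Longrightarrow> i x = 0 \<Longrightarrow> x = 0"
    and "\<And>c. c \<in> C \<Longrightarrow> \<exists>b\<in>B. p b = c"
    and "\<And>b. b \<in> B \<Longrightarrow> p b = 0 \<longleftrightarrow> b \<in> i ` A"
  shows "card B = card A * card C"
proof -
  obtain s r where "splitting A B C i p s r"
    using lin_split[OF assms] by blast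
  then have s: "lin C B s" "lin B A r" "\<forall>a\<in>A. r (i a) = a" "\<forall>c\<in>C. p (s c) = c"
    "\<forall>c\<in>C. r (s c) = 0" "\<forall>b\<in>B. i (r b) + s (p b) = b"
    unfolding splitting_def by blast+
  have "bij_betw (\<lambda>b. (r b, p b)) B (A \<times> C)"
  proof (rule bij_betwI[where g = "\<lambda>(a, c). i a + s c"])
    show "(\<lambda>b. (r b, p b)) \<in> B \<rightarrow> A \<times> C" using s(2) assms(5) by (auto simp: linD)
    show "(\<lambda>(a, c). i a + s c) \<in> A \<times> C \<rightarrow> B" using s(1) assms(2,4) by (auto simp: linD subgD)
    fix x assume "x \<in> B" then show "(case (r x, p x) of (a, c) \<Rightarrow> i a + s c) = x" using s(6) by simp
  next
    fix y assume "y \<in> A \<times> C"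
    then obtain a c where y: "y = (a, c)" "a \<in> A" "c \<in> C" by auto
    have "i a \<in> B" "s c \<in> B" using y s(1) assms(4) by (auto simp: linD)
    moreover have "p (i a) = 0" using assms(8) calculation y by blast
    ultimately show "(r (case y of (a, c) \<Rightarrow> i a + s c), p (case y of (a, c) \<Rightarrow> i a + s c)) = y"
      using y s linD(2)[OF assms(5), of "i a" "s c"] linD(2)[OF s(2), of "i a" "s c"] by simp
  qed
  then show ?thesis by (simp add: bij_betw_same_card card_cartesian_product)
qed

lemma card_coset_union:
  assumes "subg W" "v \<notin> W" shows "card (W \<union> (+) v ` W) = 2 * card W"
proof -
  have "W \<inter> (+) v ` W = {}" using assms by (auto, metis add.commute subg_cancel)
  then show ?thesis
    using assms(1) by (simp add: card_Un_disjoint subgD card_image inj_on_def)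
qed

lemma card_subg:
  assumes "subg V" shows "\<exists>d. card V = 2 ^ d"
proof -
  have "{0} \<subseteq> V" using assms by (simp add: subgD)
  with assms subg_0 show ?thesis
  proof (induction rule: subg_induct)
    case base show ?case by (rule exI[of _ 0]) simp
  next
    case (step W v)
    then obtain d where "card W = 2 ^ d" by blast
    then have "card (W \<union> (+) v ` W) = 2 ^ Suc d" using card_coset_union[OF step(1,5)] by simp
    then show ?case by blast
  qed
qed

definition dimv :: "vec set \<Rightarrow> nat" where "dimv V = (THE d. card V = 2 ^ d)"

lemma dimv_eqI: "card V = 2 ^ d \<Longrightarrow> dimv V = d"
  unfolding dimv_def by (rule the_equality) auto

lemma card_dimv: "subg V \<Longrightarrow> card V = 2 ^ dimv V"
  using card_subg dimv_eqI by blast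

lemma dimv_0 [simp]: "dimv {0} = 0"
  by (rule dimv_eqI) simp

lemma dimv_pair: "v \<noteq> 0 \<Longrightarrow> dimv {0, v} = 1"
  by (rule dimv_eqI) simp

lemma dimv_eq_0: "subg V \<Longrightarrow> dimv V = 0 \<longleftrightarrow> V = {0}"
  using card_dimv[of V] subgD(2)[of V] by (auto simp: card_1_singleton_iff)

text \<open>Prescribing the value 0 off \<open>U\<close> makes a linear map on \<open>U\<close> the
  same thing as one HOL function, so the set is finite and can be counted.\<close>

definition Lin :: "vec set \<Rightarrow> vec set \<Rightarrow> (vec \<Rightarrow> vec) set" where
  "Lin U V = {f. lin U V f \<and> (\<forall>x. x \<notin> U \<longrightarrow> f x = 0)}"

lemma finite_Lin: "subg U \<Longrightarrow> subg V \<Longrightarrow> finite (Lin U V)"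
proof -
  assume "subg U" "subg V"
  then have "finite {f. \<forall>x. (x \<in> U \<longrightarrow> f x \<in> V) \<and> (x \<notin> U \<longrightarrow> f x = 0)}"
    by (intro finite_set_of_finite_funs) (auto simp: subgD)
  then show ?thesis by (rule rev_finite_subset) (auto simp: Lin_def linD)
qed

lemma Lin_0: "subg V \<Longrightarrow> Lin {0} V = {\<lambda>_. 0}"
proof (intro set_eqI iffI)
  fix f assume "subg V" "f \<in> Lin {0} V"
  then have "f x = 0" for x using lin_0[of "{0}" V f] by (cases "x = 0") (auto simp: Lin_def)
  then show "f \<in> {\<lambda>_. 0}" by auto
qed (auto simp: Lin_def lin_def subgD)

text \<open>A linear map on \<open>W\<close> enlarged by the coset of \<open>v\<close> amounts to a
  linear map on \<open>W\<close> and an arbitrary image of \<open>v\<close>; \<open>R\<close> and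
  \<open>E\<close> are the two directions of this bijection.\<close>

lemma card_Lin:
  assumes "subg U" "subg V" shows "card (Lin U V) = 2 ^ (dimv U * dimv V)"
proof -
  have "{0} \<subseteq> U" using assms by (simp add: subgD)
  with assms(1) subg_0 show ?thesis
  proof (induction rule: subg_induct)
    case base
    show ?case by (simp add: Lin_0[OF assms(2)])
  next
    case (step W v)
    let ?W = "W \<union> (+) v ` W"
    have W: "subg ?W" by (rule subg_coset_union[OF step(1)])
    have vW: "v \<in> ?W" using subgD(2)[OF step(1)] by (metis UnI2 add.right_neutral imageI)
    define R where "R = (\<lambda>f :: vec \<Rightarrow> vec. (\<lambda>x. if x \<in> W then f x else 0, f v))"
    define E where "E = (\<lambda>(f :: vec \<Rightarrow> vec, w) x. if x \<in> ?W then if x \<in> W then f x else w + f (v + x) else 0)"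
    have "bij_betw R (Lin ?W V) (Lin W V \<times> V)"
    proof (rule bij_betwI[where g = E])
      show "R \<in> Lin ?W V \<rightarrow> Lin W V \<times> V"
      proof (rule funcsetI)
        fix f assume "f \<in> Lin ?W V"
        then have f: "lin ?W V f" by (simp add: Lin_def)
        have "lin W V (\<lambda>x. if x \<in> W then f x else 0)"
          using linD(1)[OF f] linD(2)[OF f] subgD(3)[OF step(1)] unfolding lin_def by simp
        then show "R f \<in> Lin W V \<times> V" using linD(1)[OF f vW] by (simp add: R_def Lin_def)
      qed
      show "E \<in> Lin W V \<times> V \<rightarrow> Lin ?W V"
      proof (rule funcsetI)
        fix fw assume "fw \<in> Lin W V \<times> V"
        then obtain f w where fw: "fw = (f, w)" "lin W V f" "w \<in> V" by (auto simp: Lin_def)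
        have *: "lin ?W V (\<lambda>x. if x \<in> W then f x else w + f (v + x))" (is "lin _ _ ?g")
          using lin_coset_extend(1)[OF step(1,5) fw(2) assms(2) fw(3)] .
        have E: "E fw x = ?g x" if "x \<in> ?W" for x using that unfolding E_def fw by simp
        have "lin ?W V (E fw)"
          unfolding lin_def
        proof (intro conjI ballI)
          fix x assume x: "x \<in> ?W"
          show "E fw x \<in> V" unfolding E[OF x] by (rule linD(1)[OF * x])
          fix y assume y: "y \<in> ?W"
          show "E fw (x + y) = E fw x + E fw y"
            unfolding E[OF x] E[OF y] E[OF subgD(3)[OF W x y]] by (rule linD(2)[OF * x y])
        qed
        then show "E fw \<in> Lin ?W V" by (simp add: fw Lin_def E_def)
      qed
    next
      fix f assume f: "f \<in> Lin ?W V"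
      then have lf: "lin ?W V f" by (simp add: Lin_def)
      show "E (R f) = f"
      proof
        fix x
        have "v + x \<in> W" if "x \<in> ?W" "x \<notin> W" using that by auto
        moreover have "f (v + x) = f v + f x" if "x \<in> ?W" using linD(2)[OF lf vW that] .
        moreover have "f x = 0" if "x \<notin> ?W" using that f by (simp add: Lin_def)
        ultimately show "E (R f) x = f x" by (simp add: E_def R_def)
      qed
    next
      fix y assume "y \<in> Lin W V \<times> V"
      then obtain f w where y: "y = (f, w)" "lin W V f" "\<forall>x. x \<notin> W \<longrightarrow> f x = 0" by (auto simp: Lin_def)
      have "E y v = w" using vW step(5) lin_0[OF y(2) subgD(2)[OF step(1)]] by (simp add: E_def y)
      moreover have "(\<lambda>x. if x \<in> W then E (f, w) x else 0) = f" using y(3) by (auto simp: E_def fun_eq_iff)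
      ultimately show "R (E y) = y" unfolding R_def y(1) by simp
    qed
    then have "card (Lin ?W V) = card (Lin W V) * card V"
      by (simp add: bij_betw_same_card card_cartesian_product)
    moreover have "dimv ?W = Suc (dimv W)"
      using card_coset_union[OF step(1,5)] card_dimv[OF step(1)] by (intro dimv_eqI) simp
    ultimately show ?case using step(6) card_dimv[OF assms(2)] by (simp add: power_add)
  qed
qed

text \<open>Packs a lexicographic order on pairs into one number; it serves the orders
  \<open>topo\<close> and \<open>pos'\<close> on vertices.\<close>

lemma lex_nat_less: "a < B \<Longrightarrow> b < B \<Longrightarrow> x * B + a < y * B + b \<longleftrightarrow> x < y \<or> x = y \<and> a < (b::nat)"
proof -
  assume B: "a < B" "b < B"
  have less: "x * B + a < y * B + b" if "x < y" "a < B" for x y a b :: nat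
  proof -
    have "Suc x * B \<le> y * B" using that(1) by (intro mult_le_mono1) simp
    then show ?thesis using that(2) by simp
  qed
  show ?thesis using less[of x y a b] less[of y x b a] B by (cases x y rule: linorder_cases) auto
qed

section \<open>Representations over the two-element field\<close>

text \<open>The last index of \<open>ac\<close> numbers the arrows between two given vertices, so
  parallel arrows act by independent maps.\<close>

datatype rep = Rep (sp: "nat \<Rightarrow> vec set") (ac: "nat \<Rightarrow> nat \<Rightarrow> nat \<Rightarrow> vec \<Rightarrow> vec")

locale quiver_reps =
  fixes n :: nat and Q :: quiver
begin

definition is_rep :: "rep \<Rightarrow> bool" where
  "is_rep M \<longleftrightarrow> (\<forall>i. subg (sp M i)) \<and> (\<forall>i\<ge>n. sp M i = {0}) \<and>
    (\<forall>i j c. c < Q i j \<longrightarrow> lin (sp M i) (sp M j) (ac M i j c))"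

definition C0 :: "rep \<Rightarrow> rep \<Rightarrow> (nat \<Rightarrow> vec \<Rightarrow> vec) \<Rightarrow> bool" where
  "C0 M N f \<longleftrightarrow> (\<forall>i. lin (sp M i) (sp N i) (f i))"

definition C1 :: "rep \<Rightarrow> rep \<Rightarrow> (nat \<Rightarrow> nat \<Rightarrow> nat \<Rightarrow> vec \<Rightarrow> vec) \<Rightarrow> bool" where
  "C1 M N g \<longleftrightarrow> (\<forall>i j c. c < Q i j \<longrightarrow> lin (sp M i) (sp N j) (g i j c))"

text \<open>The differential of a two-term complex from \<open>C0 M N\<close> to
  \<open>C1 M N\<close>: its kernel is Hom and its cokernel is Ext. In characteristic two the
  difference of the two composites is their sum.\<close>

definition del :: "rep \<Rightarrow> rep \<Rightarrow> (nat \<Rightarrow> vec \<Rightarrow> vec) \<Rightarrow> nat \<Rightarrow> nat \<Rightarrow> nat \<Rightarrow> vec \<Rightarrow> vec" where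
  "del M N f i j c x = ac N i j c (f i x) + f j (ac M i j c x)"

definition hom :: "rep \<Rightarrow> rep \<Rightarrow> (nat \<Rightarrow> vec \<Rightarrow> vec) \<Rightarrow> bool" where
  "hom M N f \<longleftrightarrow> C0 M N f \<and>
    (\<forall>i j c x. c < Q i j \<longrightarrow> x \<in> sp M i \<longrightarrow> f j (ac M i j c x) = ac N i j c (f i x))"

definition zero_on :: "rep \<Rightarrow> (nat \<Rightarrow> vec \<Rightarrow> vec) \<Rightarrow> bool" where
  "zero_on M f \<longleftrightarrow> (\<forall>i. \<forall>x\<in>sp M i. f i x = 0)"

definition onto :: "rep \<Rightarrow> rep \<Rightarrow> (nat \<Rightarrow> vec \<Rightarrow> vec) \<Rightarrow> bool" where
  "onto M N f \<longleftrightarrow> (\<forall>i. \<forall>y\<in>sp N i. \<exists>x\<in>sp M i. f i x = y)"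

definition monic :: "rep \<Rightarrow> (nat \<Rightarrow> vec \<Rightarrow> vec) \<Rightarrow> bool" where
  "monic M f \<longleftrightarrow> (\<forall>i. \<forall>x\<in>sp M i. f i x = 0 \<longrightarrow> x = 0)"

definition bdry :: "rep \<Rightarrow> rep \<Rightarrow> (nat \<Rightarrow> nat \<Rightarrow> nat \<Rightarrow> vec \<Rightarrow> vec) \<Rightarrow> bool" where
  "bdry M N g \<longleftrightarrow> (\<exists>f. C0 M N f \<and> (\<forall>i j c. c < Q i j \<longrightarrow> (\<forall>x\<in>sp M i. g i j c x = del M N f i j c x)))"

text \<open>A cocycle in \<open>C1 M N\<close> describes an extension of \<open>M\<close> by \<open>N\<close>; it splits iff it is a boundary.\<close>

definition Hom0 :: "rep \<Rightarrow> rep \<Rightarrow> bool" where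
  "Hom0 M N \<longleftrightarrow> (\<forall>f. hom M N f \<longrightarrow> zero_on M f)"

definition Ext0 :: "rep \<Rightarrow> rep \<Rightarrow> bool" where
  "Ext0 M N \<longleftrightarrow> (\<forall>g. C1 M N g \<longrightarrow> bdry M N g)"

definition ses :: "rep \<Rightarrow> rep \<Rightarrow> rep \<Rightarrow> (nat \<Rightarrow> vec \<Rightarrow> vec) \<Rightarrow> (nat \<Rightarrow> vec \<Rightarrow> vec) \<Rightarrow> bool" where
  "ses A B C p q \<longleftrightarrow> is_rep A \<and> is_rep B \<and> is_rep C \<and> hom A B p \<and> hom B C q \<and> monic A p \<and> onto B C q \<and>
    (\<forall>i. \<forall>b\<in>sp B i. q i b = 0 \<longleftrightarrow> b \<in> p i ` sp A i)"

lemma rep_subg: "is_rep M \<Longrightarrow> subg (sp M i)"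
  by (simp add: is_rep_def)

lemma rep_zero: "is_rep M \<Longrightarrow> 0 \<in> sp M i"
  by (simp add: rep_subg subgD)

lemma rep_add: "is_rep M \<Longrightarrow> x \<in> sp M i \<Longrightarrow> y \<in> sp M i \<Longrightarrow> x + y \<in> sp M i"
  by (simp add: rep_subg subgD)

lemma ac_in: "is_rep M \<Longrightarrow> c < Q i j \<Longrightarrow> x \<in> sp M i \<Longrightarrow> ac M i j c x \<in> sp M j"
  unfolding is_rep_def using linD(1) by blast

lemma ac_add: "is_rep M \<Longrightarrow> c < Q i j \<Longrightarrow> x \<in> sp M i \<Longrightarrow> y \<in> sp M i \<Longrightarrow>
  ac M i j c (x + y) = ac M i j c x + ac M i j c y"
  unfolding is_rep_def using linD(2) by blast

lemma ac_lin: "is_rep M \<Longrightarrow> c < Q i j \<Longrightarrow> lin (sp M i) (sp M j) (ac M i j c)"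
  unfolding is_rep_def by blast

lemma ac_0: "is_rep M \<Longrightarrow> c < Q i j \<Longrightarrow> ac M i j c 0 = 0"
  using lin_0[OF ac_lin rep_zero] .

lemma C0_lin: "C0 M N f \<Longrightarrow> lin (sp M i) (sp N i) (f i)"
  by (simp add: C0_def)

lemma C0_in: "C0 M N f \<Longrightarrow> x \<in> sp M i \<Longrightarrow> f i x \<in> sp N i"
  unfolding C0_def using linD(1) by blast

lemma C0_add: "C0 M N f \<Longrightarrow> x \<in> sp M i \<Longrightarrow> y \<in> sp M i \<Longrightarrow> f i (x + y) = f i x + f i y"
  unfolding C0_def using linD(2) by blast

lemma C0_0: "C0 M N f \<Longrightarrow> is_rep M \<Longrightarrow> f i 0 = 0"
  unfolding C0_def using lin_0 rep_zero by blast

lemma C1_lin: "C1 M N g \<Longrightarrow> c < Q i j \<Longrightarrow> lin (sp M i) (sp N j) (g i j c)"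
  unfolding C1_def by blast

lemma C1_in: "C1 M N g \<Longrightarrow> c < Q i j \<Longrightarrow> x \<in> sp M i \<Longrightarrow> g i j c x \<in> sp N j"
  unfolding C1_def using linD(1) by blast

lemma C1_add: "C1 M N g \<Longrightarrow> c < Q i j \<Longrightarrow> x \<in> sp M i \<Longrightarrow> y \<in> sp M i \<Longrightarrow>
  g i j c (x + y) = g i j c x + g i j c y"
  unfolding C1_def using linD(2) by blast

lemma C1_0: "C1 M N g \<Longrightarrow> is_rep M \<Longrightarrow> c < Q i j \<Longrightarrow> g i j c 0 = 0"
  unfolding C1_def using lin_0 rep_zero by blast

lemma hom_C0: "hom M N f \<Longrightarrow> C0 M N f"
  by (simp add: hom_def)

lemmas hom_in = C0_in[OF hom_C0] and hom_add = C0_add[OF hom_C0] and hom_0 = C0_0[OF hom_C0]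

lemma hom_ac: "hom M N f \<Longrightarrow> c < Q i j \<Longrightarrow> x \<in> sp M i \<Longrightarrow> f j (ac M i j c x) = ac N i j c (f i x)"
  by (simp add: hom_def)

lemma hom_del: "hom M N f \<longleftrightarrow> C0 M N f \<and> (\<forall>i j c x. c < Q i j \<longrightarrow> x \<in> sp M i \<longrightarrow> del M N f i j c x = 0)"
  by (auto simp: hom_def del_def vec_add_eq_0)

lemma C0_comp: "C0 L M f \<Longrightarrow> C0 M N g \<Longrightarrow> C0 L N (\<lambda>i x. g i (f i x))"
  unfolding C0_def using lin_comp by blast

lemma C0_sum: "C0 M N f \<Longrightarrow> C0 M N g \<Longrightarrow> is_rep N \<Longrightarrow> C0 M N (\<lambda>i x. f i x + g i x)"
  unfolding C0_def using lin_sum rep_subg by blast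

lemma C1_sum: "C1 M N f \<Longrightarrow> C1 M N g \<Longrightarrow> is_rep N \<Longrightarrow> C1 M N (\<lambda>i j c x. f i j c x + g i j c x)"
  unfolding C1_def using lin_sum rep_subg by blast

lemma C1_post: "C1 L M g \<Longrightarrow> C0 M N f \<Longrightarrow> C1 L N (\<lambda>i j c x. f j (g i j c x))"
  unfolding C0_def C1_def using lin_comp by blast

lemma C1_pre: "C0 L M f \<Longrightarrow> C1 M N g \<Longrightarrow> C1 L N (\<lambda>i j c x. g i j c (f i x))"
  unfolding C0_def C1_def using lin_comp by blast

lemma hom_comp: "hom L M f \<Longrightarrow> hom M N g \<Longrightarrow> hom L N (\<lambda>i x. g i (f i x))"
  using hom_in[of L M f] by (simp add: hom_def C0_comp[of L M f N g])

lemma hom_sum: "hom M N f \<Longrightarrow> hom M N g \<Longrightarrow> is_rep N \<Longrightarrow> hom M N (\<lambda>i x. f i x + g i x)"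
  using hom_in[of M N f] hom_in[of M N g] by (simp add: hom_def C0_sum ac_add[of N])

lemma hom_zero: "is_rep N \<Longrightarrow> hom M N (\<lambda>i x. 0)"
  by (simp add: hom_def C0_def lin_def rep_zero ac_0)

lemma hom_id: "hom M M (\<lambda>i x. x)"
  by (simp add: hom_def C0_def lin_def)

lemma del_C1:
  assumes "is_rep M" "is_rep N" "C0 M N f" shows "C1 M N (del M N f)"
  unfolding C1_def
proof (intro allI impI)
  fix i j c assume c: "c < Q i j"
  have "lin (sp M i) (sp N j) (\<lambda>x. ac N i j c (f i x))"
    by (rule lin_comp[OF C0_lin[OF assms(3)] ac_lin[OF assms(2) c]])
  moreover have "lin (sp M i) (sp N j) (\<lambda>x. f j (ac M i j c x))"
    by (rule lin_comp[OF ac_lin[OF assms(1) c] C0_lin[OF assms(3)]])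
  ultimately have "lin (sp M i) (sp N j) (\<lambda>x. ac N i j c (f i x) + f j (ac M i j c x))"
    by (rule lin_sum) (rule rep_subg[OF assms(2)])
  then show "lin (sp M i) (sp N j) (del M N f i j c)"
    by (simp add: del_def[abs_def])
qed

lemma del_sum: "is_rep N \<Longrightarrow> C0 M N f \<Longrightarrow> C0 M N g \<Longrightarrow> c < Q i j \<Longrightarrow> x \<in> sp M i \<Longrightarrow>
  del M N (\<lambda>i x. f i x + g i x) i j c x = del M N f i j c x + del M N g i j c x"
  by (simp add: del_def ac_add C0_in ac_simps)

lemma del_post: "is_rep M \<Longrightarrow> is_rep N \<Longrightarrow> C0 M N f \<Longrightarrow> hom N L h \<Longrightarrow> c < Q i j \<Longrightarrow> x \<in> sp M i \<Longrightarrow>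
  del M L (\<lambda>i x. h i (f i x)) i j c x = h j (del M N f i j c x)"
  by (simp add: del_def hom_ac hom_add C0_in ac_in)

lemma del_pre: "is_rep M \<Longrightarrow> hom M N h \<Longrightarrow> c < Q i j \<Longrightarrow> x \<in> sp M i \<Longrightarrow>
  del M L (\<lambda>i x. f i (h i x)) i j c x = del N L f i j c (h i x)"
  by (simp add: del_def hom_ac)

section \<open>Splittings, lifts and factorisations along short exact sequences\<close>

definition ses_splitting :: "rep \<Rightarrow> rep \<Rightarrow> rep \<Rightarrow> (nat \<Rightarrow> vec \<Rightarrow> vec) \<Rightarrow> (nat \<Rightarrow> vec \<Rightarrow> vec) \<Rightarrow>
    (nat \<Rightarrow> vec \<Rightarrow> vec) \<Rightarrow> (nat \<Rightarrow> vec \<Rightarrow> vec) \<Rightarrow> bool" where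
  "ses_splitting A B C p q s r \<longleftrightarrow> (\<forall>i. splitting (sp A i) (sp B i) (sp C i) (p i) (q i) (s i) (r i))"

lemma ses_splittingD:
  assumes "ses_splitting A B C p q s r"
  shows "C0 C B s" "C0 B A r" "\<And>i a. a \<in> sp A i \<Longrightarrow> r i (p i a) = a"
    "\<And>i c. c \<in> sp C i \<Longrightarrow> q i (s i c) = c" "\<And>i c. c \<in> sp C i \<Longrightarrow> r i (s i c) = 0"
    "\<And>i b. b \<in> sp B i \<Longrightarrow> p i (r i b) + s i (q i b) = b"
  using assms unfolding ses_splitting_def splitting_def C0_def by blast+

lemma ses_split:
  assumes "ses A B C p q" shows "\<exists>s r. ses_splitting A B C p q s r"
proof -
  have "\<exists>s r. splitting (sp A i) (sp B i) (sp C i) (p i) (q i) s r" for i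
    using assms unfolding ses_def hom_def C0_def is_rep_def monic_def onto_def
    by (intro lin_split) auto
  then show ?thesis unfolding ses_splitting_def by metis
qed

lemma sesD: assumes "ses A B C p q"
  shows "is_rep A" "is_rep B" "is_rep C" "hom A B p" "hom B C q" "monic A p" "onto B C q"
    "\<And>i b. b \<in> sp B i \<Longrightarrow> q i b = 0 \<longleftrightarrow> b \<in> p i ` sp A i"
  using assms by (auto simp: ses_def)

lemma ses_qp: "ses A B C p q \<Longrightarrow> a \<in> sp A i \<Longrightarrow> q i (p i a) = 0"
  using hom_in unfolding ses_def by (metis imageI)

text \<open>Lift along the linear section. The failure of this lift to commute with the arrows takes
  values in \<open>A\<close>, where \<open>Ext0 Z A\<close> writes it as a boundary; adding that
  cochain makes the lift a homomorphism.\<close>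

lemma ses_lift:
  assumes S: "ses A B C p q" and E: "Ext0 Z A" and Z: "is_rep Z" and f: "hom Z C f"
  shows "\<exists>h. hom Z B h \<and> (\<forall>i. \<forall>z\<in>sp Z i. q i (h i z) = f i z)"
proof -
  obtain s r where "ses_splitting A B C p q s r" using ses_split[OF S] by blast
  note sr = ses_splittingD[OF this]
  note S = sesD[OF S] ses_qp[OF S]
  let ?s = "\<lambda>i z. s i (f i z)"
  have s: "C0 Z B ?s" by (rule C0_comp[OF hom_C0[OF f] sr(1)])
  have "C1 Z A (\<lambda>i j c z. r j (del Z B ?s i j c z))"
    by (rule C1_post[OF del_C1[OF Z S(2) s] sr(2)])
  then obtain u where u: "C0 Z A u"
    and u2: "\<And>i j c z. c < Q i j \<Longrightarrow> z \<in> sp Z i \<Longrightarrow> r j (del Z B ?s i j c z) = del Z A u i j c z"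
    using E unfolding Ext0_def bdry_def by blast
  let ?h = "\<lambda>i z. ?s i z + p i (u i z)"
  have pu: "C0 Z B (\<lambda>i z. p i (u i z))" by (rule C0_comp[OF u hom_C0[OF S(4)]])
  have "del Z B ?h i j c z = 0" if c: "c < Q i j" "z \<in> sp Z i" for i j c z
  proof -
    have d: "del Z B ?s i j c z \<in> sp B j" by (rule C1_in[OF del_C1[OF Z S(2) s] c])
    have "q j (del Z B ?s i j c z) = del Z C (\<lambda>i z. q i (?s i z)) i j c z"
      by (rule del_post[OF Z S(2) s S(5) c, symmetric])
    also have "\<dots> = del Z C f i j c z"
      using c Z f by (simp add: del_def sr(4) hom_in ac_in)
    also have "\<dots> = 0" using f c by (simp add: hom_del)
    finally have "p j (r j (del Z B ?s i j c z)) = del Z B ?s i j c z"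
      using sr(6)[OF d] C0_0[OF sr(1) S(3)] by simp
    moreover have "del Z B (\<lambda>i z. p i (u i z)) i j c z = p j (del Z A u i j c z)"
      by (rule del_post[OF Z S(1) u S(4) c])
    ultimately show ?thesis using del_sum[OF S(2) s pu c] u2[OF c] by simp
  qed
  then have "hom Z B ?h" using C0_sum[OF s pu S(2)] by (simp add: hom_del)
  moreover have "q i (?h i z) = f i z" if "z \<in> sp Z i" for i z
    using that hom_add[OF S(5) C0_in[OF s that] C0_in[OF pu that]] sr(4) hom_in[OF f that]
      S(9)[OF C0_in[OF u that]] by simp
  ultimately show ?thesis by blast
qed

text \<open>Dual to \<open>ses_lift\<close>: the failure of the linear extension vanishes on the
  image of \<open>A\<close>, so it descends to \<open>C\<close> and is a boundary there.\<close>

lemma ses_extend: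
  assumes S: "ses A B C p q" and E: "Ext0 C Z" and Z: "is_rep Z" and f: "hom A Z f"
  shows "\<exists>h. hom B Z h \<and> (\<forall>i. \<forall>a\<in>sp A i. h i (p i a) = f i a)"
proof -
  obtain s r where "ses_splitting A B C p q s r" using ses_split[OF S] by blast
  note sr = ses_splittingD[OF this]
  note S = sesD[OF S] ses_qp[OF S]
  let ?s = "\<lambda>i b. f i (r i b)"
  have s: "C0 B Z ?s" by (rule C0_comp[OF sr(2) hom_C0[OF f]])
  have "C1 C Z (\<lambda>i j c z. del B Z ?s i j c (s i z))"
    by (rule C1_pre[OF sr(1) del_C1[OF S(2) Z s]])
  then obtain u where u: "C0 C Z u"
    and u2: "\<And>i j c z. c < Q i j \<Longrightarrow> z \<in> sp C i \<Longrightarrow> del B Z ?s i j c (s i z) = del C Z u i j c z"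
    using E unfolding Ext0_def bdry_def by blast
  let ?h = "\<lambda>i z. ?s i z + u i (q i z)"
  have pu: "C0 B Z (\<lambda>i z. u i (q i z))" by (rule C0_comp[OF hom_C0[OF S(5)] u])
  have "del B Z ?h i j c b = 0" if c: "c < Q i j" "b \<in> sp B i" for i j c b
  proof -
    have rb: "r i b \<in> sp A i" by (rule C0_in[OF sr(2) c(2)])
    have qb: "q i b \<in> sp C i" by (rule hom_in[OF S(5) c(2)])
    have "del B Z ?s i j c (p i (r i b)) = del A Z (\<lambda>i x. ?s i (p i x)) i j c (r i b)"
      by (rule del_pre[OF S(1,4) c(1) rb, symmetric])
    also have "\<dots> = del A Z f i j c (r i b)"
      using c(1) S(1) rb by (simp add: del_def sr(3) ac_in)
    also have "\<dots> = 0" using f c rb by (simp add: hom_del)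
    finally have "del B Z ?s i j c b = del B Z ?s i j c (s i (q i b))"
      using C1_add[OF del_C1[OF S(2) Z s] c(1) hom_in[OF S(4) rb] C0_in[OF sr(1) qb]] sr(6)[OF c(2)] by simp
    moreover have "del B Z (\<lambda>i z. u i (q i z)) i j c b = del C Z u i j c (q i b)"
      by (rule del_pre[OF S(2,5) c])
    ultimately show ?thesis using del_sum[OF Z s pu c] u2[OF c(1) qb] by simp
  qed
  then have "hom B Z ?h" using C0_sum[OF s pu Z] by (simp add: hom_del)
  moreover have "?h i (p i a) = f i a" if "a \<in> sp A i" for i a
    using that sr(3) S(9) C0_0[OF u S(3)] by simp
  ultimately show ?thesis by blast
qed

lemma ses_factor_left:
  assumes S: "ses A B C p q" and f: "hom Z B f" and 0: "\<And>i z. z \<in> sp Z i \<Longrightarrow> q i (f i z) = 0"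
  shows "\<exists>h. hom Z A h \<and> (\<forall>i. \<forall>z\<in>sp Z i. p i (h i z) = f i z)"
proof -
  obtain s r where "ses_splitting A B C p q s r" using ses_split[OF S] by blast
  note sr = ses_splittingD[OF this]
  note S = sesD[OF S] ses_qp[OF S]
  have pr: "p i (r i (f i z)) = f i z" if "z \<in> sp Z i" for i z
    using sr(6)[OF hom_in[OF f that]] 0[OF that] C0_0[OF sr(1) S(3)] by simp
  have "hom Z A (\<lambda>i z. r i (f i z))"
    unfolding hom_def
  proof (intro conjI allI impI)
    show "C0 Z A (\<lambda>i z. r i (f i z))" by (rule C0_comp[OF hom_C0[OF f] sr(2)])
    fix i j c z assume c: "c < Q i j" "z \<in> sp Z i"
    have rz: "r i (f i z) \<in> sp A i" by (rule C0_in[OF sr(2) hom_in[OF f c(2)]])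
    have "f j (ac Z i j c z) = p j (ac A i j c (r i (f i z)))"
      using hom_ac[OF f c] hom_ac[OF S(4) c(1) rz] pr[OF c(2)] by simp
    then show "r j (f j (ac Z i j c z)) = ac A i j c (r i (f i z))"
      using sr(3)[OF ac_in[OF S(1) c(1) rz]] by simp
  qed
  then show ?thesis using pr by (intro exI[of _ "\<lambda>i z. r i (f i z)"]) blast
qed

lemma ses_factor_right:
  assumes S: "ses A B C p q" and f: "hom B Z f" and 0: "\<And>i a. a \<in> sp A i \<Longrightarrow> f i (p i a) = 0"
  shows "\<exists>h. hom C Z h \<and> (\<forall>i. \<forall>b\<in>sp B i. h i (q i b) = f i b)"
proof -
  obtain s r where "ses_splitting A B C p q s r" using ses_split[OF S] by blast
  note sr = ses_splittingD[OF this]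
  note S = sesD[OF S] ses_qp[OF S]
  have fs: "f i (s i (q i b)) = f i b" if "b \<in> sp B i" for i b
    using hom_add[OF f hom_in[OF S(4) C0_in[OF sr(2) that]] C0_in[OF sr(1) hom_in[OF S(5) that]]]
      sr(6)[OF that] 0[OF C0_in[OF sr(2) that]] by simp
  have "hom C Z (\<lambda>i z. f i (s i z))"
    unfolding hom_def
  proof (intro conjI allI impI)
    show "C0 C Z (\<lambda>i z. f i (s i z))" by (rule C0_comp[OF sr(1) hom_C0[OF f]])
    fix i j c z assume c: "c < Q i j" "z \<in> sp C i"
    have sz: "s i z \<in> sp B i" by (rule C0_in[OF sr(1) c(2)])
    have "f j (s j (q j (ac B i j c (s i z)))) = f j (ac B i j c (s i z))"
      by (rule fs[OF ac_in[OF S(2) c(1) sz]])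
    then show "f j (s j (ac C i j c z)) = ac Z i j c (f i (s i z))"
      using hom_ac[OF f c(1) sz] hom_ac[OF S(5) c(1) sz] sr(4)[OF c(2)] by simp
  qed
  then show ?thesis using fs by (intro exI[of _ "\<lambda>i z. f i (s i z)"]) blast
qed

section \<open>Vanishing of Hom and Ext along short exact sequences\<close>

lemma Hom0D: "Hom0 M N \<Longrightarrow> hom M N f \<Longrightarrow> x \<in> sp M i \<Longrightarrow> f i x = 0"
  by (auto simp: Hom0_def zero_on_def)

lemma Hom0I: "(\<And>f i x. hom M N f \<Longrightarrow> x \<in> sp M i \<Longrightarrow> f i x = 0) \<Longrightarrow> Hom0 M N"
  by (auto simp: Hom0_def zero_on_def)

lemma Hom0_sub: "hom A B p \<Longrightarrow> monic A p \<Longrightarrow> Hom0 Z B \<Longrightarrow> Hom0 Z A"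
proof (rule Hom0I)
  fix f i x assume *: "hom A B p" "monic A p" "Hom0 Z B" "hom Z A f" "x \<in> sp Z i"
  then have "p i (f i x) = 0" using Hom0D hom_comp by blast
  then show "f i x = 0" using * hom_in unfolding monic_def by blast
qed

lemma Hom0_quot: "hom B C q \<Longrightarrow> onto B C q \<Longrightarrow> Hom0 B Z \<Longrightarrow> Hom0 C Z"
proof (rule Hom0I)
  fix f i x assume *: "hom B C q" "onto B C q" "Hom0 B Z" "hom C Z f" "x \<in> sp C i"
  then obtain b where "b \<in> sp B i" "x = q i b" unfolding onto_def by metis
  then show "f i x = 0" using Hom0D[OF *(3) hom_comp[OF *(1,4)]] by simp
qed

text \<open>Pieces of the long exact sequences. In the names \<open>left\<close> and
  \<open>right\<close> tell which argument carries the sequence, and \<open>start\<close>,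
  \<open>middle\<close>, \<open>end\<close> the term for which vanishing is concluded.\<close>

lemma Hom0_middle_right: 
  assumes S: "ses A B C p q" and "Hom0 Z A" "Hom0 Z C" shows "Hom0 Z B"
proof (rule Hom0I)
  fix f i x assume f: "hom Z B f" and x: "x \<in> sp Z i"
  have "q i (f i z) = 0" if "z \<in> sp Z i" for i z
    using Hom0D[OF assms(3) hom_comp[OF f sesD(5)[OF S]] that] .
  then obtain h where h: "hom Z A h" "\<forall>i. \<forall>z\<in>sp Z i. p i (h i z) = f i z"
    using ses_factor_left[OF S f] by blast
  then show "f i x = 0" using Hom0D[OF assms(2) h(1) x] hom_0[OF sesD(4,1)[OF S]] x by metis
qed

lemma Hom0_middle_left: 
  assumes S: "ses A B C p q" and "Hom0 A Z" "Hom0 C Z" shows "Hom0 B Z"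
proof (rule Hom0I)
  fix f i x assume f: "hom B Z f" and x: "x \<in> sp B i"
  have "f i (p i a) = 0" if "a \<in> sp A i" for i a
    using Hom0D[OF assms(2) hom_comp[OF sesD(4)[OF S] f] that] .
  then obtain h where h: "hom C Z h" "\<forall>i. \<forall>b\<in>sp B i. h i (q i b) = f i b"
    using ses_factor_right[OF S f] by blast
  then show "f i x = 0" using Hom0D[OF assms(3) h(1) hom_in[OF sesD(5)[OF S] x]] x by simp
qed

lemma Hom0_end_right: 
  assumes S: "ses A B C p q" and "is_rep Z" "Hom0 Z B" "Ext0 Z A" shows "Hom0 Z C"
proof (rule Hom0I)
  fix f i x assume f: "hom Z C f" and x: "x \<in> sp Z i"
  then obtain h where h: "hom Z B h" "\<forall>i. \<forall>z\<in>sp Z i. q i (h i z) = f i z"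
    using ses_lift[OF S assms(4,2)] by blast
  then show "f i x = 0" using Hom0D[OF assms(3) h(1) x] hom_0[OF sesD(5,2)[OF S]] x by metis
qed

lemma Hom0_start_left: 
  assumes S: "ses A B C p q" and "is_rep Z" "Hom0 B Z" "Ext0 C Z" shows "Hom0 A Z"
proof (rule Hom0I)
  fix f i x assume f: "hom A Z f" and x: "x \<in> sp A i"
  then obtain h where h: "hom B Z h" "\<forall>i. \<forall>a\<in>sp A i. h i (p i a) = f i a"
    using ses_extend[OF S assms(4,2)] by blast
  then show "f i x = 0" using Hom0D[OF assms(3) h(1) hom_in[OF sesD(4)[OF S] x]] x by simp
qed

lemma Ext0D: "Ext0 M N \<Longrightarrow> C1 M N g \<Longrightarrow>
  \<exists>f. C0 M N f \<and> (\<forall>i j c. c < Q i j \<longrightarrow> (\<forall>x\<in>sp M i. g i j c x = del M N f i j c x))"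
  by (auto simp: Ext0_def bdry_def)

lemma Ext0I: "(\<And>g. C1 M N g \<Longrightarrow>
  \<exists>f. C0 M N f \<and> (\<forall>i j c. c < Q i j \<longrightarrow> (\<forall>x\<in>sp M i. g i j c x = del M N f i j c x))) \<Longrightarrow> Ext0 M N"
  by (auto simp: Ext0_def bdry_def)

text \<open>The assumption \<open>lift\<close> says that the connecting map out of Hom(Z,C) is zero,
  so Ext(Z,A) embeds into Ext(Z,B).\<close>

lemma Ext0_start_right:
  assumes S: "ses A B C p q" and Z: "is_rep Z" and "Ext0 Z B"
    and lift: "\<And>f. hom Z C f \<Longrightarrow> \<exists>h. hom Z B h \<and> (\<forall>i. \<forall>z\<in>sp Z i. q i (h i z) = f i z)"
  shows "Ext0 Z A"
proof (rule Ext0I)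
  fix g assume g: "C1 Z A g"
  note q0 = ses_qp[OF S]
  obtain s r where "ses_splitting A B C p q s r" using ses_split[OF S] by blast
  note sr = ses_splittingD[OF this]
  note S' = S
  note S = sesD[OF S] 
  obtain u where u: "C0 Z B u" "\<And>i j c z. c < Q i j \<Longrightarrow> z \<in> sp Z i \<Longrightarrow> p j (g i j c z) = del Z B u i j c z"
    using Ext0D[OF assms(3) C1_post[OF g hom_C0[OF S(4)]]] by blast
  have "del Z C (\<lambda>i z. q i (u i z)) i j c z = 0" if c: "c < Q i j" "z \<in> sp Z i" for i j c z
    using del_post[OF Z S(2) u(1) S(5) c] u(2)[OF c, symmetric] q0[OF C1_in[OF g c]] by simp
  then have "hom Z C (\<lambda>i z. q i (u i z))"
    using C0_comp[OF u(1) hom_C0[OF S(5)]] by (simp add: hom_del)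
  from lift[OF this] obtain h where h: "hom Z B h" "\<And>i z. z \<in> sp Z i \<Longrightarrow> q i (h i z) = q i (u i z)"
    by blast
  let ?v = "\<lambda>i z. u i z + h i z"
  have v: "C0 Z B ?v" by (rule C0_sum[OF u(1) hom_C0[OF h(1)] S(2)])
  have "q i (?v i z) = 0" if "z \<in> sp Z i" for i z
    using hom_add[OF S(5) C0_in[OF u(1) that] hom_in[OF h(1) that]] h(2)[OF that] by simp
  then have prv: "p i (r i (?v i z)) = ?v i z" if "z \<in> sp Z i" for i z
    using sr(6)[OF C0_in[OF v that]] C0_0[OF sr(1) S(3)] that by simp
  let ?w = "\<lambda>i z. r i (?v i z)"
  have w: "C0 Z A ?w" by (rule C0_comp[OF v sr(2)])
  have "g i j c z = del Z A ?w i j c z" if c: "c < Q i j" "z \<in> sp Z i" for i j c z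
  proof -
    have "p j (del Z A ?w i j c z) = del Z B (\<lambda>i z. p i (?w i z)) i j c z"
      by (rule del_post[OF Z S(1) w S(4) c, symmetric])
    also have "\<dots> = del Z B ?v i j c z"
      using prv c ac_in[OF Z c] by (simp add: del_def)
    also have "\<dots> = p j (g i j c z)"
      using del_sum[OF S(2) u(1) hom_C0[OF h(1)] c] u(2)[OF c] h(1) c by (simp add: hom_del)
    finally show ?thesis
      using sr(3)[OF C1_in[OF g c]] sr(3)[OF C1_in[OF del_C1[OF Z S(1) w] c]] by simp
  qed
  with w show "\<exists>f. C0 Z A f \<and> (\<forall>i j c. c < Q i j \<longrightarrow> (\<forall>x\<in>sp Z i. g i j c x = del Z A f i j c x))"
    by blast
qed

text \<open>Here \<open>extend\<close> kills the connecting map out of Hom(A,Z), so Ext(C,Z) embeds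
  into Ext(B,Z).\<close>

lemma Ext0_end_left:
  assumes S: "ses A B C p q" and Z: "is_rep Z" and "Ext0 B Z"
    and extend: "\<And>f. hom A Z f \<Longrightarrow> \<exists>h. hom B Z h \<and> (\<forall>i. \<forall>a\<in>sp A i. h i (p i a) = f i a)"
  shows "Ext0 C Z"
proof (rule Ext0I)
  fix g assume g: "C1 C Z g"
  note q0 = ses_qp[OF S]
  obtain s r where "ses_splitting A B C p q s r" using ses_split[OF S] by blast
  note sr = ses_splittingD[OF this]
  note S = sesD[OF S] 
  obtain u where u: "C0 B Z u" "\<And>i j c z. c < Q i j \<Longrightarrow> z \<in> sp B i \<Longrightarrow> g i j c (q i z) = del B Z u i j c z"
    using Ext0D[OF assms(3) C1_pre[OF hom_C0[OF S(5)] g]] by blast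
  have "del A Z (\<lambda>i z. u i (p i z)) i j c z = 0" if c: "c < Q i j" "z \<in> sp A i" for i j c z
    using del_pre[OF S(1,4) c] u(2)[OF c(1) hom_in[OF S(4) c(2)], symmetric] q0[OF c(2)]
      C1_0[OF g S(3) c(1)] by simp
  then have "hom A Z (\<lambda>i z. u i (p i z))"
    using C0_comp[OF hom_C0[OF S(4)] u(1)] by (simp add: hom_del)
  from extend[OF this] obtain h where h: "hom B Z h" "\<And>i z. z \<in> sp A i \<Longrightarrow> h i (p i z) = u i (p i z)"
    by blast
  let ?v = "\<lambda>i z. u i z + h i z"
  have v: "C0 B Z ?v" by (rule C0_sum[OF u(1) hom_C0[OF h(1)] Z])
  have vs: "?v i b = ?v i (s i (q i b))" if "b \<in> sp B i" for i b
  proof -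
    have "?v i (p i (r i b)) = 0" using h(2)[OF C0_in[OF sr(2) that]] by simp
    then show ?thesis
      using C0_add[OF v hom_in[OF S(4) C0_in[OF sr(2) that]] C0_in[OF sr(1) hom_in[OF S(5) that]]]
        sr(6)[OF that] by simp
  qed
  let ?w = "\<lambda>i z. ?v i (s i z)"
  have w: "C0 C Z ?w" by (rule C0_comp[OF sr(1) v])
  have "g i j c z = del C Z ?w i j c z" if c: "c < Q i j" "z \<in> sp C i" for i j c z
  proof -
    have sz: "s i z \<in> sp B i" "q i (s i z) = z" using C0_in[OF sr(1)] sr(4) c by auto
    have "del C Z ?w i j c (q i (s i z)) = del B Z (\<lambda>i z. ?w i (q i z)) i j c (s i z)"
      by (rule del_pre[OF S(2,5) c(1) sz(1), symmetric])
    also have "\<dots> = del B Z ?v i j c (s i z)"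
      unfolding del_def vs[OF sz(1), symmetric] vs[OF ac_in[OF S(2) c(1) sz(1)], symmetric] ..
    also have "\<dots> = g i j c (q i (s i z))"
      using del_sum[OF Z u(1) hom_C0[OF h(1)] c(1) sz(1)] u(2)[OF c(1) sz(1)] h(1) c sz by (simp add: hom_del)
    finally show ?thesis using sz by simp
  qed
  with w show "\<exists>f. C0 C Z f \<and> (\<forall>i j c. c < Q i j \<longrightarrow> (\<forall>x\<in>sp C i. g i j c x = del C Z f i j c x))"
    by blast
qed

text \<open>Heredity in concrete form: elements of \<open>C1\<close> satisfy no cocycle condition,
  so any one of them lifts along a linear section, and Ext is right exact. \<open>Ext0_sub\<close>
  is the same fact in the first argument.\<close>

lemma Ext0_quot:
  assumes S: "ses A B C p q" and Z: "is_rep Z" and "Ext0 Z B" shows "Ext0 Z C"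
proof (rule Ext0I)
  fix g assume g: "C1 Z C g"
  obtain s r where "ses_splitting A B C p q s r" using ses_split[OF S] by blast
  note sr = ses_splittingD[OF this]
  note S = sesD[OF S]
  obtain u where u: "C0 Z B u" "\<And>i j c z. c < Q i j \<Longrightarrow> z \<in> sp Z i \<Longrightarrow> s j (g i j c z) = del Z B u i j c z"
    using Ext0D[OF assms(3) C1_post[OF g sr(1)]] by blast
  have "g i j c z = del Z C (\<lambda>i z. q i (u i z)) i j c z" if c: "c < Q i j" "z \<in> sp Z i" for i j c z
    using del_post[OF Z S(2) u(1) S(5) c] u(2)[OF c] sr(4)[OF C1_in[OF g c]] by simp
  with C0_comp[OF u(1) hom_C0[OF S(5)]]
  show "\<exists>f. C0 Z C f \<and> (\<forall>i j c. c < Q i j \<longrightarrow> (\<forall>x\<in>sp Z i. g i j c x = del Z C f i j c x))" by blast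
qed

lemma Ext0_sub:
  assumes S: "ses A B C p q" and Z: "is_rep Z" and "Ext0 B Z" shows "Ext0 A Z"
proof (rule Ext0I)
  fix g assume g: "C1 A Z g"
  obtain s r where "ses_splitting A B C p q s r" using ses_split[OF S] by blast
  note sr = ses_splittingD[OF this]
  note S = sesD[OF S]
  obtain u where u: "C0 B Z u" "\<And>i j c z. c < Q i j \<Longrightarrow> z \<in> sp B i \<Longrightarrow> g i j c (r i z) = del B Z u i j c z"
    using Ext0D[OF assms(3) C1_pre[OF sr(2) g]] by blast
  have "g i j c z = del A Z (\<lambda>i z. u i (p i z)) i j c z" if c: "c < Q i j" "z \<in> sp A i" for i j c z
    using del_pre[OF S(1,4) c] u(2)[OF c(1) hom_in[OF S(4) c(2)]] sr(3)[OF c(2)] by simp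
  with C0_comp[OF hom_C0[OF S(4)] u(1)]
  show "\<exists>f. C0 A Z f \<and> (\<forall>i j c. c < Q i j \<longrightarrow> (\<forall>x\<in>sp A i. g i j c x = del A Z f i j c x))" by blast
qed

lemma Ext0_middle_right:
  assumes S: "ses A B C p q" and Z: "is_rep Z" and "Ext0 Z A" "Ext0 Z C" shows "Ext0 Z B"
proof (rule Ext0I)
  fix g assume g: "C1 Z B g"
  obtain s r where "ses_splitting A B C p q s r" using ses_split[OF S] by blast
  note sr = ses_splittingD[OF this]
  note S = sesD[OF S]
  obtain u where u: "C0 Z C u" "\<And>i j c z. c < Q i j \<Longrightarrow> z \<in> sp Z i \<Longrightarrow> q j (g i j c z) = del Z C u i j c z"
    using Ext0D[OF assms(4) C1_post[OF g hom_C0[OF S(5)]]] by blast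
  let ?t = "\<lambda>i z. s i (u i z)"
  have t: "C0 Z B ?t" by (rule C0_comp[OF u(1) sr(1)])
  let ?g = "\<lambda>i j c z. g i j c z + del Z B ?t i j c z"
  have g': "C1 Z B ?g" by (rule C1_sum[OF g del_C1[OF Z S(2) t] S(2)])
  have "q j (?g i j c z) = 0" if c: "c < Q i j" "z \<in> sp Z i" for i j c z
  proof -
    have "q j (del Z B ?t i j c z) = del Z C (\<lambda>i z. q i (?t i z)) i j c z"
      by (rule del_post[OF Z S(2) t S(5) c, symmetric])
    also have "\<dots> = del Z C u i j c z"
      using C0_in[OF u(1)] c ac_in[OF Z c] by (simp add: del_def sr(4))
    finally show ?thesis
      using hom_add[OF S(5) C1_in[OF g c] C1_in[OF del_C1[OF Z S(2) t] c]] u(2)[OF c] by simp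
  qed
  then have pr: "p j (r j (?g i j c z)) = ?g i j c z" if "c < Q i j" "z \<in> sp Z i" for i j c z
    using sr(6)[OF C1_in[OF g' that]] C0_0[OF sr(1) S(3)] that by simp
  obtain v where v: "C0 Z A v" "\<And>i j c z. c < Q i j \<Longrightarrow> z \<in> sp Z i \<Longrightarrow> r j (?g i j c z) = del Z A v i j c z"
    using Ext0D[OF assms(3) C1_post[OF g' sr(2)]] by blast
  have pv: "C0 Z B (\<lambda>i z. p i (v i z))" by (rule C0_comp[OF v(1) hom_C0[OF S(4)]])
  have "g i j c z = del Z B (\<lambda>i z. p i (v i z) + ?t i z) i j c z" if c: "c < Q i j" "z \<in> sp Z i" for i j c z
    using del_sum[OF S(2) pv t c] del_post[OF Z S(1) v(1) S(4) c] pr[OF c] v(2)[OF c]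
    by (simp add: add.assoc)
  with C0_sum[OF pv t S(2)]
  show "\<exists>f. C0 Z B f \<and> (\<forall>i j c. c < Q i j \<longrightarrow> (\<forall>x\<in>sp Z i. g i j c x = del Z B f i j c x))" by blast
qed

lemma Ext0_middle_left:
  assumes S: "ses A B C p q" and Z: "is_rep Z" and "Ext0 A Z" "Ext0 C Z" shows "Ext0 B Z"
proof (rule Ext0I)
  fix g assume g: "C1 B Z g"
  obtain s r where "ses_splitting A B C p q s r" using ses_split[OF S] by blast
  note sr = ses_splittingD[OF this]
  note S = sesD[OF S]
  obtain u where u: "C0 A Z u" "\<And>i j c z. c < Q i j \<Longrightarrow> z \<in> sp A i \<Longrightarrow> g i j c (p i z) = del A Z u i j c z"
    using Ext0D[OF assms(3) C1_pre[OF hom_C0[OF S(4)] g]] by blast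
  let ?t = "\<lambda>i z. u i (r i z)"
  have t: "C0 B Z ?t" by (rule C0_comp[OF sr(2) u(1)])
  let ?g = "\<lambda>i j c z. g i j c z + del B Z ?t i j c z"
  have g': "C1 B Z ?g" by (rule C1_sum[OF g del_C1[OF S(2) Z t] Z])
  have g0: "?g i j c (p i a) = 0" if c: "c < Q i j" "a \<in> sp A i" for i j c a
  proof -
    have "del B Z ?t i j c (p i a) = del A Z (\<lambda>i z. ?t i (p i z)) i j c a"
      by (rule del_pre[OF S(1,4) c, symmetric])
    also have "\<dots> = del A Z u i j c a"
      using c ac_in[OF S(1) c] by (simp add: del_def sr(3))
    finally show ?thesis using u(2)[OF c] by simp
  qed
  have gs: "?g i j c b = ?g i j c (s i (q i b))" if c: "c < Q i j" "b \<in> sp B i" for i j c b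
    using C1_add[OF g' c(1) hom_in[OF S(4) C0_in[OF sr(2) c(2)]] C0_in[OF sr(1) hom_in[OF S(5) c(2)]]]
      sr(6)[OF c(2)] g0[OF c(1) C0_in[OF sr(2) c(2)]] by simp
  obtain v where v: "C0 C Z v" "\<And>i j c z. c < Q i j \<Longrightarrow> z \<in> sp C i \<Longrightarrow> ?g i j c (s i z) = del C Z v i j c z"
    using Ext0D[OF assms(4) C1_pre[OF sr(1) g']] by blast
  have pv: "C0 B Z (\<lambda>i z. v i (q i z))" by (rule C0_comp[OF hom_C0[OF S(5)] v(1)])
  have "g i j c b = del B Z (\<lambda>i z. v i (q i z) + ?t i z) i j c b" if c: "c < Q i j" "b \<in> sp B i" for i j c b
    using del_sum[OF Z pv t c] del_pre[OF S(2,5) c] gs[OF c] v(2)[OF c(1) hom_in[OF S(5) c(2)]]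
    by (metis add.commute vec_self_left)
  with C0_sum[OF pv t Z]
  show "\<exists>f. C0 B Z f \<and> (\<forall>i j c. c < Q i j \<longrightarrow> (\<forall>x\<in>sp B i. g i j c x = del B Z f i j c x))" by blast
qed

section \<open>Kernels, subrepresentations, quotients and extensions\<close>

definition ker :: "rep \<Rightarrow> (nat \<Rightarrow> vec \<Rightarrow> vec) \<Rightarrow> rep" where
  "ker M f = Rep (\<lambda>i. {x \<in> sp M i. f i x = 0}) (ac M)"

definition subfam :: "rep \<Rightarrow> (nat \<Rightarrow> vec set) \<Rightarrow> bool" where
  "subfam M U \<longleftrightarrow> (\<forall>i. subg (U i) \<and> U i \<subseteq> sp M i) \<and>
    (\<forall>i j c. c < Q i j \<longrightarrow> (\<forall>x\<in>U i. ac M i j c x \<in> U j))"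

text \<open>The block triangular action: \<open>A\<close> is the submodule of first components,
  \<open>C\<close> the quotient of second components, and \<open>g\<close> is the off-diagonal
  block.\<close>

definition ext :: "rep \<Rightarrow> rep \<Rightarrow> (nat \<Rightarrow> nat \<Rightarrow> nat \<Rightarrow> vec \<Rightarrow> vec) \<Rightarrow> rep" where
  "ext A C g = Rep (\<lambda>i. {z. fs z \<in> sp A i \<and> sn z \<in> sp C i})
    (\<lambda>i j c z. pr (ac A i j c (fs z) + g i j c (sn z)) (ac C i j c (sn z)))"

lemma sp_ker [simp]: "sp (ker M f) i = {x \<in> sp M i. f i x = 0}"
  and ac_ker [simp]: "ac (ker M f) = ac M"
  by (simp_all add: ker_def)

lemma sp_ext [simp]: "sp (ext A C g) i = {z. fs z \<in> sp A i \<and> sn z \<in> sp C i}"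
  and ac_ext [simp]: "ac (ext A C g) i j c z = pr (ac A i j c (fs z) + g i j c (sn z)) (ac C i j c (sn z))"
  by (simp_all add: ext_def)

lemma subfam_rep:
  assumes "is_rep M" "subfam M U" shows "is_rep (Rep U (ac M))"
  unfolding is_rep_def
proof (intro conjI allI impI)
  show "subg (sp (Rep U (ac M)) i)" for i using assms(2) by (simp add: subfam_def)
  show "sp (Rep U (ac M)) i = {0}" if "n \<le> i" for i
  proof -
    have "sp M i = {0}" "U i \<subseteq> sp M i" "0 \<in> U i"
      using assms that subgD(2)[of "U i"] unfolding subfam_def is_rep_def by blast+
    then show ?thesis by auto
  qed
  show "lin (sp (Rep U (ac M)) i) (sp (Rep U (ac M)) j) (ac (Rep U (ac M)) i j c)" if "c < Q i j" for i j c
    using assms(2) ac_add[OF assms(1) that] that unfolding lin_def subfam_def by (auto simp: subset_iff)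
qed

lemma subfam_incl: "subfam M U \<Longrightarrow> hom (Rep U (ac M)) M (\<lambda>i x. x)"
  unfolding hom_def C0_def lin_def subfam_def by auto

lemma subfam_ker:
  assumes "is_rep M" "is_rep N" "hom M N f" shows "subfam M (\<lambda>i. {x \<in> sp M i. f i x = 0})"
  unfolding subfam_def subg_def
  using assms subgD(1)[OF rep_subg[OF assms(1)]]
  by (auto simp: rep_zero hom_0 rep_add hom_add[OF assms(3)] ac_in hom_ac[OF assms(3)] ac_0)

lemma rep_ker: "is_rep M \<Longrightarrow> is_rep N \<Longrightarrow> hom M N f \<Longrightarrow> is_rep (ker M f)"
  unfolding ker_def using subfam_rep subfam_ker by blast

lemma ker_incl: "hom (ker M f) M (\<lambda>i x. x)"
  unfolding hom_def C0_def lin_def by auto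

lemma ses_ker:
  "is_rep M \<Longrightarrow> is_rep N \<Longrightarrow> hom M N f \<Longrightarrow> onto M N f \<Longrightarrow> ses (ker M f) M N (\<lambda>i x. x) f"
  by (auto simp: ses_def rep_ker ker_incl monic_def)

text \<open>The quotient is realised on the complement of \<open>U\<close> cut out by a linear
  retraction \<open>r\<close>, namely as the image of \<open>x + r x\<close>, so that no cosets
  occur. The action on it is that of \<open>M\<close> followed by \<open>q\<close>.\<close>

lemma subfam_quotient:
  assumes M: "is_rep M" and U: "subfam M U"
  shows "\<exists>C q. ses (Rep U (ac M)) M C (\<lambda>i x. x) q"
proof -
  have sU: "subg (U i)" "U i \<subseteq> sp M i" for i using U by (auto simp: subfam_def)
  have "\<exists>r. lin (sp M i) (U i) r \<and> (\<forall>x\<in>U i. r x = x)" for i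
  proof -
    have "lin (U i) (U i) (\<lambda>x. x)" by (simp add: lin_def)
    from lin_extend[OF rep_subg[OF M] sU(1) sU(2) this sU(1)] show ?thesis .
  qed
  then obtain r where r: "\<And>i. lin (sp M i) (U i) (r i)" "\<And>i x. x \<in> U i \<Longrightarrow> r i x = x" by metis
  have rU: "r i x \<in> U i" "r i x \<in> sp M i" if "x \<in> sp M i" for i x
    using linD(1)[OF r(1) that] sU(2) by auto
  define q where "q = (\<lambda>i x. x + r i x)"
  have qin: "q i x \<in> sp M i" if "x \<in> sp M i" for i x
    using that rU(2) M by (simp add: q_def rep_add)
  have qadd: "q i (x + y) = q i x + q i y" if "x \<in> sp M i" "y \<in> sp M i" for i x y
    using linD(2)[OF r(1) that] by (simp add: q_def ac_simps)
  have qU: "q i x = 0 \<longleftrightarrow> x \<in> U i" if "x \<in> sp M i" for i x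
    using r(2) rU(1)[OF that] by (auto simp: q_def vec_add_eq_0)
  have qlin: "lin (sp M i) (q i ` sp M i) (q i)" for i
    using qadd by (auto simp: lin_def)
  define C where "C = Rep (\<lambda>i. q i ` sp M i) (\<lambda>i j c x. q j (ac M i j c x))"
  have qac: "q j (ac M i j c (q i x)) = q j (ac M i j c x)" if "c < Q i j" "x \<in> sp M i" for i j c x
  proof -
    have "ac M i j c (r i x) \<in> U j" using U that rU(1)[OF that(2)] by (auto simp: subfam_def)
    moreover have "ac M i j c (r i x) \<in> sp M j" "ac M i j c x \<in> sp M j"
      using M that rU(2) by (auto simp: ac_in)
    ultimately have "q j (ac M i j c x + ac M i j c (r i x)) = q j (ac M i j c x)"
      using qadd qU by simp
    then show ?thesis using ac_add[OF M that(1) that(2) rU(2)[OF that(2)]] by (simp add: q_def)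
  qed
  have repC: "is_rep C"
    unfolding is_rep_def
  proof (intro conjI allI impI)
    show "subg (sp C i)" for i using subg_image[OF rep_subg[OF M] qlin] by (simp add: C_def)
    show "sp C i = {0}" if "n \<le> i" for i
      using M that qU[of 0 i] subgD(2)[OF sU(1)] unfolding is_rep_def C_def by simp
    show "lin (sp C i) (sp C j) (ac C i j c)" if c: "c < Q i j" for i j c
      unfolding lin_def
    proof (intro conjI ballI)
      fix x assume "x \<in> sp C i"
      then obtain m where m: "m \<in> sp M i" "x = q i m" by (auto simp: C_def)
      show "ac C i j c x \<in> sp C j"
        using m c M qin by (auto simp: C_def ac_in)
      fix y assume "y \<in> sp C i"
      then obtain m' where m': "m' \<in> sp M i" "y = q i m'" by (auto simp: C_def)
      show "ac C i j c (x + y) = ac C i j c x + ac C i j c y"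
        using m(2) m'(2) ac_add[OF M c qin[OF m(1)] qin[OF m'(1)]]
          qadd[OF ac_in[OF M c qin[OF m(1)]] ac_in[OF M c qin[OF m'(1)]]] by (simp add: C_def)
    qed
  qed
  have homq: "hom M C q"
    unfolding hom_def C0_def using qlin qac by (simp add: C_def)
  have "ses (Rep U (ac M)) M C (\<lambda>i x. x) q"
    unfolding ses_def
    using M repC homq subfam_rep[OF M U] subfam_incl[OF U] qU
    by (auto simp: monic_def onto_def C_def)
  then show ?thesis by blast
qed

lemma subfam_image:
  assumes "is_rep A" "is_rep B" "hom A B f" shows "subfam B (\<lambda>i. f i ` sp A i)"
  unfolding subfam_def
proof (intro conjI allI impI ballI)
  show "subg (f i ` sp A i)" for i by (rule subg_image[OF rep_subg[OF assms(1)] C0_lin[OF hom_C0[OF assms(3)]]])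
  show "f i ` sp A i \<subseteq> sp B i" for i using hom_in[OF assms(3)] by auto
  fix i j c x assume "c < Q i j" "x \<in> f i ` sp A i"
  then show "ac B i j c x \<in> f j ` sp A j"
    using hom_ac[OF assms(3), symmetric] ac_in[OF assms(1)] by auto
qed

lemma monic_coker:
  assumes "is_rep A" "is_rep B" "hom A B f" "monic A f"
  shows "\<exists>C q. ses A B C f q"
proof -
  obtain C q where "ses (Rep (\<lambda>i. f i ` sp A i) (ac B)) B C (\<lambda>i x. x) q"
    using subfam_quotient[OF assms(2) subfam_image[OF assms(1-3)]] by blast
  then have "ses A B C f q" using assms by (simp add: ses_def)
  then show ?thesis by blast
qed

lemma subg_pairs: "subg U \<Longrightarrow> subg V \<Longrightarrow> subg {z. fs z \<in> U \<and> sn z \<in> V}"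
proof -
  assume U: "subg U" "subg V"
  have "{z. fs z \<in> U \<and> sn z \<in> V} = case_prod pr ` (U \<times> V)"
    by (auto simp: image_iff) (metis pr_fs_sn)
  then have "finite {z. fs z \<in> U \<and> sn z \<in> V}" using U by (simp add: subgD)
  then show ?thesis using U by (simp add: subg_def)
qed

lemma rep_ext:
  assumes "is_rep A" "is_rep C" "C1 C A g" shows "is_rep (ext A C g)"
  unfolding is_rep_def
proof (intro conjI allI impI)
  show "subg (sp (ext A C g) i)" for i using assms by (simp add: subg_pairs rep_subg)
  show "sp (ext A C g) i = {0}" if "n \<le> i" for i
  proof -
    have "sp A i = {0}" "sp C i = {0}" using assms(1,2) that by (simp_all add: is_rep_def)
    moreover have "z = 0" if "fs z = 0" "sn z = 0" for z using that pr_fs_sn[of z] by simp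
    ultimately show ?thesis by auto
  qed
  show "lin (sp (ext A C g) i) (sp (ext A C g) j) (ac (ext A C g) i j c)" if c: "c < Q i j" for i j c
    unfolding lin_def
  proof (intro conjI ballI)
    fix x assume x: "x \<in> sp (ext A C g) i"
    then show "ac (ext A C g) i j c x \<in> sp (ext A C g) j"
      using rep_add[OF assms(1) ac_in[OF assms(1) c] C1_in[OF assms(3) c]] ac_in[OF assms(2) c] by simp
    fix y assume y: "y \<in> sp (ext A C g) i"
    show "ac (ext A C g) i j c (x + y) = ac (ext A C g) i j c x + ac (ext A C g) i j c y"
      using x y by (simp add: pr_add ac_add[OF assms(1) c] ac_add[OF assms(2) c] C1_add[OF assms(3) c] ac_simps)
  qed
qed

lemma ses_ext:
  assumes "is_rep A" "is_rep C" "C1 C A g"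
  shows "ses A (ext A C g) C (\<lambda>i x. pr x 0) (\<lambda>i. sn)"
  unfolding ses_def
proof (intro conjI allI ballI)
  show "hom A (ext A C g) (\<lambda>i x. pr x 0)"
    using assms by (auto simp: hom_def C0_def lin_def rep_zero pr_add C1_0 ac_0)
  show "hom (ext A C g) C (\<lambda>i. sn)"
    by (auto simp: hom_def C0_def lin_def)
  show "monic A (\<lambda>i x. pr x 0)" by (simp add: monic_def)
  show "onto (ext A C g) C (\<lambda>i. sn)"
    unfolding onto_def
  proof (intro allI ballI)
    fix i y assume "y \<in> sp C i"
    then show "\<exists>x\<in>sp (ext A C g) i. sn x = y"
      using rep_zero[OF assms(1)] by (intro bexI[of _ "pr 0 y"]) auto
  qed
  fix i b assume b: "b \<in> sp (ext A C g) i"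
  show "sn b = 0 \<longleftrightarrow> b \<in> (\<lambda>x. pr x 0) ` sp A i"
  proof
    assume "sn b = 0"
    then have "b = pr (fs b) 0" using pr_fs_sn[of b] by simp
    then show "b \<in> (\<lambda>x. pr x 0) ` sp A i" using b by auto
  qed auto
qed (use assms rep_ext in auto)

text \<open>A retraction onto \<open>A\<close>, evaluated on the second components, is a cochain
  whose boundary is \<open>g\<close>.\<close>

lemma ext_nonsplit:
  assumes A: "is_rep A" and C: "is_rep C" and g: "C1 C A g" and nb: "\<not> bdry C A g"
    and f: "hom (ext A C g) A f" and id: "\<And>i x. x \<in> sp A i \<Longrightarrow> f i (pr x 0) = x"
  shows False
proof -
  let ?u = "\<lambda>i x. f i (pr 0 x)"
  have c0: "C0 C A ?u"
    unfolding C0_def lin_def using hom_in[OF f] hom_add[OF f] rep_zero[OF A]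
    by (auto simp flip: pr_add[of 0 _ 0, simplified])
  have "g i j c x = del C A ?u i j c x" if c: "c < Q i j" "x \<in> sp C i" for i j c x
  proof -
    have "f j (ac (ext A C g) i j c (pr 0 x)) = ac A i j c (f i (pr 0 x))"
      using c rep_zero[OF A] by (intro hom_ac[OF f]) auto
    moreover have "ac (ext A C g) i j c (pr 0 x) = pr (g i j c x) 0 + pr 0 (ac C i j c x)"
      using c by (simp add: ac_0[OF A] pr_add)
    moreover have "f j (pr (g i j c x) 0 + pr 0 (ac C i j c x)) = f j (pr (g i j c x) 0) + f j (pr 0 (ac C i j c x))"
      using c rep_zero[OF A] rep_zero[OF C] C1_in[OF g c] ac_in[OF C c] by (intro hom_add[OF f]) auto
    ultimately have "g i j c x + f j (pr 0 (ac C i j c x)) = ac A i j c (f i (pr 0 x))"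
      using id[OF C1_in[OF g c]] by simp
    then show ?thesis unfolding del_def by (metis add.commute vec_self_left)
  qed
  with c0 nb show False unfolding bdry_def by blast
qed

section \<open>Bricks, perpendicularity and dimension vectors\<close>

definition nonzero :: "rep \<Rightarrow> bool" where
  "nonzero M \<longleftrightarrow> (\<exists>i. \<exists>x\<in>sp M i. x \<noteq> 0)"

definition brick :: "rep \<Rightarrow> bool" where
  "brick M \<longleftrightarrow> is_rep M \<and> nonzero M \<and>
    (\<forall>f. hom M M f \<longrightarrow> zero_on M f \<or> (\<forall>i. \<forall>x\<in>sp M i. f i x = x))"

abbreviation perp :: "rep \<Rightarrow> rep \<Rightarrow> bool" where "perp A B \<equiv> Hom0 A B \<and> Ext0 A B"

definition dv :: "rep \<Rightarrow> nat \<Rightarrow> int" where "dv M i = int (dimv (sp M i))"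

definition eul :: "(nat \<Rightarrow> int) \<Rightarrow> (nat \<Rightarrow> int) \<Rightarrow> int" where
  "eul x y = (\<Sum>i<n. x i * y i) - (\<Sum>i<n. \<Sum>j<n. int (Q i j) * x i * y j)"

lemma dv_ses: "ses A B C p q \<Longrightarrow> dv B i = dv A i + dv C i"
proof -
  assume S: "ses A B C p q"
  then have "card (sp B i) = card (sp A i) * card (sp C i)"
    unfolding ses_def hom_def C0_def is_rep_def monic_def onto_def
    by (intro card_exact[where i = "p i" and p = "q i"]) auto
  then have "dimv (sp B i) = dimv (sp A i) + dimv (sp C i)"
    using sesD(1-3)[OF S] by (intro dimv_eqI) (simp add: rep_subg card_dimv power_add)
  then show ?thesis by (simp add: dv_def)
qed

lemma dv_nonneg: "0 \<le> dv M i" by (simp add: dv_def)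

lemma dv_outside: "is_rep M \<Longrightarrow> n \<le> i \<Longrightarrow> dv M i = 0"
  by (simp add: dv_def is_rep_def)

lemma dv_eq_0: "is_rep M \<Longrightarrow> dv M i = 0 \<longleftrightarrow> sp M i = {0}"
  by (simp add: dv_def dimv_eq_0 rep_subg)

lemma nonzero_dv: "is_rep M \<Longrightarrow> nonzero M \<longleftrightarrow> (\<exists>i. dv M i \<noteq> 0)"
  unfolding nonzero_def using dv_eq_0[of M] rep_zero[of M] by blast

section \<open>The Euler form\<close>

definition arrows :: "(nat \<times> nat \<times> nat) set" where
  "arrows = (SIGMA i:{..<n}. SIGMA j:{..<n}. {..<Q i j})"

text \<open>Many functions represent the same cochain in \<open>C0\<close> and \<open>C1\<close>.
  The extensional copies \<open>X0\<close> and \<open>X1\<close> contain each cochain once, so their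
  cardinalities are meaningful.\<close>

definition X0 :: "rep \<Rightarrow> rep \<Rightarrow> (nat \<Rightarrow> vec \<Rightarrow> vec) set" where
  "X0 M N = Pi\<^sub>E {..<n} (\<lambda>i. Lin (sp M i) (sp N i))"

definition X1 :: "rep \<Rightarrow> rep \<Rightarrow> (nat \<times> nat \<times> nat \<Rightarrow> vec \<Rightarrow> vec) set" where
  "X1 M N = Pi\<^sub>E arrows (\<lambda>(i, j, c). Lin (sp M i) (sp N j))"

definition dX :: "rep \<Rightarrow> rep \<Rightarrow> (nat \<Rightarrow> vec \<Rightarrow> vec) \<Rightarrow> nat \<times> nat \<times> nat \<Rightarrow> vec \<Rightarrow> vec" where
  "dX M N f = restrict (\<lambda>(i, j, c) x. if x \<in> sp M i then del M N f i j c x else 0) arrows"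

lemma finite_X: "is_rep M \<Longrightarrow> is_rep N \<Longrightarrow> finite (X0 M N)" "is_rep M \<Longrightarrow> is_rep N \<Longrightarrow> finite (X1 M N)"
  unfolding X0_def X1_def
  by (auto intro!: finite_PiE finite_Lin simp: rep_subg arrows_def)

text \<open>The Euler form is the difference of the dimensions of the two terms of the complex;
  hence injectivity or bijectivity of the differential bounds or determines it.\<close>

lemma card_X:
  assumes "is_rep M" "is_rep N"
  shows "\<exists>a b. card (X0 M N) = 2 ^ a \<and> card (X1 M N) = 2 ^ b \<and> eul (dv M) (dv N) = int a - int b"
proof (intro exI conjI)
  show "card (X0 M N) = 2 ^ (\<Sum>i<n. dimv (sp M i) * dimv (sp N i))"
    using assms by (simp add: X0_def card_PiE card_Lin rep_subg power_sum)
  show "card (X1 M N) = 2 ^ (\<Sum>(i, j, c)\<in>arrows. dimv (sp M i) * dimv (sp N j))"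
    using assms by (simp add: X1_def card_PiE card_Lin rep_subg power_sum arrows_def case_prod_unfold)
  have "(\<Sum>(i, j, c)\<in>arrows. dimv (sp M i) * dimv (sp N j)) =
      (\<Sum>i<n. \<Sum>j<n. Q i j * (dimv (sp M i) * dimv (sp N j)))"
    unfolding arrows_def by (simp flip: sum.Sigma)
  then show "eul (dv M) (dv N) = int (\<Sum>i<n. dimv (sp M i) * dimv (sp N i)) -
      int (\<Sum>(i, j, c)\<in>arrows. dimv (sp M i) * dimv (sp N j))"
    by (simp add: eul_def dv_def mult.assoc)
qed

end

section \<open>Counting along the differential: Euler form versus Hom and Ext\<close>

locale acyclic_reps = quiver_reps +
  assumes cq: "cluster_quiver n Q" and acy: "acyclic_quiver Q"
begin

lemma arrow_less: "c < Q i j \<Longrightarrow> i < n" "c < Q i j \<Longrightarrow> j < n"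
  using cq unfolding cluster_quiver_def by (metis gr_implies_not0 neq0_conv)+

lemma in_arrows: "(i, j, c) \<in> arrows \<longleftrightarrow> c < Q i j"
  using arrow_less by (auto simp: arrows_def)

text \<open>\<open>hat\<close> and \<open>trunc\<close> translate between extensional cochains and
  the functions in \<open>C0\<close>. The value 0 beyond \<open>n\<close> is harmless because all
  spaces there are zero.\<close>

definition hat :: "(nat \<Rightarrow> vec \<Rightarrow> vec) \<Rightarrow> nat \<Rightarrow> vec \<Rightarrow> vec" where
  "hat f i = (if i < n then f i else (\<lambda>_. 0))"

definition trunc :: "rep \<Rightarrow> (nat \<Rightarrow> vec \<Rightarrow> vec) \<Rightarrow> nat \<Rightarrow> vec \<Rightarrow> vec" where
  "trunc M f = restrict (\<lambda>i x. if x \<in> sp M i then f i x else 0) {..<n}"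

lemma hat_C0: "is_rep M \<Longrightarrow> is_rep N \<Longrightarrow> f \<in> X0 M N \<Longrightarrow> C0 M N (hat f)"
  unfolding C0_def X0_def is_rep_def by (auto simp: hat_def Lin_def PiE_def Pi_def lin_def)

lemma trunc_X0:
  assumes "is_rep M" "C0 M N f" shows "trunc M f \<in> X0 M N"
  unfolding X0_def
proof (rule PiE_I)
  fix i assume "i \<in> {..<n}"
  then have "trunc M f i = (\<lambda>x. if x \<in> sp M i then f i x else 0)" by (simp add: trunc_def)
  moreover have "lin (sp M i) (sp N i) (\<lambda>x. if x \<in> sp M i then f i x else 0)"
    using C0_in[OF assms(2)] C0_add[OF assms(2)] rep_add[OF assms(1)] by (simp add: lin_def)
  ultimately show "trunc M f i \<in> Lin (sp M i) (sp N i)" by (simp add: Lin_def)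
qed (simp add: trunc_def)

lemma X0_eqI:
  assumes "f \<in> X0 M N" "f' \<in> X0 M N" "\<And>i x. i < n \<Longrightarrow> x \<in> sp M i \<Longrightarrow> f i x = f' i x" shows "f = f'"
proof (rule PiE_ext[OF assms(1,2)[unfolded X0_def]])
  fix i assume i: "i \<in> {..<n}"
  have "f i x = f' i x" for x
    using assms i by (cases "x \<in> sp M i") (auto simp: X0_def PiE_def Pi_def Lin_def)
  then show "f i = f' i" by blast
qed

lemma dX_apply: "c < Q i j \<Longrightarrow> x \<in> sp M i \<Longrightarrow> dX M N f (i, j, c) x = del M N (hat f) i j c x"
  using arrow_less[of c i j] by (simp add: dX_def in_arrows del_def hat_def)

lemma dX_eqI: "(\<And>i j c x. c < Q i j \<Longrightarrow> x \<in> sp M i \<Longrightarrow> del M N (hat f) i j c x = g (i, j, c) x) \<Longrightarrow>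
  g \<in> X1 M N \<Longrightarrow> dX M N f = g"
proof
  fix a :: "nat \<times> nat \<times> nat" assume d: "\<And>i j c x. c < Q i j \<Longrightarrow> x \<in> sp M i \<Longrightarrow> del M N (hat f) i j c x = g (i, j, c) x"
    and g: "g \<in> X1 M N"
  obtain i j c where a: "a = (i, j, c)" by (cases a)
  show "dX M N f a = g a"
  proof (cases "c < Q i j")
    case False
    then show ?thesis using g unfolding a X1_def by (auto simp: dX_def in_arrows PiE_def extensional_def)
  next
    case True
    have "dX M N f a x = g a x" for x
    proof (cases "x \<in> sp M i")
      case True
      then show ?thesis using dX_apply[OF \<open>c < Q i j\<close> True] d[OF \<open>c < Q i j\<close> True] a by simp
    next
      case False
      have "g (i, j, c) \<in> Lin (sp M i) (sp N j)"
        using g \<open>c < Q i j\<close> unfolding X1_def by (auto simp: PiE_def Pi_def in_arrows)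
      then show ?thesis using False \<open>c < Q i j\<close> by (simp add: a dX_def in_arrows Lin_def)
    qed
    then show ?thesis by blast
  qed
qed

lemma dX_in:
  assumes "is_rep M" "is_rep N" "f \<in> X0 M N" shows "dX M N f \<in> X1 M N"
  unfolding X1_def
proof (rule PiE_I)
  fix a assume "a \<in> arrows"
  then obtain i j c where a: "a = (i, j, c)" "c < Q i j" by (metis in_arrows prod_cases3)
  have d: "lin (sp M i) (sp N j) (del M N (hat f) i j c)"
    by (rule C1_lin[OF del_C1[OF assms(1,2) hat_C0[OF assms]] a(2)])
  have "lin (sp M i) (sp N j) (dX M N f a)"
    unfolding a lin_def
  proof (intro conjI ballI)
    fix x assume x: "x \<in> sp M i"
    then show "dX M N f (i, j, c) x \<in> sp N j" using linD(1)[OF d] a(2) by (simp add: dX_apply)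
    fix y assume y: "y \<in> sp M i"
    show "dX M N f (i, j, c) (x + y) = dX M N f (i, j, c) x + dX M N f (i, j, c) y"
      using linD(2)[OF d x y] by (simp add: dX_apply a(2) x y rep_add[OF assms(1)])
  qed
  moreover have "dX M N f a x = 0" if "x \<notin> sp M i" for x
    using that a by (simp add: dX_def in_arrows)
  ultimately show "dX M N f a \<in> (case a of (i, j, c) \<Rightarrow> Lin (sp M i) (sp N j))"
    by (simp add: a Lin_def)
qed (simp add: dX_def)

lemma dX_eq_hom:
  assumes "is_rep M" "is_rep N" "f \<in> X0 M N" "f' \<in> X0 M N" "dX M N f = dX M N f'"
  shows "hom M N (\<lambda>i x. hat f i x + hat f' i x)"
proof -
  note c = hat_C0[OF assms(1,2,3)] hat_C0[OF assms(1,2,4)]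
  have "del M N (\<lambda>i x. hat f i x + hat f' i x) i j c x = 0" if "c < Q i j" "x \<in> sp M i" for i j c x
    using del_sum[OF assms(2) c that] dX_apply[OF that, of N f] dX_apply[OF that, of N f'] assms(5) by simp
  then show ?thesis using C0_sum[OF c assms(2)] by (simp add: hom_del)
qed

lemma dX_surj:
  assumes "is_rep M" "is_rep N" "Ext0 M N" "g \<in> X1 M N" shows "\<exists>f\<in>X0 M N. dX M N f = g"
proof -
  have "C1 M N (\<lambda>i j c. g (i, j, c))"
    unfolding C1_def
  proof (intro allI impI)
    fix i j c assume "c < Q i j"
    then have "(i, j, c) \<in> arrows" by (simp add: in_arrows)
    from PiE_mem[OF assms(4)[unfolded X1_def] this] show "lin (sp M i) (sp N j) (g (i, j, c))"
      by (simp add: Lin_def)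
  qed
  then obtain f where f: "C0 M N f" "\<And>i j c x. c < Q i j \<Longrightarrow> x \<in> sp M i \<Longrightarrow> g (i, j, c) x = del M N f i j c x"
    using Ext0D[OF assms(3)] by blast
  have h: "hat (trunc M f) i x = f i x" if "i < n" "x \<in> sp M i" for i x
    using that by (simp add: hat_def trunc_def)
  have "dX M N (trunc M f) = g"
  proof (rule dX_eqI[OF _ assms(4)])
    fix i j c x assume c: "c < Q i j" "x \<in> sp M i"
    show "del M N (hat (trunc M f)) i j c x = g (i, j, c) x"
      using f(2)[OF c] h c arrow_less[OF c(1)] ac_in[OF assms(1) c] by (simp add: del_def)
  qed
  then show ?thesis using trunc_X0[OF assms(1) f(1)] by blast
qed

lemma dX_inj:
  assumes "is_rep M" "is_rep N" "Hom0 M N" shows "inj_on (dX M N) (X0 M N)"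
proof (rule inj_onI)
  fix f f' assume f: "f \<in> X0 M N" "f' \<in> X0 M N" "dX M N f = dX M N f'"
  have "hat f i x + hat f' i x = 0" if "x \<in> sp M i" for i x
    by (rule Hom0D[OF assms(3) dX_eq_hom[OF assms(1,2) f] that])
  then show "f = f'" by (intro X0_eqI[OF f(1,2)]) (force simp: hat_def vec_add_eq_0)
qed

text \<open>Without homomorphisms the differential is injective; in \<open>eul_perp\<close> it is
  bijective.\<close>

lemma eul_Hom0:
  assumes "is_rep M" "is_rep N" "Hom0 M N" shows "eul (dv M) (dv N) \<le> 0"
proof -
  obtain a b where ab: "card (X0 M N) = 2 ^ a" "card (X1 M N) = 2 ^ b" "eul (dv M) (dv N) = int a - int b"
    using card_X[OF assms(1,2)] by blast
  have "card (X0 M N) \<le> card (X1 M N)"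
    using dX_in[OF assms(1,2)] by (intro card_inj_on_le[OF dX_inj[OF assms]] finite_X assms) auto
  then show ?thesis using ab by simp
qed

lemma eul_perp:
  assumes "is_rep M" "is_rep N" "perp M N" shows "eul (dv M) (dv N) = 0"
proof -
  obtain a b where ab: "card (X0 M N) = 2 ^ a" "card (X1 M N) = 2 ^ b" "eul (dv M) (dv N) = int a - int b"
    using card_X[OF assms(1,2)] by blast
  have "bij_betw (dX M N) (X0 M N) (X1 M N)"
    unfolding bij_betw_def
    using dX_in[OF assms(1,2)] dX_surj[OF assms(1,2)] dX_inj[OF assms(1,2)] assms(3) by blast
  then have "card (X0 M N) = card (X1 M N)" by (rule bij_betw_same_card)
  then show ?thesis using ab by simp
qed

lemma brickD: "brick M \<Longrightarrow> is_rep M" "brick M \<Longrightarrow> nonzero M"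
  "brick M \<Longrightarrow> hom M M f \<Longrightarrow> zero_on M f \<or> (\<forall>i. \<forall>x\<in>sp M i. f i x = x)"
  by (auto simp: brick_def)

text \<open>Rigidity makes the differential onto. Two cochains with equal boundary differ by an
  endomorphism, that is by zero or the identity, so every fibre has two elements and the dimensions
  differ by one.\<close>

lemma eul_brick:
  assumes "brick M" "Ext0 M M" shows "eul (dv M) (dv M) = 1"
proof -
  note M = brickD(1)[OF assms(1)]
  obtain a b where ab: "card (X0 M M) = 2 ^ a" "card (X1 M M) = 2 ^ b" "eul (dv M) (dv M) = int a - int b"
    using card_X[OF M M] by blast
  have fib: "card {f \<in> X0 M M. dX M M f = g} = 2" if g: "g \<in> X1 M M" for g
  proof -
    obtain f where f: "f \<in> X0 M M" "dX M M f = g" using dX_surj[OF M M assms(2) g] by blast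
    define f' where "f' = trunc M (\<lambda>i x. hat f i x + x)"
    have c0: "C0 M M (\<lambda>i x. hat f i x + x)"
      by (rule C0_sum[OF hat_C0[OF M M f(1)] hom_C0[OF hom_id] M])
    have f': "f' \<in> X0 M M" unfolding f'_def by (rule trunc_X0[OF M c0])
    have hf': "hat f' i x = hat f i x + x" if "i < n" "x \<in> sp M i" for i x
      using that by (simp add: hat_def f'_def trunc_def)
    have "dX M M f' = g"
    proof (rule dX_eqI[OF _ g])
      fix i j c x assume c: "c < Q i j" "x \<in> sp M i"
      have "del M M (hat f') i j c x = del M M (\<lambda>i x. hat f i x + x) i j c x"
        using hf' c arrow_less[OF c(1)] ac_in[OF M c] by (simp add: del_def)
      also have "\<dots> = del M M (hat f) i j c x + del M M (\<lambda>i x. x) i j c x"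
        by (rule del_sum[OF M hat_C0[OF M M f(1)] hom_C0[OF hom_id] c])
      also have "\<dots> = g (i, j, c) x"
        using dX_apply[OF c, of M f] f(2) by (simp add: del_def)
      finally show "del M M (hat f') i j c x = g (i, j, c) x" .
    qed
    moreover obtain i x where ix: "x \<in> sp M i" "x \<noteq> 0" using brickD(2)[OF assms(1)] by (auto simp: nonzero_def)
    then have "i < n" using M unfolding is_rep_def by (metis leI singletonD)
    then have "f i x \<noteq> f' i x" using ix hf'[OF \<open>i < n\<close> ix(1)] by (simp add: hat_def)
    then have "f \<noteq> f'" by auto
    moreover have "h = f \<or> h = f'" if h: "h \<in> X0 M M" "dX M M h = g" for h
    proof -
      have "hom M M (\<lambda>i x. hat h i x + hat f i x)" using dX_eq_hom[OF M M h(1) f(1)] h f by simp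
      from brickD(3)[OF assms(1) this] show ?thesis
      proof
        assume "zero_on M (\<lambda>i x. hat h i x + hat f i x)"
        then have "h = f" by (intro X0_eqI[OF h(1) f(1)]) (force simp: zero_on_def hat_def vec_add_eq_0)
        then show ?thesis ..
      next
        assume *: "\<forall>i. \<forall>x\<in>sp M i. hat h i x + hat f i x = x"
        have "hat h i x = hat f' i x" if "i < n" "x \<in> sp M i" for i x
          using * that hf'[OF that] by (metis add.commute vec_self_left)
        then have "h = f'" by (intro X0_eqI[OF h(1) f']) (simp add: hat_def)
        then show ?thesis ..
      qed
    qed
    ultimately have "{f \<in> X0 M M. dX M M f = g} = {f, f'}" using f f' by blast
    then show ?thesis using \<open>f \<noteq> f'\<close> by simp
  qed
  have "card (X0 M M) = (\<Sum>g\<in>X1 M M. \<Sum>f\<in>{f \<in> X0 M M. dX M M f = g}. 1)"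
    using dX_in[OF M M] by (subst sum.group) (auto simp: finite_X M)
  also have "\<dots> = 2 * card (X1 M M)" using fib by simp
  finally have "(2::nat) ^ a = 2 ^ Suc b" using ab by simp
  then have "a = Suc b" by (simp only: power_inject_exp[of "2::nat"])
  then show ?thesis using ab(3) by simp
qed

lemma eul_add_left: "eul (\<lambda>i. x i + m * y i) z = eul x z + m * eul y z"
  by (simp add: eul_def algebra_simps sum.distrib sum_distrib_left)

lemma eul_add_right: "eul z (\<lambda>i. x i + m * y i) = eul z x + m * eul z y"
  by (simp add: eul_def algebra_simps sum.distrib sum_distrib_left)

lemma eul_neg_left: "eul (\<lambda>i. - x i) z = - eul x z"
  by (simp add: eul_def sum_negf)

lemma eul_neg_right: "eul z (\<lambda>i. - x i) = - eul z x"
  by (simp add: eul_def sum_negf)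

section \<open>Two-out-of-three for perpendicularity\<close>

lemma perp_right_A: assumes S: "ses A B C p q" and W: "is_rep W" and "perp W B" "perp W C" shows "perp W A"
proof
  show "Hom0 W A" using Hom0_sub[OF sesD(4,6)[OF S]] assms(3) by blast
  show "Ext0 W A"
  proof (rule Ext0_start_right[OF S W])
    fix f assume f: "hom W C f"
    have "\<forall>i. \<forall>z\<in>sp W i. q i 0 = f i z"
      using Hom0D[OF _ f] assms(4) hom_0[OF sesD(5,2)[OF S]] by metis
    then show "\<exists>h. hom W B h \<and> (\<forall>i. \<forall>z\<in>sp W i. q i (h i z) = f i z)"
      using hom_zero[OF sesD(2)[OF S]] by (intro exI[of _ "\<lambda>i x. 0"]) blast
  qed (use assms(3) in blast)
qed

lemma perp_right_B: assumes S: "ses A B C p q" and W: "is_rep W" and "perp W A" "perp W C" shows "perp W B"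
  using assms Hom0_middle_right[OF S] Ext0_middle_right[OF S W] by blast

lemma perp_right_C: assumes S: "ses A B C p q" and W: "is_rep W" and "perp W A" "perp W B" shows "perp W C"
  using assms Hom0_end_right[OF S W] Ext0_quot[OF S W] by blast

lemma perp_left_A: assumes S: "ses A B C p q" and W: "is_rep W" and "perp B W" "perp C W" shows "perp A W"
  using assms Hom0_start_left[OF S W] Ext0_sub[OF S W] by blast

lemma perp_left_B: assumes S: "ses A B C p q" and W: "is_rep W" and "perp A W" "perp C W" shows "perp B W"
  using assms Hom0_middle_left[OF S] Ext0_middle_left[OF S W] by blast

lemma Ext0_end_left_Hom0:
  assumes S: "ses A B C p q" and W: "is_rep W" and "Hom0 A W" "Ext0 B W" shows "Ext0 C W"
proof (rule Ext0_end_left[OF S W])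
  fix f assume f: "hom A W f"
  have "\<forall>i. \<forall>a\<in>sp A i. 0 = f i a" using Hom0D[OF assms(3) f] by metis
  then show "\<exists>h. hom B W h \<and> (\<forall>i. \<forall>a\<in>sp A i. h i (p i a) = f i a)"
    using hom_zero[OF W] by (intro exI[of _ "\<lambda>i x. 0"]) blast
qed (use assms in blast)

lemma Ext0_start_right_Hom0:
  assumes S: "ses A B C p q" and W: "is_rep W" and "Ext0 W B" "Hom0 W C" shows "Ext0 W A"
proof (rule Ext0_start_right[OF S W])
  fix f assume f: "hom W C f"
  have "\<forall>i. \<forall>z\<in>sp W i. q i 0 = f i z"
    using Hom0D[OF assms(4) f] hom_0[OF sesD(5,2)[OF S]] by metis
  then show "\<exists>h. hom W B h \<and> (\<forall>i. \<forall>z\<in>sp W i. q i (h i z) = f i z)"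
    using hom_zero[OF sesD(2)[OF S]] by (intro exI[of _ "\<lambda>i x. 0"]) blast
qed (use assms(3) in blast)

lemma perp_left_C: assumes S: "ses A B C p q" and W: "is_rep W" and "perp A W" "perp B W" shows "perp C W"
  using assms Hom0_quot[OF sesD(5,7)[OF S]] Ext0_end_left_Hom0[OF S W] by blast

section \<open>Approximations and universal extensions\<close>

definition zrep :: "rep \<Rightarrow> bool" where "zrep P \<longleftrightarrow> is_rep P \<and> (\<forall>i. sp P i = {0})"

text \<open>Iterated extensions with \<open>r\<close> factors \<open>k\<close>. For exceptional
  \<open>k\<close> these are the sums of \<open>r\<close> copies of \<open>k\<close>, but the
  filtration gives the properties in \<open>Filt_props\<close> by induction without decomposing
  anything.\<close>

inductive Filt :: "rep \<Rightarrow> nat \<Rightarrow> rep \<Rightarrow> bool" for k where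
  Filt_0: "zrep P \<Longrightarrow> Filt k 0 P"
| Filt_Suc: "Filt k r P \<Longrightarrow> C1 P k g \<Longrightarrow> Filt k (Suc r) (ext k P g)"

lemma zrep_Hom0: "zrep P \<Longrightarrow> is_rep Z \<Longrightarrow> Hom0 P Z" "zrep P \<Longrightarrow> Hom0 Z P"
proof -
  assume P: "zrep P"
  show "Hom0 P Z" if "is_rep Z"
    by (rule Hom0I) (use P in \<open>auto simp: zrep_def hom_0\<close>)
  show "Hom0 Z P"
  proof (rule Hom0I)
    fix f i x assume "hom Z P f" "x \<in> sp Z i"
    from hom_in[OF this] show "f i x = 0" using P by (simp add: zrep_def)
  qed
qed

lemma zrep_Ext0: "zrep P \<Longrightarrow> is_rep Z \<Longrightarrow> Ext0 P Z" "zrep P \<Longrightarrow> is_rep Z \<Longrightarrow> Ext0 Z P"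
proof -
  assume P: "zrep P" and Z: "is_rep Z"
  then have P': "is_rep P" by (simp add: zrep_def)
  show "Ext0 P Z"
  proof (rule Ext0I)
    fix g assume g: "C1 P Z g"
    have "C0 P Z (\<lambda>i x. 0)" by (rule hom_C0[OF hom_zero[OF Z]])
    moreover have "g i j c x = del P Z (\<lambda>i x. 0) i j c x" if "c < Q i j" "x \<in> sp P i" for i j c x
      using that P C1_0[OF g P' that(1)] ac_0[OF Z that(1)] by (simp add: zrep_def del_def)
    ultimately show "\<exists>f. C0 P Z f \<and> (\<forall>i j c. c < Q i j \<longrightarrow> (\<forall>x\<in>sp P i. g i j c x = del P Z f i j c x))"
      by blast
  qed
  show "Ext0 Z P"
  proof (rule Ext0I)
    fix g assume g: "C1 Z P g"
    have "C0 Z P (\<lambda>i x. 0)" by (rule hom_C0[OF hom_zero[OF P']])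
    moreover have "g i j c x = del Z P (\<lambda>i x. 0) i j c x" if "c < Q i j" "x \<in> sp Z i" for i j c x
      using C1_in[OF g that] P ac_0[OF P' that(1)] by (simp add: zrep_def del_def)
    ultimately show "\<exists>f. C0 Z P f \<and> (\<forall>i j c. c < Q i j \<longrightarrow> (\<forall>x\<in>sp Z i. g i j c x = del Z P f i j c x))"
      by blast
  qed
qed

lemma Filt_props:
  assumes "Filt k r P" and k: "is_rep k"
  shows "is_rep P" "dv P i = int r * dv k i" "is_rep Z \<Longrightarrow> Hom0 k Z \<Longrightarrow> Hom0 P Z" "is_rep Z \<Longrightarrow> Hom0 Z k \<Longrightarrow> Hom0 Z P"
    "is_rep Z \<Longrightarrow> Ext0 k Z \<Longrightarrow> Ext0 P Z" "is_rep Z \<Longrightarrow> Ext0 Z k \<Longrightarrow> Ext0 Z P"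
  using assms(1)
proof (induction)
  case (Filt_0 P)
  {
    case 1 then show ?case using Filt_0 by (simp add: zrep_def)
  next
    case 2 then show ?case using Filt_0 by (simp add: zrep_def dv_def)
  next
    case 3 then show ?case using Filt_0 zrep_Hom0 by blast
  next
    case 4 then show ?case using Filt_0 zrep_Hom0 by blast
  next
    case 5 then show ?case using Filt_0 zrep_Ext0 by blast
  next
    case 6 then show ?case using Filt_0 zrep_Ext0 by blast
  }
next
  case (Filt_Suc r P g)
  note S = ses_ext[OF k Filt_Suc(3) Filt_Suc(2)]
  {
    case 1 then show ?case using sesD(2)[OF S] .
  next
    case 2 then show ?case using dv_ses[OF S] Filt_Suc(4) by (simp add: algebra_simps)
  next
    case 3 then show ?case using Hom0_middle_left[OF S] Filt_Suc.IH(3) by blast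
  next
    case 4 then show ?case using Hom0_middle_right[OF S] Filt_Suc.IH(4) by blast
  next
    case 5 then show ?case using Ext0_middle_left[OF S] Filt_Suc.IH(5) by blast
  next
    case 6 then show ?case using Ext0_middle_right[OF S] Filt_Suc.IH(6) by blast
  }
qed

lemma perp_Filt:
  assumes "Filt k r P" "is_rep k" "is_rep Z"
  shows "perp k Z \<Longrightarrow> perp P Z" "perp Z k \<Longrightarrow> perp Z P"
  using Filt_props[OF assms(1,2)] assms(3) by blast+

text \<open>The Happel--Ringel argument: by heredity the extension of the cokernel \<open>C\<close> by the image of \<open>u\<close>
  lifts along \<open>u\<close>, and it splits after pulling back to \<open>P\<close> because \<open>Ext0 P Y\<close>.\<close>

lemma monic_or_onto:
  assumes Y: "brick Y" and P: "is_rep P" and u: "hom Y P u" and E: "Ext0 P Y"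
    and H: "\<And>C q. ses (Rep (\<lambda>i. u i ` sp Y i) (ac P)) P C (\<lambda>i x. x) q \<Longrightarrow> Hom0 C P"
  shows "monic Y u \<or> onto Y P u"
proof -
  note Yr = brickD(1)[OF Y]
  define I where "I = Rep (\<lambda>i. u i ` sp Y i) (ac P)"
  have sf: "subfam P (\<lambda>i. u i ` sp Y i)" by (rule subfam_image[OF Yr P u])
  obtain C q where S0: "ses I P C (\<lambda>i x. x) q" using subfam_quotient[OF P sf] unfolding I_def by blast
  have HC: "Hom0 C P" using H S0 unfolding I_def by blast
  obtain t r where "ses_splitting I P C (\<lambda>i x. x) q t r" using ses_split[OF S0] by blast
  note tr = ses_splittingD[OF this]
  note S = sesD[OF S0]
  have uI: "hom Y I u" "onto Y I u"
    using u by (auto simp: hom_def C0_def lin_def onto_def I_def)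
  obtain s r' where "ses_splitting (ker Y u) Y I (\<lambda>i x. x) u s r'"
    using ses_split[OF ses_ker[OF Yr S(1) uI]] by blast
  note s = ses_splittingD(1,4)[OF this]
  have Cr: "is_rep C" by (rule S(3))
  have g: "C1 C P (del C P t)" by (rule del_C1[OF Cr P tr(1)])
  have gI: "del C P t i j c x \<in> sp I j" if c: "c < Q i j" "x \<in> sp C i" for i j c x
  proof -
    have "q j (del C P t i j c x) = del C C (\<lambda>i x. q i (t i x)) i j c x"
      by (rule del_post[OF Cr P tr(1) S(5) c, symmetric])
    also have "\<dots> = 0" using c ac_in[OF Cr c] by (simp add: del_def tr(4))
    finally show ?thesis using S(8)[OF C1_in[OF g c]] by simp
  qed
  have "C1 C I (del C P t)" unfolding C1_def lin_def
    using gI C1_add[OF g] by blast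
  from C1_post[OF this s(1)] have g': "C1 C Y (\<lambda>i j c x. s j (del C P t i j c x))" .
  from Ext0D[OF E C1_pre[OF hom_C0[OF S(5)] g']]
  obtain f where f: "C0 P Y f"
    "\<And>i j c x. c < Q i j \<Longrightarrow> x \<in> sp P i \<Longrightarrow> s j (del C P t i j c (q i x)) = del P Y f i j c x"
    by blast
  have "del Y Y (\<lambda>i x. f i (u i x)) i j c y = 0" if c: "c < Q i j" "y \<in> sp Y i" for i j c y
  proof -
    have "q i (u i y) = 0" using c(2) S(8)[OF hom_in[OF u c(2)]] by (auto simp: I_def)
    moreover have "del C P t i j c 0 = 0" by (rule C1_0[OF g Cr c(1)])
    moreover have "s j 0 = 0" by (rule C0_0[OF s(1) S(1)])
    ultimately show ?thesis using del_pre[OF Yr u c, of Y f] f(2)[OF c(1) hom_in[OF u c(2)]] by simp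
  qed
  then have "hom Y Y (\<lambda>i x. f i (u i x))"
    using C0_comp[OF hom_C0[OF u] f(1)] by (simp add: hom_del)
  from brickD(3)[OF Y this] show ?thesis
  proof
    assume "\<forall>i. \<forall>x\<in>sp Y i. f i (u i x) = x"
    then have "monic Y u" unfolding monic_def using C0_0[OF f(1) P] by metis
    then show ?thesis ..
  next
    assume z: "zero_on Y (\<lambda>i x. f i (u i x))"
    have fI: "f i x = 0" if "x \<in> sp I i" for i x using that z by (auto simp: I_def zero_on_def)
    \<comment> \<open>As \<open>f\<close> kills the image \<open>I\<close>, adding
      \<open>u f t\<close> to the linear section \<open>t\<close> cancels its defect and gives a
      homomorphism from \<open>C\<close> to \<open>P\<close>. It vanishes by assumption, and
      applying \<open>q\<close> then shows \<open>C = 0\<close>.\<close>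
    let ?v = "\<lambda>i c. u i (f i (t i c))"
    have ft: "C0 C Y (\<lambda>i c. f i (t i c))" by (rule C0_comp[OF tr(1) f(1)])
    have v: "C0 C P ?v" by (rule C0_comp[OF ft hom_C0[OF u]])
    have "del C P (\<lambda>i c. t i c + ?v i c) i j c x = 0" if c: "c < Q i j" "x \<in> sp C i" for i j c x
    proof -
      have tx: "t i x \<in> sp P i" "q i (t i x) = x" using C0_in[OF tr(1) c(2)] tr(4)[OF c(2)] by auto
      have acx: "ac C i j c x \<in> sp C j" by (rule ac_in[OF Cr c])
      have "ac P i j c (t i x) = t j (ac C i j c x) + del C P t i j c x"
        by (simp add: del_def ac_simps)
      then have "f j (ac P i j c (t i x)) = f j (t j (ac C i j c x))"
        using C0_add[OF f(1) C0_in[OF tr(1) acx] C1_in[OF g c]] fI[OF gI[OF c]] by simp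
      then have "del C Y (\<lambda>i c. f i (t i c)) i j c x = s j (del C P t i j c x)"
        using f(2)[OF c(1) tx(1)] tx(2) by (simp add: del_def)
      then have "del C P ?v i j c x = del C P t i j c x"
        using del_post[OF Cr Yr ft u c] s(2)[OF gI[OF c]] by simp
      then show ?thesis using del_sum[OF P tr(1) v c] by simp
    qed
    then have h: "hom C P (\<lambda>i c. t i c + ?v i c)"
      using C0_sum[OF tr(1) v P] by (simp add: hom_del)
    have "x = 0" if x: "x \<in> sp C i" for i x
    proof -
      have "t i x = ?v i x" using Hom0D[OF HC h x] by (simp add: vec_add_eq_0)
      moreover have "q i (?v i x) = 0"
        using S(8)[OF C0_in[OF v x]] C0_in[OF ft x] by (auto simp: I_def)
      ultimately show ?thesis using tr(4)[OF x] by simp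
    qed
    then have "\<exists>y\<in>sp Y i. u i y = x" if "x \<in> sp P i" for i x
      using S(8)[OF that] hom_in[OF S(5) that] by (auto simp: I_def)
    then have "onto Y P u" unfolding onto_def by blast
    then show ?thesis ..
  qed
qed

text \<open>\<open>indep\<close> says that composition with \<open>u\<close> is injective on
  Hom(P,k), and \<open>factors\<close> for all \<open>f\<close> that it is surjective onto Hom(Y,k).
  Together they describe the minimal left approximation of \<open>Y\<close> by modules filtered by
  \<open>k\<close>.\<close>

definition indep :: "rep \<Rightarrow> rep \<Rightarrow> rep \<Rightarrow> (nat \<Rightarrow> vec \<Rightarrow> vec) \<Rightarrow> bool" where
  "indep k Y P u \<longleftrightarrow> (\<forall>h. hom P k h \<and> (\<forall>i. \<forall>y\<in>sp Y i. h i (u i y) = 0) \<longrightarrow> zero_on P h)"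

definition factors :: "rep \<Rightarrow> rep \<Rightarrow> rep \<Rightarrow> (nat \<Rightarrow> vec \<Rightarrow> vec) \<Rightarrow> (nat \<Rightarrow> vec \<Rightarrow> vec) \<Rightarrow> bool" where
  "factors k Y P u f \<longleftrightarrow> (\<exists>h. hom P k h \<and> (\<forall>i. \<forall>y\<in>sp Y i. h i (u i y) = f i y))"

lemma C1_zero: "is_rep N \<Longrightarrow> C1 M N (\<lambda>i j c x. 0)"
  by (simp add: C1_def lin_def rep_zero)

text \<open>A map that does not factor becomes a new coordinate. Independence survives: a
  homomorphism from \<open>P'\<close> to \<open>k\<close> killing the image restricts to the new
  copy of \<open>k\<close> as zero or the identity, and the identity would factor \<open>f\<close>
  through the old \<open>u\<close>.\<close>

lemma approx_extend:
  assumes k: "brick k" and Y: "is_rep Y" and F: "Filt k r P" and u: "hom Y P u" and ind: "indep k Y P u"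
    and f: "hom Y k f" and nf: "\<not> factors k Y P u f"
  defines "P' \<equiv> ext k P (\<lambda>i j c x. 0)" and "u' \<equiv> (\<lambda>i y. pr (f i y) (u i y))"
  shows "Filt k (Suc r) P'" "hom Y P' u'" "indep k Y P' u'" "factors k Y P' u' f"
    "\<And>f'. factors k Y P u f' \<Longrightarrow> factors k Y P' u' f'"
proof -
  note kr = brickD(1)[OF k]
  note P = Filt_props(1)[OF F kr]
  show "Filt k (Suc r) P'" unfolding P'_def by (rule Filt_Suc[OF F C1_zero[OF kr]])
  show "hom Y P' u'"
    unfolding hom_def C0_def lin_def P'_def u'_def
    using hom_in[OF f] hom_in[OF u] hom_add[OF f] hom_add[OF u] hom_ac[OF f] hom_ac[OF u]
    by (auto simp: pr_add)
  have fsP: "hom P' k (\<lambda>i. fs)"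
    unfolding hom_def C0_def lin_def P'_def by auto
  have snP: "hom P' P (\<lambda>i. sn)"
    unfolding hom_def C0_def lin_def P'_def by auto
  show "factors k Y P' u' f" unfolding factors_def using fsP by (intro exI[of _ "\<lambda>i. fs"]) (simp add: u'_def)
  show "factors k Y P' u' f'" if "factors k Y P u f'" for f'
  proof -
    obtain h where h: "hom P k h" "\<forall>i. \<forall>y\<in>sp Y i. h i (u i y) = f' i y" using \<open>factors k Y P u f'\<close> unfolding factors_def by blast
    show ?thesis unfolding factors_def
      using hom_comp[OF snP h(1)] h(2) by (intro exI[of _ "\<lambda>i x. h i (sn x)"]) (simp add: u'_def)
  qed
  note S = ses_ext[OF kr P C1_zero[OF kr, of P], folded P'_def]
  have S1: "hom k P' (\<lambda>i x. pr x 0)" by (rule sesD(4)[OF S])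
  have S2: "hom P P' (\<lambda>i x. pr 0 x)"
    unfolding hom_def C0_def lin_def P'_def using ac_0[OF kr] by (auto simp: pr_add rep_zero[OF kr])
  show "indep k Y P' u'" unfolding indep_def
  proof (intro allI impI)
    fix h assume h: "hom P' k h \<and> (\<forall>i. \<forall>y\<in>sp Y i. h i (u' i y) = 0)"
    have split: "h i (pr a b) = h i (pr a 0) + h i (pr 0 b)" if "a \<in> sp k i" "b \<in> sp P i" for i a b
      using hom_add[of P' k h, OF _ hom_in[OF S1 that(1)] hom_in[OF S2 that(2)]] h by (simp add: pr_add)
    have hk: "hom k k (\<lambda>i x. h i (pr x 0))" by (rule hom_comp[OF S1]) (use h in blast)
    have hP: "hom P k (\<lambda>i x. h i (pr 0 x))" by (rule hom_comp[OF S2]) (use h in blast)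
    have eq: "h i (pr (f i y) 0) = h i (pr 0 (u i y))" if "y \<in> sp Y i" for i y
      using h that split[OF hom_in[OF f that] hom_in[OF u that]] by (auto simp: u'_def vec_add_eq_0)
    from brickD(3)[OF k hk] have zk: "zero_on k (\<lambda>i x. h i (pr x 0))"
    proof
      assume *: "\<forall>i. \<forall>x\<in>sp k i. h i (pr x 0) = x"
      have "h i (pr 0 (u i y)) = f i y" if "y \<in> sp Y i" for i y
        using * eq[OF that] hom_in[OF f that] by simp
      then have "factors k Y P u f" unfolding factors_def using hP by blast
      then show ?thesis using nf by blast
    qed
    then have "h i (pr 0 (u i y)) = 0" if "y \<in> sp Y i" for i y
      using eq[OF that] hom_in[OF f that] by (simp add: zero_on_def)
    then have "zero_on P (\<lambda>i x. h i (pr 0 x))"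
      using ind hP unfolding indep_def by blast
    then have "h i (pr (fs z) (sn z)) = 0" if "z \<in> sp P' i" for i z
      using that zk split[of "fs z" i "sn z"] by (auto simp: P'_def zero_on_def)
    then show "zero_on P' h" by (simp add: zero_on_def)
  qed
qed

text \<open>Among independent maps choose one through which the most elements of the finite set
  \<open>X0 Y k\<close> factor; \<open>approx_extend\<close> would improve on it if any map failed
  to factor.\<close>

lemma left_approx:
  assumes k: "brick k" and Y: "is_rep Y"
  shows "\<exists>r P u. Filt k r P \<and> hom Y P u \<and> indep k Y P u \<and> (\<forall>f. hom Y k f \<longrightarrow> factors k Y P u f)"
proof -
  note kr = brickD(1)[OF k]
  define A where "A = (\<lambda>P u. {f \<in> X0 Y k. factors k Y P u (hat f)})"
  have finA: "finite (A P u)" "card (A P u) \<le> card (X0 Y k)" for P u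
    unfolding A_def using finite_X(1)[OF Y kr] by (auto intro: card_mono)
  define G where "G = (\<lambda>m. \<exists>r P u. Filt k r P \<and> hom Y P u \<and> indep k Y P u \<and> card (A P u) = m)"
  define Z where "Z = Rep (\<lambda>_. {0}) (\<lambda>_ _ _ _. 0)"
  have Z: "zrep Z" unfolding zrep_def is_rep_def Z_def lin_def by simp
  have "hom Y Z (\<lambda>i x. 0)" using Z hom_zero by (simp add: zrep_def)
  moreover have "indep k Y Z (\<lambda>i x. 0)"
    unfolding indep_def using zrep_Hom0(1)[OF Z kr] by (simp add: Hom0_def)
  ultimately have G0: "G (card (A Z (\<lambda>i x. 0)))" unfolding G_def using Filt_0[OF Z] by blast
  have "\<forall>m'. G m' \<longrightarrow> m' < Suc (card (X0 Y k))" using finA(2) unfolding G_def by (auto simp: less_Suc_eq_le)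
  from ex_has_greatest_nat[of G _ "\<lambda>x. x", OF G0 this]
  obtain m where m: "G m" "\<And>m'. G m' \<Longrightarrow> m' \<le> m" by auto
  then obtain r P u where P: "Filt k r P" "hom Y P u" "indep k Y P u" "card (A P u) = m"
    unfolding G_def by blast
  have "factors k Y P u f" if f: "hom Y k f" for f
  proof (rule ccontr)
    assume nf: "\<not> factors k Y P u f"
    note E = approx_extend[OF k Y P(1-3) f nf]
    define P' u' where "P' = ext k P (\<lambda>i j c x. 0)" and "u' = (\<lambda>i y. pr (f i y) (u i y))"
    note E = E[folded P'_def u'_def]
    have t: "hat (trunc Y f) i y = f i y" if "y \<in> sp Y i" for i y
    proof (cases "i < n")
      case True then show ?thesis using that by (simp add: hat_def trunc_def)
    next
      case False
      then have "sp Y i = {0}" using Y by (simp add: is_rep_def)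
      then show ?thesis using that False hom_0[OF f Y] by (simp add: hat_def)
    qed
    have "A P u \<subseteq> A P' u'" using E(5) unfolding A_def by blast
    moreover have "trunc Y f \<in> A P' u'"
      unfolding A_def using trunc_X0[OF Y hom_C0[OF f]] E(4) t by (simp add: factors_def)
    moreover have "trunc Y f \<notin> A P u"
      unfolding A_def using nf t by (simp add: factors_def)
    ultimately have "card (A P u) < card (A P' u')" using finA(1) by (metis psubsetI psubset_card_mono)
    moreover have "G (card (A P' u'))" unfolding G_def using E(1-3) by blast
    ultimately show False using m(2) P(4) by fastforce
  qed
  then show ?thesis using P by blast
qed

section \<open>Exceptional modules and their exchange with respect to \<open>k\<close>\<close>

definition exc :: "rep \<Rightarrow> bool" where "exc M \<longleftrightarrow> brick M \<and> Ext0 M M"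

text \<open>The last two conjuncts let \<open>L\<close> replace \<open>Z\<close> in an exceptional
  sequence without disturbing modules perpendicular to both \<open>Z\<close> and
  \<open>k\<close>.\<close>

definition mutd :: "rep \<Rightarrow> rep \<Rightarrow> rep \<Rightarrow> bool" where
  "mutd k Z L \<longleftrightarrow> exc L \<and> perp L k \<and> (\<forall>W. is_rep W \<and> perp W Z \<and> perp W k \<longrightarrow> perp W L) \<and>
    (\<forall>W. is_rep W \<and> perp Z W \<and> perp k W \<longrightarrow> perp L W)"

text \<open>The approximation is monic or onto by \<open>monic_or_onto\<close>, and the new module
  is its cokernel or kernel. Bijectivity on maps to \<open>k\<close> makes this module perpendicular
  to \<open>k\<close>. Its endomorphisms are traced back to those of the brick \<open>Y\<close> by
  extending or lifting them, which is possible since \<open>Ext0 P Y\<close>.\<close>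

lemma red_mutation:
  assumes k: "exc k" and Y: "exc Y" and kY: "perp k Y" and E: "Ext0 Y k"
  shows "\<exists>r P u. Filt k r P \<and> hom Y P u \<and> indep k Y P u \<and> (\<forall>f. hom Y k f \<longrightarrow> factors k Y P u f) \<and>
    (onto Y P u \<and> mutd k Y (ker Y u) \<or> \<not> onto Y P u \<and> (\<exists>C q. ses Y P C u q \<and> mutd k Y C))"
proof -
  have k': "brick k" "Ext0 k k" "is_rep k" and Y': "brick Y" "Ext0 Y Y" "is_rep Y"
    using k Y by (auto simp: exc_def brick_def)
  obtain r P u where P: "Filt k r P" "hom Y P u" "indep k Y P u" "\<And>f. hom Y k f \<Longrightarrow> factors k Y P u f"
    using left_approx[OF k'(1) Y'(3)] by blast
  note F = Filt_props[OF P(1) k'(3)]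
  note Pr = F(1)
  have PY: "perp P Y" using F(3,5)[OF Y'(3)] kY by blast
  have Pk: "Ext0 P k" using F(5)[OF k'(3) k'(2)] .
  have quot: "Hom0 C k" if "hom P C q" "\<And>i y. y \<in> sp Y i \<Longrightarrow> q i (u i y) = 0" "is_rep C" "onto P C q" for C q
  proof (rule Hom0I)
    note on = that(4)
    fix f i x assume f: "hom C k f" and x: "x \<in> sp C i"
    have "hom P k (\<lambda>i x. f i (q i x))" by (rule hom_comp[OF that(1) f])
    moreover have "\<forall>i. \<forall>y\<in>sp Y i. f i (q i (u i y)) = 0"
      using that(2) hom_0[OF f that(3)] by simp
    ultimately have "zero_on P (\<lambda>i x. f i (q i x))" using P(3) unfolding indep_def by blast
    moreover obtain b where "b \<in> sp P i" "q i b = x" using on x unfolding onto_def by blast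
    ultimately show "f i x = 0" by (auto simp: zero_on_def)
  qed
  have "monic Y u \<or> onto Y P u"
  proof (rule monic_or_onto[OF Y'(1) Pr P(2)])
    show "Ext0 P Y" using PY by blast
    fix C q assume S: "ses (Rep (\<lambda>i. u i ` sp Y i) (ac P)) P C (\<lambda>i x. x) q"
    have "Hom0 C k"
      by (rule quot[OF sesD(5)[OF S] _ sesD(3,7)[OF S]]) (use ses_qp[OF S] in auto)
    then show "Hom0 C P" using F(4)[OF sesD(3)[OF S]] by blast
  qed
  then show ?thesis
  proof (cases "onto Y P u")
    case True
    define K where "K = ker Y u"
    have S: "ses K Y P (\<lambda>i x. x) u" unfolding K_def by (rule ses_ker[OF Y'(3) Pr P(2) True])
    have Kr: "is_rep K" by (rule sesD(1)[OF S])
    have "Hom0 K k"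
    proof (rule Hom0I)
      fix f i x assume f: "hom K k f" and x: "x \<in> sp K i"
      obtain h where h: "hom Y k h" "\<forall>i. \<forall>a\<in>sp K i. h i a = f i a"
        using ses_extend[OF S Pk k'(3) f] by blast
      obtain h' where h': "hom P k h'" "\<forall>i. \<forall>y\<in>sp Y i. h' i (u i y) = h i y"
        using P(4)[OF h(1)] unfolding factors_def by blast
      have "h i x = h' i (u i x)" using h'(2)[rule_format, symmetric] x by (simp add: K_def)
      also have "\<dots> = 0" using x hom_0[OF h'(1) Pr] by (simp add: K_def)
      finally show "f i x = 0" using h(2) x by simp
    qed
    moreover have "Ext0 K k" by (rule Ext0_sub[OF S k'(3) E])
    ultimately have Kk: "perp K k" by blast
    have KP: "perp K P" using F(4,6)[OF Kr] Kk by blast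
    have "Ext0 K Y" by (rule Ext0_sub[OF S Y'(3,2)])
    then have "Ext0 K K" using Ext0_start_right_Hom0[OF S Kr] KP by blast
    moreover have "brick K" unfolding brick_def
    proof (intro conjI allI impI Kr)
      show "nonzero K"
      proof (rule ccontr)
        assume "\<not> nonzero K"
        \<comment> \<open>A zero kernel would identify \<open>Y\<close> with \<open>P\<close>; then
          \<open>Hom0 P Y\<close> gives \<open>Hom0 P P\<close>, so both are zero.\<close>
        then have "zrep K" using Kr rep_zero[OF Kr] by (auto simp: zrep_def nonzero_def)
        then have "Ext0 P K" "Hom0 P Y" using zrep_Ext0(2)[OF _ Pr] PY by auto
        then have "Hom0 P P" using Hom0_end_right[OF S Pr] by blast
        then have "x = 0" if "x \<in> sp P i" for i x using Hom0D[OF _ hom_id that] by blast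
        then have "zrep P" using rep_zero[OF Pr] Pr unfolding zrep_def by blast
        then have "dv Y i = 0" for i
          using dv_ses[OF S, of i] \<open>zrep K\<close> \<open>zrep P\<close> by (simp add: zrep_def dv_def)
        then show False using brickD(2)[OF Y'(1)] nonzero_dv[OF Y'(3)] by blast
      qed
      fix f assume f: "hom K K f"
      have "hom K Y f" using hom_comp[OF f sesD(4)[OF S]] by simp
      then obtain h where h: "hom Y Y h" "\<forall>i. \<forall>a\<in>sp K i. h i a = f i a"
        using ses_extend[OF S _ Y'(3)] PY by blast
      show "zero_on K f \<or> (\<forall>i. \<forall>x\<in>sp K i. f i x = x)"
        using brickD(3)[OF Y'(1) h(1)] h(2) by (auto simp: zero_on_def K_def)
    qed
    ultimately have "exc K" by (simp add: exc_def)
    moreover have "perp W K" if "is_rep W" "perp W Y" "perp W k" for W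
      using perp_right_A[OF S that(1,2)] perp_Filt(2)[OF P(1) k'(3) that(1,3)] by blast
    moreover have "perp K W" if "is_rep W" "perp Y W" "perp k W" for W
      using perp_left_A[OF S that(1,2)] perp_Filt(1)[OF P(1) k'(3) that(1,3)] by blast
    ultimately have "mutd k Y K" using Kk by (auto simp: mutd_def)
    then show ?thesis using P True unfolding K_def by blast
  next
    case False
    then have "monic Y u" using \<open>monic Y u \<or> onto Y P u\<close> by blast
    then obtain C q where S: "ses Y P C u q" using monic_coker[OF Y'(3) Pr P(2)] by blast
    have Cr: "is_rep C" by (rule sesD(3)[OF S])
    have "Hom0 C k" by (rule quot[OF sesD(5)[OF S] ses_qp[OF S] sesD(3,7)[OF S]])
    moreover have "Ext0 C k"
      by (rule Ext0_end_left[OF S k'(3) Pk]) (use P(4) in \<open>simp add: factors_def\<close>)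
    ultimately have Ck: "perp C k" by blast
    have CP: "perp C P" using F(4,6)[OF Cr] Ck by blast
    have "Ext0 C C" using Ext0_quot[OF S Cr] CP by blast
    moreover have "brick C" unfolding brick_def
    proof (intro conjI allI impI Cr)
      show "nonzero C"
      proof (rule ccontr)
        assume "\<not> nonzero C"
        then have z: "x = 0" if "x \<in> sp C i" for x i using that by (auto simp: nonzero_def)
        have "\<exists>y\<in>sp Y i. u i y = x" if "x \<in> sp P i" for i x
          using sesD(8)[OF S that] z[OF hom_in[OF sesD(5)[OF S] that]] by auto
        then show False using False by (simp add: onto_def)
      qed
      fix f assume f: "hom C C f"
      obtain h where h: "hom P P h" "\<forall>i. \<forall>z\<in>sp P i. q i (h i z) = f i (q i z)"
        using ses_lift[OF S _ Pr hom_comp[OF sesD(5)[OF S] f]] PY by blast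
      have qhu: "q i (h i (u i y)) = 0" if "y \<in> sp Y i" for i y
        using h(2) hom_in[OF P(2) that] ses_qp[OF S that] hom_0[OF f Cr] by simp
      obtain e where e: "hom Y Y e" "\<forall>i. \<forall>y\<in>sp Y i. u i (e i y) = h i (u i y)"
        using ses_factor_left[OF S hom_comp[OF P(2) h(1)]] qhu by blast
      \<comment> \<open>If a lift to \<open>P\<close> of an endomorphism of \<open>C\<close> kills
        \<open>Y\<close>, it factors through a map from \<open>C\<close> to \<open>P\<close>, and
        all of these vanish. This applies to \<open>h\<close> or to \<open>h\<close> plus the
        identity, as the induced endomorphism of \<open>Y\<close> is zero or the identity.\<close>
      have kills: "f' i x = 0" if h': "hom P P h'" "\<And>i z. z \<in> sp P i \<Longrightarrow> q i (h' i z) = f' i (q i z)"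
        "\<And>i y. y \<in> sp Y i \<Longrightarrow> h' i (u i y) = 0" and x: "x \<in> sp C i" for f' h' i x
      proof -
        obtain w where w: "hom C P w" "\<forall>i. \<forall>b\<in>sp P i. w i (q i b) = h' i b"
          using ses_factor_right[OF S h'(1)] h'(3) by blast
        obtain b where b: "b \<in> sp P i" "x = q i b" using sesD(7)[OF S] x unfolding onto_def by metis
        have "h' i b = 0" using Hom0D[OF _ w(1) x] CP w(2) b by simp
        then show ?thesis using h'(2)[OF b(1)] b hom_0[OF sesD(5)[OF S] Pr] by simp
      qed
      show "zero_on C f \<or> (\<forall>i. \<forall>x\<in>sp C i. f i x = x)"
        using brickD(3)[OF Y'(1) e(1)]
      proof
        assume "zero_on Y e"
        then have "h i (u i y) = 0" if "y \<in> sp Y i" for i y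
          using e(2)[rule_format, OF that] that hom_0[OF P(2) Y'(3), of i] by (simp add: zero_on_def)
        then have "zero_on C f" unfolding zero_on_def using kills[OF h(1)] h(2) by blast
        then show ?thesis ..
      next
        assume *: "\<forall>i. \<forall>x\<in>sp Y i. e i x = x"
        have hh: "hom P P (\<lambda>i x. h i x + x)" by (rule hom_sum[OF h(1) hom_id Pr])
        have hu: "h i (u i y) + u i y = 0" if "y \<in> sp Y i" for i y
          using e(2) * that by (simp add: vec_add_eq_0)
        have qh: "q i (h i z + z) = f i (q i z) + q i z" if "z \<in> sp P i" for i z
          using hom_add[OF sesD(5)[OF S] hom_in[OF h(1) that] that] h(2) that by simp
        have "f i x + x = 0" if "x \<in> sp C i" for i x
          using kills[OF hh qh hu that] .
        then show ?thesis by (simp add: vec_add_eq_0)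
      qed
    qed
    ultimately have "exc C" by (simp add: exc_def)
    moreover have "perp W C" if "is_rep W" "perp W Y" "perp W k" for W
      using perp_right_C[OF S that(1,2)] perp_Filt(2)[OF P(1) k'(3) that(1,3)] by blast
    moreover have "perp C W" if "is_rep W" "perp Y W" "perp k W" for W
      using perp_left_C[OF S that(1,2)] perp_Filt(1)[OF P(1) k'(3) that(1,3)] by blast
    ultimately have "mutd k Y C" using Ck by (auto simp: mutd_def)
    then show ?thesis using P False S by blast
  qed
qed

text \<open>Each nonsplit extension by \<open>k\<close> raises \<open>eul (dv E) (dv k) \<le> 0\<close> by one, so the construction
  terminates.\<close>

lemma universal_ext:
  assumes k: "exc k" and "is_rep Z" "Hom0 Z k"
  shows "\<exists>E p r. is_rep E \<and> hom E Z p \<and> onto E Z p \<and> Filt k r (ker E p) \<and> perp E k"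
proof -
  have k': "brick k" "Ext0 k k" "is_rep k" using k by (auto simp: exc_def brick_def)
  have "\<exists>E p r. is_rep E \<and> hom E Z p \<and> onto E Z p \<and> Filt k r (ker E p) \<and> perp E k"
    if "is_rep E0" "hom E0 Z p0" "onto E0 Z p0" "Filt k r0 (ker E0 p0)" "Hom0 E0 k" for E0 p0 r0
    using that
  proof (induction "nat (- eul (dv E0) (dv k))" arbitrary: E0 p0 r0 rule: less_induct)
    case less
    show ?case
    proof (cases "Ext0 E0 k")
      case True then show ?thesis using less by blast
    next
      case False
      then obtain g where g: "C1 E0 k g" "\<not> bdry E0 k g" unfolding Ext0_def by blast
      define E where "E = ext k E0 g"
      note S = ses_ext[OF k'(3) less(2) g(1), folded E_def]
      have Er: "is_rep E" by (rule sesD(2)[OF S])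
      have homE: "Hom0 E k"
      proof (rule Hom0I)
        fix f i x assume f: "hom E k f" and x: "x \<in> sp E i"
        have "hom k k (\<lambda>i x. f i (pr x 0))" by (rule hom_comp[OF sesD(4)[OF S] f])
        from brickD(3)[OF k'(1) this] have "zero_on k (\<lambda>i x. f i (pr x 0))"
          using ext_nonsplit[OF k'(3) less(2) g f[unfolded E_def]] by blast
        then obtain h where h: "hom E0 k h" "\<forall>i. \<forall>b\<in>sp E i. h i (sn b) = f i b"
          using ses_factor_right[OF S f] by (auto simp: zero_on_def)
        show "f i x = 0" using Hom0D[OF less(6) h(1) hom_in[OF sesD(5)[OF S] x]] h(2) x by simp
      qed
      let ?p = "\<lambda>i z. p0 i (sn z)"
      have p: "hom E Z ?p" by (rule hom_comp[OF sesD(5)[OF S] less(3)])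
      have on: "onto E Z ?p" unfolding onto_def
      proof (intro allI ballI)
        fix i y assume "y \<in> sp Z i"
        then obtain e where e: "e \<in> sp E0 i" "p0 i e = y" using less(4) unfolding onto_def by blast
        then obtain z where "z \<in> sp E i" "sn z = e" using sesD(7)[OF S] unfolding onto_def by blast
        then show "\<exists>x\<in>sp E i. p0 i (sn x) = y" using e by blast
      qed
      have "ker E ?p = ext k (ker E0 p0) g"
        unfolding E_def ext_def ker_def by (auto simp: fun_eq_iff)
      moreover have "C1 (ker E0 p0) k g" using C1_pre[OF hom_C0[OF ker_incl] g(1)] by simp
      ultimately have F: "Filt k (Suc r0) (ker E ?p)" using Filt_Suc[OF less(5)] by simp
      have "dv E = (\<lambda>i. dv E0 i + 1 * dv k i)" using dv_ses[OF S] by (auto simp: fun_eq_iff)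
      then have "eul (dv E) (dv k) = eul (dv E0) (dv k) + 1"
        using eul_add_left[of "dv E0" 1 "dv k" "dv k"] eul_brick[OF k'(1,2)] by simp
      moreover have "eul (dv E) (dv k) \<le> 0" by (rule eul_Hom0[OF Er k'(3) homE])
      ultimately show ?thesis using less(1)[OF _ Er p on F homE] by simp
    qed
  qed
  moreover have "zrep (ker Z (\<lambda>i x. x))"
    using rep_ker[OF assms(2,2) hom_id] rep_zero[OF assms(2)] by (auto simp: zrep_def)
  moreover have "onto Z Z (\<lambda>i x. x)" by (simp add: onto_def)
  ultimately show ?thesis using assms(2,3) hom_id[of Z] Filt_0 by blast
qed

text \<open>The universal extension makes Ext to \<open>k\<close> vanish. An endomorphism of
  \<open>E\<close> induces one of \<open>X\<close>, since \<open>P\<close> has no maps to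
  \<open>X\<close>; after possibly adding the identity the latter is zero, so the former lands in
  \<open>P\<close> and vanishes by \<open>Hom0 E P\<close>.\<close>

lemma green_mutation:
  assumes k: "exc k" and X: "exc X" and Xk: "Hom0 X k" and kX: "perp k X"
  shows "\<exists>E p r. is_rep E \<and> hom E X p \<and> onto E X p \<and> Filt k r (ker E p) \<and> mutd k X E"
proof -
  have k': "brick k" "Ext0 k k" "is_rep k" and X': "brick X" "Ext0 X X" "is_rep X"
    using k X by (auto simp: exc_def brick_def)
  obtain E p r where E: "is_rep E" "hom E X p" "onto E X p" "Filt k r (ker E p)" "perp E k"
    using universal_ext[OF k X'(3) Xk] by blast
  define P where "P = ker E p"
  have F: "Filt k r P" using E by (simp add: P_def)
  note FP = Filt_props[OF F k'(3)]
  have S: "ses P E X (\<lambda>i x. x) p" unfolding P_def by (rule ses_ker[OF E(1) X'(3) E(2,3)])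
  have PX: "perp P X" using perp_Filt(1)[OF F k'(3) X'(3) kX] .
  have EP: "perp E P" using perp_Filt(2)[OF F k'(3) E(1) E(5)] .
  have "Ext0 E X" using Ext0_middle_left[OF S X'(3)] PX X'(2) by blast
  then have "Ext0 E E" using Ext0_middle_right[OF S E(1)] EP by blast
  moreover have "brick E" unfolding brick_def
  proof (intro conjI allI impI E(1))
    show "nonzero E"
    proof -
      obtain i x where "x \<in> sp X i" "x \<noteq> 0" using brickD(2)[OF X'(1)] by (auto simp: nonzero_def)
      moreover then obtain e where "e \<in> sp E i" "p i e = x" using E(3) unfolding onto_def by blast
      ultimately have "e \<noteq> 0" using hom_0[OF E(2,1), of i] by auto
      then show ?thesis using \<open>e \<in> sp E i\<close> unfolding nonzero_def by blast
    qed
    fix f assume f: "hom E E f"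
    have pf: "p i (f i a) = 0" if "a \<in> sp P i" for i a
      using Hom0D[OF _ hom_comp[OF hom_comp[OF sesD(4)[OF S] f] E(2)] that] PX by blast
    obtain h where h: "hom X X h" "\<forall>i. \<forall>b\<in>sp E i. h i (p i b) = p i (f i b)"
      using ses_factor_right[OF S hom_comp[OF f E(2)]] pf by blast
    have kills: "f' i x = 0" if f': "hom E E f'" "\<And>i z. z \<in> sp E i \<Longrightarrow> p i (f' i z) = 0" and x: "x \<in> sp E i" for f' i x
    proof -
      obtain w where w: "hom E P w" "\<forall>i. \<forall>z\<in>sp E i. w i z = f' i z"
        using ses_factor_left[OF S f'(1)] f'(2) by blast
      then show ?thesis using Hom0D[OF _ w(1) x] EP x by simp
    qed
    show "zero_on E f \<or> (\<forall>i. \<forall>x\<in>sp E i. f i x = x)"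
      using brickD(3)[OF X'(1) h(1)]
    proof
      assume "zero_on X h"
      then have "p i (f i z) = 0" if "z \<in> sp E i" for i z
        using h(2)[rule_format, OF that, symmetric] hom_in[OF E(2) that] by (simp add: zero_on_def)
      then have "zero_on E f" unfolding zero_on_def using kills[OF f] by blast
      then show ?thesis ..
    next
      assume *: "\<forall>i. \<forall>x\<in>sp X i. h i x = x"
      have "p i (f i z + z) = 0" if "z \<in> sp E i" for i z
        using hom_add[OF E(2) hom_in[OF f that] that] h(2)[rule_format, OF that, symmetric] *
          hom_in[OF E(2) that] by simp
      then have "f i x + x = 0" if "x \<in> sp E i" for i x
        using kills[OF hom_sum[OF f hom_id E(1)] _ that] by blast
      then show ?thesis by (simp add: vec_add_eq_0)
    qed
  qed
  ultimately have "exc E" by (simp add: exc_def)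
  moreover have "perp W E" if "is_rep W" "perp W X" "perp W k" for W
    using perp_right_B[OF S that(1) _ that(2)] perp_Filt(2)[OF F k'(3) that(1,3)] by blast
  moreover have "perp E W" if "is_rep W" "perp X W" "perp k W" for W
    using perp_left_B[OF S that(1) _ that(2)] perp_Filt(1)[OF F k'(3) that(1,3)] by blast
  ultimately have "mutd k X E" using E(5) by (auto simp: mutd_def)
  then show ?thesis using E by blast
qed

section \<open>Torsion classes\<close>

definition orth :: "rep list \<Rightarrow> rep \<Rightarrow> bool" where
  "orth Ms N \<longleftrightarrow> is_rep N \<and> (\<forall>M\<in>set Ms. Hom0 N M)"

text \<open>\<open>Splus\<close> and \<open>Sminus\<close> say that \<open>X\<close>, respectively the shift of \<open>Y\<close>, is simple in the heart of
  the torsion pair with torsion class \<open>orth Ms\<close>.\<close>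

definition Splus :: "rep list \<Rightarrow> rep \<Rightarrow> bool" where
  "Splus Ms X \<longleftrightarrow> (\<forall>N f. orth Ms N \<and> hom N X f \<and> \<not> zero_on N f \<longrightarrow> onto N X f \<and> orth Ms (ker N f))"

definition Sminus :: "rep list \<Rightarrow> rep \<Rightarrow> bool" where
  "Sminus Ms Y \<longleftrightarrow> (\<forall>N g. orth Ms N \<and> C1 N Y g \<and> \<not> bdry N Y g \<longrightarrow> orth Ms (ext Y N g))"

lemma orth_rep: "orth Ms N \<Longrightarrow> is_rep N" by (simp add: orth_def)

lemma orth_snoc: "orth (Ms @ [k]) N \<longleftrightarrow> orth Ms N \<and> Hom0 N k"
  by (auto simp: orth_def)

lemma SplusD: "Splus Ms X \<Longrightarrow> orth Ms N \<Longrightarrow> hom N X f \<Longrightarrow> \<not> zero_on N f \<Longrightarrow> onto N X f \<and> orth Ms (ker N f)"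
  by (simp add: Splus_def)

lemma SminusD: "Sminus Ms Y \<Longrightarrow> orth Ms N \<Longrightarrow> C1 N Y g \<Longrightarrow> \<not> bdry N Y g \<Longrightarrow> orth Ms (ext Y N g)"
  by (simp add: Sminus_def)

lemma indepD: "indep k Y P u \<Longrightarrow> hom P k h \<Longrightarrow> (\<And>i y. y \<in> sp Y i \<Longrightarrow> h i (u i y) = 0) \<Longrightarrow> x \<in> sp P i \<Longrightarrow> h i x = 0"
  unfolding indep_def zero_on_def by blast

lemma indepI: "(\<And>h i x. hom P k h \<Longrightarrow> (\<And>i y. y \<in> sp Y i \<Longrightarrow> h i (u i y) = 0) \<Longrightarrow> x \<in> sp P i \<Longrightarrow> h i x = 0) \<Longrightarrow> indep k Y P u"
  unfolding indep_def zero_on_def by blast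

lemma ker_zero: "zero_on N f \<Longrightarrow> ker N f = N"
  by (rule rep.expand) (auto simp: zero_on_def fun_eq_iff)

text \<open>Extends simplicity of \<open>k\<close> to modules filtered by \<open>k\<close>, with
  \<open>indep\<close> in place of being nonzero. Map first onto the quotient \<open>P\<close>, then
  map the kernel of this to the submodule \<open>k\<close>; both steps stay in the torsion
  class.\<close>

lemma Splus_Filt:
  assumes k: "brick k" and Sk: "Splus Ms k"
    and "Filt k r P" "orth Ms N" "hom N P w" "indep k N P w"
  shows "onto N P w \<and> orth Ms (ker N w)"
  using assms(3-6)
proof (induction arbitrary: N w)
  case (Filt_0 P)
  then have P: "sp P i = {0}" for i by (simp add: zrep_def)
  then have "zero_on N w" using hom_in[OF Filt_0(3)] by (auto simp: zero_on_def)
  moreover have "0 \<in> sp N i \<and> w i 0 = 0" for i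
    using rep_zero[OF orth_rep[OF Filt_0(2)]] hom_0[OF Filt_0(3) orth_rep[OF Filt_0(2)]] by blast
  then have "onto N P w" unfolding onto_def P by blast
  ultimately show ?case using Filt_0(2) by (simp add: ker_zero)
next
  case (Filt_Suc r P g)
  note kr = brickD(1)[OF k]
  note Pr = Filt_props(1)[OF Filt_Suc(1) kr]
  define P' where "P' = ext k P g"
  note S = ses_ext[OF kr Pr Filt_Suc(2), folded P'_def]
  note Pr' = sesD(2)[OF S]
  note w = Filt_Suc(5)[folded P'_def] and ind = Filt_Suc(6)[folded P'_def]
  note Nr = orth_rep[OF Filt_Suc(4)]
  let ?w1 = "\<lambda>i x. sn (w i x)"
  have w1: "hom N P ?w1" by (rule hom_comp[OF w sesD(5)[OF S]])
  have i1: "indep k N P ?w1"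
  proof (rule indepI)
    fix h i x assume h: "hom P k h" and z: "\<And>i y. y \<in> sp N i \<Longrightarrow> h i (sn (w i y)) = 0" and x: "x \<in> sp P i"
    have "h i (sn (pr 0 x)) = 0"
      by (rule indepD[OF ind hom_comp[OF sesD(5)[OF S] h]]) (use z x rep_zero[OF kr] in \<open>auto simp: P'_def\<close>)
    then show "h i x = 0" by simp
  qed
  from Filt_Suc.IH[OF Filt_Suc(4) w1 i1] have o1: "onto N P ?w1" and N1: "orth Ms (ker N ?w1)" by auto
  define N1 where "N1 = ker N ?w1"
  have S1: "ses N1 N P (\<lambda>i x. x) ?w1" unfolding N1_def by (rule ses_ker[OF Nr Pr w1 o1])
  let ?w2 = "\<lambda>i x. fs (w i x)"
  have w2: "hom N1 k ?w2"
    unfolding hom_def C0_def lin_def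
  proof (intro conjI allI ballI impI)
    fix i x assume x: "x \<in> sp N1 i"
    then have xN: "x \<in> sp N i" and sx: "sn (w i x) = 0" by (simp_all add: N1_def)
    then show "fs (w i x) \<in> sp k i" using hom_in[OF w xN] by (simp add: P'_def)
    { fix y assume "y \<in> sp N1 i"
      then have "y \<in> sp N i" by (simp add: N1_def)
      then show "fs (w i (x + y)) = fs (w i x) + fs (w i y)" using hom_add[OF w xN] by simp }
    fix j c assume c: "c < Q i j"
    show "fs (w j (ac N1 i j c x)) = ac k i j c (fs (w i x))"
      using hom_ac[OF w c xN] sx C1_0[OF Filt_Suc(2) Pr c] by (simp add: N1_def P'_def)
  qed
  have nz: "\<not> zero_on N1 ?w2"
  proof
    assume z: "zero_on N1 ?w2"
    obtain s r where "ses_splitting N1 N P (\<lambda>i x. x) ?w1 s r" using ses_split[OF S1] by blast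
    note s = ses_splittingD(1,4)[OF this]
    have key: "fs (w i x) = fs (w i (s i (sn (w i x))))" if x: "x \<in> sp N i" for i x
    proof -
      have sw: "sn (w i x) \<in> sp P i" by (rule hom_in[OF w1 x])
      have y: "s i (sn (w i x)) \<in> sp N i" by (rule C0_in[OF s(1) sw])
      have "x + s i (sn (w i x)) \<in> sp N1 i"
        using rep_add[OF Nr x y] hom_add[OF w1 x y] s(2)[OF sw] by (simp add: N1_def)
      then have "fs (w i (x + s i (sn (w i x)))) = 0" using z unfolding zero_on_def by blast
      then show ?thesis by (simp add: hom_add[OF w x y] vec_add_eq_0)
    qed
    \<comment> \<open>If the kernel \<open>N1\<close> mapped to zero in \<open>k\<close>, the first
      component of \<open>w\<close> would be a function of the second. The difference of the two is
      then a homomorphism on \<open>P'\<close> that kills the image of \<open>w\<close> but is the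
      identity on the copy of \<open>k\<close>, against \<open>indep\<close>.\<close>
    let ?h = "\<lambda>i z. fs z + fs (w i (s i (sn z)))"
    have hh: "hom P' k ?h"
      unfolding hom_def
    proof (intro conjI allI impI)
      have "C0 P' k (\<lambda>i. fs)" unfolding C0_def lin_def P'_def by simp
      moreover have "C0 P' P' (\<lambda>i z. w i (s i (sn z)))"
        by (rule C0_comp[OF C0_comp[OF hom_C0[OF sesD(5)[OF S]] s(1)] hom_C0[OF w]])
      ultimately show "C0 P' k ?h" using C0_comp[of P' P' _ k "\<lambda>i. fs"] C0_sum[OF _ _ kr] by blast
      fix i j c z assume c: "c < Q i j" and zz: "z \<in> sp P' i"
      then have f: "fs z \<in> sp k i" "sn z \<in> sp P i" by (simp_all add: P'_def)
      have sz: "s i (sn z) \<in> sp N i" by (rule C0_in[OF s(1) f(2)])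
      have wsz: "fs (w i (s i (sn z))) \<in> sp k i" using hom_in[OF w sz] by (simp add: P'_def)
      have "sn (w j (ac N i j c (s i (sn z)))) = ac P i j c (sn z)"
        using hom_ac[OF w1 c sz] s(2)[OF f(2)] by simp
      then have "fs (w j (s j (ac P i j c (sn z)))) = fs (w j (ac N i j c (s i (sn z))))"
        using key[OF ac_in[OF Nr c sz]] by simp
      also have "\<dots> = ac k i j c (fs (w i (s i (sn z)))) + g i j c (sn z)"
        using hom_ac[OF w c sz] s(2)[OF f(2)] by (simp add: P'_def)
      finally show "?h j (ac P' i j c z) = ac k i j c (?h i z)"
        using ac_add[OF kr c f(1) wsz] by (simp add: P'_def ac_simps)
    qed
    have "?h i (pr a 0) = 0" if "a \<in> sp k i" for i a
      by (rule indepD[OF ind hh]) (use key that rep_zero[OF Pr] in \<open>auto simp: P'_def vec_add_eq_0\<close>)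
    then have "a = 0" if "a \<in> sp k i" for i a
      using that C0_0[OF s(1) Pr] hom_0[OF w Nr] by simp
    then show False using brickD(2)[OF k] by (auto simp: nonzero_def)
  qed
  from SplusD[OF Sk N1[folded N1_def] w2 nz] have o2: "onto N1 k ?w2" and T: "orth Ms (ker N1 ?w2)" by auto
  have "ker N1 ?w2 = ker N w"
    by (rule rep.expand) (auto simp: N1_def fun_eq_iff intro: vec_pair_eqI[of _ 0, simplified])
  moreover have "onto N P' w" unfolding onto_def
  proof (intro allI ballI)
    fix i z assume z: "z \<in> sp P' i"
    obtain x where x: "x \<in> sp N i" "sn (w i x) = sn z" using o1 z unfolding onto_def by (auto simp: P'_def)
    have "fs z + fs (w i x) \<in> sp k i" using z hom_in[OF w x(1)] rep_add[OF kr] by (simp add: P'_def)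
    then obtain y where y: "y \<in> sp N1 i" "fs (w i y) = fs z + fs (w i x)" using o2 unfolding onto_def by blast
    then have y': "y \<in> sp N i" "sn (w i y) = 0" by (simp_all add: N1_def)
    have "w i (x + y) = z" unfolding hom_add[OF w x(1) y'(1)]
      by (rule vec_pair_eqI) (use x y y' in \<open>simp_all add: ac_simps\<close>)
    then show "\<exists>x\<in>sp N i. w i x = z" using rep_add[OF Nr x(1) y'(1)] by blast
  qed
  ultimately show ?case using T by (simp add: P'_def)
qed

section \<open>How simplicity in the heart survives appending \<open>k\<close>\<close>

lemma Splus_snoc_unchanged:
  assumes "Splus Ms X" "is_rep X" "is_rep k" "Ext0 X k" shows "Splus (Ms @ [k]) X"
  unfolding Splus_def orth_snoc
proof (intro allI impI)
  fix N f assume *: "(orth Ms N \<and> Hom0 N k) \<and> hom N X f \<and> \<not> zero_on N f"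
  then have 1: "onto N X f" "orth Ms (ker N f)" using SplusD[OF assms(1), of N f] by auto
  have "Hom0 (ker N f) k"
    using Hom0_start_left[OF ses_ker assms(3)] * 1 assms orth_rep by blast
  then show "onto N X f \<and> orth Ms (ker N f) \<and> Hom0 (ker N f) k" using 1 by blast
qed

text \<open>Since \<open>N\<close> has no maps to \<open>P\<close>, the composite from
  \<open>N\<close> to \<open>X\<close> is nonzero, hence onto with torsion kernel \<open>K\<close>.
  The restriction of \<open>f\<close> from \<open>K\<close> to \<open>P\<close> is independent
  because \<open>E\<close> has no maps to \<open>k\<close>, so \<open>Splus_Filt\<close> applies to
  it.\<close>

lemma Splus_snoc_green:
  assumes k: "brick k" and Sk: "Splus Ms k" and X: "is_rep X" and SX: "Splus Ms X"
    and E: "is_rep E" "hom E X p" "onto E X p" "Filt k r (ker E p)" "perp E k"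
  shows "Splus (Ms @ [k]) E"
  unfolding Splus_def orth_snoc
proof (intro allI impI)
  fix N f assume *: "(orth Ms N \<and> Hom0 N k) \<and> hom N E f \<and> \<not> zero_on N f"
  then have N: "orth Ms N" "Hom0 N k" and f: "hom N E f" and nz: "\<not> zero_on N f" by auto
  note kr = brickD(1)[OF k] and Nr = orth_rep[OF N(1)]
  define P where "P = ker E p"
  have S: "ses P E X (\<lambda>i x. x) p" unfolding P_def by (rule ses_ker[OF E(1) X E(2,3)])
  have NP: "Hom0 N P" using Filt_props(4)[OF E(4) kr Nr N(2)] by (simp add: P_def)
  let ?g = "\<lambda>i x. p i (f i x)"
  have g: "hom N X ?g" by (rule hom_comp[OF f E(2)])
  have "\<not> zero_on N ?g"
  proof
    assume z: "zero_on N ?g"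
    then obtain h where h: "hom N P h" "\<forall>i. \<forall>z\<in>sp N i. h i z = f i z"
      using ses_factor_left[OF S f] unfolding zero_on_def by blast
    then show False using nz Hom0D[OF NP h(1)] by (auto simp: zero_on_def)
  qed
  from SplusD[OF SX N(1) g this] have og: "onto N X ?g" and K0: "orth Ms (ker N ?g)" by auto
  define K where "K = ker N ?g"
  have SK: "ses K N X (\<lambda>i x. x) ?g" unfolding K_def by (rule ses_ker[OF Nr X g og])
  have w: "hom K P f"
    using hom_in[OF f] hom_add[OF f] hom_ac[OF f] unfolding hom_def C0_def lin_def K_def P_def by simp
  obtain s r where "ses_splitting K N X (\<lambda>i x. x) ?g s r" using ses_split[OF SK] by blast
  note s = ses_splittingD(1,4)[OF this]
  have ind: "indep k K P f"
  proof (rule indepI)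
    fix h i x assume h: "hom P k h" and z: "\<And>i y. y \<in> sp K i \<Longrightarrow> h i (f i y) = 0" and x: "x \<in> sp P i"
    \<comment> \<open>This pushes \<open>E\<close> into \<open>P\<close> and commutes with arrows up
      to the image of \<open>K\<close>. As \<open>h\<close> kills that image, \<open>h\<close> after
      \<open>?b\<close> is a homomorphism from \<open>E\<close> to \<open>k\<close>, hence zero, and
      on \<open>P\<close> it agrees with \<open>h\<close>.\<close>
    let ?b = "\<lambda>i e. e + f i (s i (p i e))"
    have b0: "C0 E E ?b"
      by (rule C0_sum[OF hom_C0[OF hom_id] C0_comp[OF C0_comp[OF hom_C0[OF E(2)] s(1)] hom_C0[OF f]] E(1)])
    have bP: "?b i e \<in> sp P i" if "e \<in> sp E i" for i e
    proof -
      have "p i e \<in> sp X i" by (rule hom_in[OF E(2) that])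
      moreover have "f i (s i (p i e)) \<in> sp E i" using calculation C0_in[OF s(1)] hom_in[OF f] by blast
      ultimately show ?thesis
        using that hom_add[OF E(2) that] s(2) C0_in[OF b0 that] by (simp add: P_def)
    qed
    have "hom E k (\<lambda>i e. h i (?b i e))"
      unfolding hom_def
    proof (intro conjI allI impI)
      have "C0 E P ?b" unfolding C0_def lin_def using bP C0_add[OF b0] by blast
      then show "C0 E k (\<lambda>i e. h i (?b i e))" by (rule C0_comp[OF _ hom_C0[OF h]])
      fix i j c e assume c: "c < Q i j" and e: "e \<in> sp E i"
      have pe: "p i e \<in> sp X i" by (rule hom_in[OF E(2) e])
      have sp: "s i (p i e) \<in> sp N i" by (rule C0_in[OF s(1) pe])
      have ape: "ac X i j c (p i e) \<in> sp X j" by (rule ac_in[OF X c pe])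
      have sp': "s j (ac X i j c (p i e)) \<in> sp N j" by (rule C0_in[OF s(1) ape])
      let ?n = "s j (ac X i j c (p i e)) + ac N i j c (s i (p i e))"
      have n: "?n \<in> sp K j"
        using rep_add[OF Nr sp' ac_in[OF Nr c sp]] hom_add[OF g sp' ac_in[OF Nr c sp]]
          s(2)[OF ape] s(2)[OF pe] hom_ac[OF g c sp] by (simp add: K_def)
      have "f j ?n = f j (s j (ac X i j c (p i e))) + ac E i j c (f i (s i (p i e)))"
        using hom_add[OF f sp' ac_in[OF Nr c sp]] hom_ac[OF f c sp] by simp
      moreover have "ac E i j c (?b i e) = ac E i j c e + ac E i j c (f i (s i (p i e)))"
        by (rule ac_add[OF E(1) c e hom_in[OF f sp]])
      moreover have "?b j (ac E i j c e) = ac E i j c e + f j (s j (ac X i j c (p i e)))"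
        using hom_ac[OF E(2) c e] by simp
      ultimately have "?b j (ac E i j c e) + ac E i j c (?b i e) = f j ?n"
        by (simp add: ac_simps)
      moreover have b1: "?b j (ac E i j c e) \<in> sp P j" by (rule bP[OF ac_in[OF E(1) c e]])
      moreover have b2: "ac E i j c (?b i e) \<in> sp P j"
        using ac_in[OF sesD(1)[OF S] c bP[OF e]] by (simp add: P_def)
      ultimately have "h j (?b j (ac E i j c e)) + h j (ac E i j c (?b i e)) = 0"
        using z[OF n] hom_add[OF h b1 b2] by simp
      then show "h j (?b j (ac E i j c e)) = ac k i j c (h i (?b i e))"
        using hom_ac[OF h c bP[OF e]] by (simp add: vec_add_eq_0 P_def)
    qed
    from Hom0D[OF _ this, of x i] have "h i (?b i x) = 0" using E(5) x by (simp add: P_def)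
    then show "h i x = 0" using x C0_0[OF s(1) X] hom_0[OF f Nr] by (simp add: P_def)
  qed
  from Splus_Filt[OF k Sk E(4)[folded P_def] K0[folded K_def] w ind]
  have oP: "onto K P f" and TK: "orth Ms (ker K f)" by auto
  have "ker K f = ker N f"
    by (rule rep.expand) (auto simp: K_def fun_eq_iff hom_0[OF E(2,1)])
  moreover have onto: "onto N E f" unfolding onto_def
  proof (intro allI ballI)
    fix i e assume e: "e \<in> sp E i"
    obtain x where x: "x \<in> sp N i" "p i (f i x) = p i e" using og hom_in[OF E(2) e] unfolding onto_def by blast
    have "e + f i x \<in> sp P i"
      using rep_add[OF E(1) e hom_in[OF f x(1)]] hom_add[OF E(2) e hom_in[OF f x(1)]] x(2) by (simp add: P_def)
    then obtain y where y: "y \<in> sp K i" "f i y = e + f i x" using oP unfolding onto_def by blast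
    then have yN: "y \<in> sp N i" by (simp add: K_def)
    have "x + y \<in> sp N i" "f i (x + y) = e"
      using rep_add[OF Nr x(1) yN] hom_add[OF f x(1) yN] y(2) by (simp_all add: add.left_commute add.commute)
    then show "\<exists>x\<in>sp N i. f i x = e" by blast
  qed
  moreover have "Hom0 (ker N f) k"
    using Hom0_start_left[OF ses_ker[OF Nr E(1) f onto] kr N(2)] E(5) by blast
  ultimately show "onto N E f \<and> orth Ms (ker N f) \<and> Hom0 (ker N f) k" using TK by simp
qed

text \<open>Pull the sequence back along \<open>f\<close> to an extension of \<open>N\<close> by
  \<open>Y\<close>. If it split, \<open>f\<close> would lift to \<open>P\<close>, but
  \<open>N\<close> has no maps to \<open>P\<close>. So \<open>Sminus\<close> puts the extension in
  the torsion class, its map to \<open>P\<close> is onto by \<open>Splus_Filt\<close>, and its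
  kernel covers the kernel of \<open>f\<close>.\<close>

lemma Splus_snoc_coker:
  assumes k: "brick k" and Sk: "Splus Ms k" and SY: "Sminus Ms Y" and S: "ses Y P C u q"
    and F: "Filt k r P" and ind: "indep k Y P u" and Ck: "perp C k"
  shows "Splus (Ms @ [k]) C"
  unfolding Splus_def orth_snoc
proof (intro allI impI)
  fix N f assume *: "(orth Ms N \<and> Hom0 N k) \<and> hom N C f \<and> \<not> zero_on N f"
  then have N: "orth Ms N" "Hom0 N k" and f: "hom N C f" and nz: "\<not> zero_on N f" by auto
  note kr = brickD(1)[OF k] and Nr = orth_rep[OF N(1)]
  note Yr = sesD(1)[OF S] and Pr = sesD(2)[OF S] and Cr = sesD(3)[OF S] and u = sesD(4)[OF S] and q = sesD(5)[OF S]
  obtain t r where "ses_splitting Y P C u q t r" using ses_split[OF S] by blast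
  note tr = ses_splittingD[OF this]
  let ?s = "\<lambda>i x. t i (f i x)"
  have s: "C0 N P ?s" by (rule C0_comp[OF hom_C0[OF f] tr(1)])
  define g where "g = (\<lambda>i j c x. r j (del N P ?s i j c x))"
  have g: "C1 N Y g" unfolding g_def by (rule C1_post[OF del_C1[OF Nr Pr s] tr(2)])
  have ug: "u j (g i j c x) = del N P ?s i j c x" if c: "c < Q i j" "x \<in> sp N i" for i j c x
  proof -
    have "q j (del N P ?s i j c x) = del N C (\<lambda>i x. q i (?s i x)) i j c x"
      by (rule del_post[OF Nr Pr s q c, symmetric])
    also have "\<dots> = del N C f i j c x"
      using c ac_in[OF Nr c] hom_in[OF f] by (simp add: del_def tr(4))
    also have "\<dots> = 0" using f c by (simp add: hom_del)
    finally show ?thesis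
      using tr(6)[OF C1_in[OF del_C1[OF Nr Pr s] c]] C0_0[OF tr(1) Cr] by (simp add: g_def)
  qed
  have "\<not> bdry N Y g"
  proof
    assume "bdry N Y g"
    then obtain v where v: "C0 N Y v" "\<And>i j c x. c < Q i j \<Longrightarrow> x \<in> sp N i \<Longrightarrow> g i j c x = del N Y v i j c x"
      unfolding bdry_def by blast
    have uv: "C0 N P (\<lambda>i x. u i (v i x))" by (rule C0_comp[OF v(1) hom_C0[OF u]])
    have "del N P (\<lambda>i x. ?s i x + u i (v i x)) i j c x = 0" if c: "c < Q i j" "x \<in> sp N i" for i j c x
      using del_sum[OF Pr s uv c] del_post[OF Nr Yr v(1) u c] ug[OF c] v(2)[OF c] by simp
    then have "hom N P (\<lambda>i x. ?s i x + u i (v i x))" using C0_sum[OF s uv Pr] by (simp add: hom_del)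
    from Hom0D[OF Filt_props(4)[OF F kr Nr N(2)] this]
    have z: "?s i x = u i (v i x)" if "x \<in> sp N i" for i x using that by (simp add: vec_add_eq_0)
    have "f i x = 0" if "x \<in> sp N i" for i x
      using tr(4)[OF hom_in[OF f that]] z[OF that] ses_qp[OF S C0_in[OF v(1) that]] by simp
    then show False using nz by (simp add: zero_on_def)
  qed
  from SminusD[OF SY N(1) g this] have TE: "orth Ms (ext Y N g)" .
  define E where "E = ext Y N g"
  note SE = ses_ext[OF Yr Nr g, folded E_def]
  note Er = sesD(2)[OF SE]
  let ?W = "\<lambda>i z. u i (fs z) + ?s i (sn z)"
  have W: "hom E P ?W"
    unfolding hom_def
  proof (intro conjI allI impI)
    have "C0 E Y (\<lambda>i. fs)" unfolding C0_def lin_def E_def by simp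
    from C0_sum[OF C0_comp[OF this hom_C0[OF u]] C0_comp[OF hom_C0[OF sesD(5)[OF SE]] s] Pr]
    show "C0 E P ?W" .
    fix i j c z assume c: "c < Q i j" and z: "z \<in> sp E i"
    then have zz: "fs z \<in> sp Y i" "sn z \<in> sp N i" by (simp_all add: E_def)
    have "u j (ac Y i j c (fs z) + g i j c (sn z)) = ac P i j c (u i (fs z)) + del N P ?s i j c (sn z)"
      using hom_add[OF u ac_in[OF Yr c zz(1)] C1_in[OF g c zz(2)]] ug[OF c zz(2)] hom_ac[OF u c zz(1)] by simp
    then show "?W j (ac E i j c z) = ac P i j c (?W i z)"
      using ac_add[OF Pr c hom_in[OF u zz(1)] C0_in[OF s zz(2)]] by (simp add: E_def del_def ac_simps)
  qed
  have s0: "?s i 0 = 0" for i by (rule C0_0[OF s Nr])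
  have iW: "indep k E P ?W"
  proof (rule indepI)
    fix h i x assume h: "hom P k h" and z: "\<And>i y. y \<in> sp E i \<Longrightarrow> h i (?W i y) = 0" and x: "x \<in> sp P i"
    have "h i (u i y) = 0" if "y \<in> sp Y i" for i y
      using z[of "pr y 0" i] that rep_zero[OF Nr] s0 by (simp add: E_def)
    from indepD[OF ind h this x] show "h i x = 0" .
  qed
  from Splus_Filt[OF k Sk F TE[folded E_def] W iW]
  have oW: "onto E P ?W" and TW: "orth Ms (ker E ?W)" by auto
  have qW: "q i (?W i z) = f i (sn z)" if "z \<in> sp E i" for i z
  proof -
    have zz: "fs z \<in> sp Y i" "sn z \<in> sp N i" using that by (simp_all add: E_def)
    show ?thesis
      using hom_add[OF q hom_in[OF u zz(1)] C0_in[OF s zz(2)]] ses_qp[OF S zz(1)] tr(4)[OF hom_in[OF f zz(2)]] by simp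
  qed
  have onto: "onto N C f" unfolding onto_def
  proof (intro allI ballI)
    fix i c assume "c \<in> sp C i"
    then obtain b where "b \<in> sp P i" "q i b = c" using sesD(7)[OF S] unfolding onto_def by blast
    moreover then obtain z where "z \<in> sp E i" "?W i z = b" using oW unfolding onto_def by blast
    ultimately have z: "z \<in> sp E i" "q i (?W i z) = c" by simp_all
    then show "\<exists>x\<in>sp N i. f i x = c" using qW[OF z(1)] hom_in[OF sesD(5)[OF SE] z(1)] by auto
  qed
  have hs: "hom (ker E ?W) (ker N f) (\<lambda>i. sn)"
    unfolding hom_def C0_def lin_def
  proof (intro conjI allI ballI impI)
    fix i z assume z: "z \<in> sp (ker E ?W) i"
    then have zE: "z \<in> sp E i" and z0: "?W i z = 0" by auto
    have "f i (sn z) = 0" using qW[OF zE] z0 hom_0[OF q Pr] by simp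
    then show "sn z \<in> sp (ker N f) i" using hom_in[OF sesD(5)[OF SE] zE] by simp
    show "sn (z + y) = sn z + sn y" for y by simp
    show "sn (ac (ker E ?W) i j c z) = ac (ker N f) i j c (sn z)" for j c by (simp add: E_def)
  qed
  have os: "onto (ker E ?W) (ker N f) (\<lambda>i. sn)"
    unfolding onto_def
  proof (intro allI ballI)
    fix i x assume "x \<in> sp (ker N f) i"
    then have "pr 0 x \<in> sp (ker E ?W) i"
      using rep_zero[OF Yr] hom_0[OF u Yr] C0_0[OF tr(1) Cr] by (simp add: E_def)
    then show "\<exists>z\<in>sp (ker E ?W) i. sn z = x" by (intro bexI[of _ "pr 0 x"]) simp_all
  qed
  have "orth Ms (ker N f)"
    using TW Hom0_quot[OF hs os] rep_ker[OF Nr Cr f] by (auto simp: orth_def)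
  moreover have "Hom0 (ker N f) k"
    using Hom0_start_left[OF ses_ker[OF Nr Cr f onto] kr N(2)] Ck by blast
  ultimately show "onto N C f \<and> orth Ms (ker N f) \<and> Hom0 (ker N f) k" using onto by blast
qed

text \<open>A map from a nonsplit extension to \<open>k\<close> cannot be the identity on the
  submodule \<open>k\<close>, so it is zero there, factors through \<open>N\<close> and
  vanishes.\<close>

lemma Sminus_snoc_self:
  assumes k: "brick k" and o: "orth Ms k" shows "Sminus (Ms @ [k]) k"
  unfolding Sminus_def orth_snoc
proof (intro allI impI)
  fix N g assume *: "(orth Ms N \<and> Hom0 N k) \<and> C1 N k g \<and> \<not> bdry N k g"
  then have N: "orth Ms N" "Hom0 N k" and g: "C1 N k g" "\<not> bdry N k g" by auto
  note kr = brickD(1)[OF k] and Nr = orth_rep[OF N(1)]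
  note S = ses_ext[OF kr Nr g(1)]
  have "orth Ms (ext k N g)"
    using Hom0_middle_left[OF S] o N(1) sesD(2)[OF S] by (simp add: orth_def)
  moreover have "Hom0 (ext k N g) k"
  proof (rule Hom0I)
    fix f i x assume f: "hom (ext k N g) k f" and x: "x \<in> sp (ext k N g) i"
    have "hom k k (\<lambda>i x. f i (pr x 0))" by (rule hom_comp[OF sesD(4)[OF S] f])
    from brickD(3)[OF k this] have "zero_on k (\<lambda>i x. f i (pr x 0))"
      using ext_nonsplit[OF kr Nr g f] by blast
    then obtain h where h: "hom N k h" "\<forall>i. \<forall>b\<in>sp (ext k N g) i. h i (sn b) = f i b"
      using ses_factor_right[OF S f] by (auto simp: zero_on_def)
    then show "f i x = 0" using Hom0D[OF N(2) h(1) hom_in[OF sesD(5)[OF S] x]] h(2) x by simp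
  qed
  ultimately show "orth Ms (ext k N g) \<and> Hom0 (ext k N g) k" ..
qed

lemma Sminus_snoc_unchanged:
  assumes "Sminus Ms Y" "is_rep Y" "Hom0 Y k" shows "Sminus (Ms @ [k]) Y"
  unfolding Sminus_def orth_snoc
proof (intro allI impI)
  fix N g assume *: "(orth Ms N \<and> Hom0 N k) \<and> C1 N Y g \<and> \<not> bdry N Y g"
  then have "orth Ms (ext Y N g)" using SminusD[OF assms(1)] by blast
  moreover have "Hom0 (ext Y N g) k"
    using Hom0_middle_left[OF ses_ext[OF assms(2)]] * assms(3) orth_rep by blast
  ultimately show "orth Ms (ext Y N g) \<and> Hom0 (ext Y N g) k" ..
qed

text \<open>Pushed forward to \<open>Y\<close> the extension stays nonsplit, since a splitting
  composed with \<open>u\<close> would be a map from \<open>N\<close> to \<open>P\<close> and hence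
  zero. The original extension is the kernel of the induced map from the larger one to
  \<open>P\<close>.\<close>

lemma Sminus_snoc_ker:
  assumes k: "brick k" and Sk: "Splus Ms k" and SY: "Sminus Ms Y" and Y: "is_rep Y"
    and u: "hom Y P u" "onto Y P u" and F: "Filt k r P" and ind: "indep k Y P u" and Kk: "Hom0 (ker Y u) k"
  shows "Sminus (Ms @ [k]) (ker Y u)"
  unfolding Sminus_def orth_snoc
proof (intro allI impI)
  fix N g assume *: "(orth Ms N \<and> Hom0 N k) \<and> C1 N (ker Y u) g \<and> \<not> bdry N (ker Y u) g"
  then have N: "orth Ms N" "Hom0 N k" and g: "C1 N (ker Y u) g" "\<not> bdry N (ker Y u) g" by auto
  note kr = brickD(1)[OF k] and Nr = orth_rep[OF N(1)]
  note Pr = Filt_props(1)[OF F kr]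
  have gY: "C1 N Y g" using C1_post[OF g(1) hom_C0[OF ker_incl]] by simp
  have ug: "u j (g i j c x) = 0" if "c < Q i j" "x \<in> sp N i" for i j c x
    using C1_in[OF g(1) that] by simp
  have "\<not> bdry N Y g"
  proof
    assume "bdry N Y g"
    then obtain v where v: "C0 N Y v" "\<And>i j c x. c < Q i j \<Longrightarrow> x \<in> sp N i \<Longrightarrow> g i j c x = del N Y v i j c x"
      unfolding bdry_def by blast
    have "del N P (\<lambda>i x. u i (v i x)) i j c x = 0" if c: "c < Q i j" "x \<in> sp N i" for i j c x
      using del_post[OF Nr Y v(1) u(1) c] v(2)[OF c] ug[OF c] by simp
    then have "hom N P (\<lambda>i x. u i (v i x))" using C0_comp[OF v(1) hom_C0[OF u(1)]] by (simp add: hom_del)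
    from Hom0D[OF Filt_props(4)[OF F kr Nr N(2)] this]
    have "C0 N (ker Y u) v" using C0_in[OF v(1)] C0_add[OF v(1)] by (simp add: C0_def lin_def)
    moreover have "g i j c x = del N (ker Y u) v i j c x" if c: "c < Q i j" "x \<in> sp N i" for i j c x
      using v(2)[OF c] by (simp add: del_def)
    ultimately have "bdry N (ker Y u) g" unfolding bdry_def by blast
    then show False using g(2) by blast
  qed
  from SminusD[OF SY N(1) gY this] have TE: "orth Ms (ext Y N g)" .
  let ?W = "\<lambda>i z. u i (fs z)"
  have W: "hom (ext Y N g) P ?W"
    unfolding hom_def C0_def lin_def
    using hom_in[OF u(1)] hom_add[OF u(1)] hom_ac[OF u(1)] ac_in[OF Y] C1_in[OF gY] ug by simp
  have iW: "indep k (ext Y N g) P ?W"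
  proof (rule indepI)
    fix h i x assume h: "hom P k h" and z: "\<And>i y. y \<in> sp (ext Y N g) i \<Longrightarrow> h i (?W i y) = 0" and x: "x \<in> sp P i"
    have "h i (u i y) = 0" if "y \<in> sp Y i" for i y
      using z[of "pr y 0" i] that rep_zero[OF Nr] by simp
    from indepD[OF ind h this x] show "h i x = 0" .
  qed
  have "ker (ext Y N g) ?W = ext (ker Y u) N g"
    unfolding ext_def ker_def by (auto simp: fun_eq_iff)
  then have "orth Ms (ext (ker Y u) N g)" using Splus_Filt[OF k Sk F TE W iW] by simp
  moreover have "Hom0 (ext (ker Y u) N g) k"
    using Hom0_middle_left[OF ses_ext[OF rep_ker[OF Y Pr u(1)] Nr g(1)] Kk N(2)] .
  ultimately show "orth Ms (ext (ker Y u) N g) \<and> Hom0 (ext (ker Y u) N g) k" ..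
qed

section \<open>Mutation of exceptional sequences\<close>

text \<open>The order of the arguments is chosen so that on unit vectors this is the number of
  arrows from the first vertex to the second minus the number of arrows back; see
  \<open>om_unit\<close>.\<close>

definition om :: "(nat \<Rightarrow> int) \<Rightarrow> (nat \<Rightarrow> int) \<Rightarrow> int" where
  "om x y = eul y x - eul x y"

definition dstep :: "nat \<Rightarrow> (nat \<Rightarrow> nat \<Rightarrow> int) \<Rightarrow> nat \<Rightarrow> nat \<Rightarrow> int" where
  "dstep k d j i = (if j = k then - d k i else d j i + max 0 (om (d j) (d k)) * d k i)"

lemma excD: "exc M \<Longrightarrow> brick M" "exc M \<Longrightarrow> Ext0 M M" "exc M \<Longrightarrow> is_rep M"
  by (auto simp: exc_def brick_def)

text \<open>A nonzero map from \<open>Y\<close> to \<open>k\<close> would be monic or onto. Then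
  \<open>Y\<close> is a submodule of \<open>k\<close> or \<open>k\<close> a quotient of
  \<open>Y\<close>, and in both cases rigidity and heredity give \<open>Ext0 Y k\<close>.\<close>

lemma exc_pair:
  assumes k: "exc k" and Y: "exc Y" and kY: "Ext0 k Y" and nE: "\<not> Ext0 Y k"
  shows "Hom0 Y k"
proof (rule ccontr)
  assume "\<not> Hom0 Y k"
  then obtain f where f: "hom Y k f" and nz: "\<not> zero_on Y f" unfolding Hom0_def by blast
  note kr = excD(3)[OF k] and Yr = excD(3)[OF Y]
  have "monic Y f \<or> onto Y k f"
  proof (rule monic_or_onto[OF excD(1)[OF Y] kr f kY])
    fix C q assume S: "ses (Rep (\<lambda>i. f i ` sp Y i) (ac k)) k C (\<lambda>i x. x) q"
    show "Hom0 C k"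
    proof (rule Hom0I)
      fix h i x assume h: "hom C k h" and x: "x \<in> sp C i"
      have qf: "q i (f i y) = 0" if "y \<in> sp Y i" for i y using ses_qp[OF S] that by simp
      from brickD(3)[OF excD(1)[OF k] hom_comp[OF sesD(5)[OF S] h]]
      show "h i x = 0"
      proof
        assume z: "zero_on k (\<lambda>i x. h i (q i x))"
        obtain b where "b \<in> sp k i" "q i b = x" using sesD(7)[OF S] x unfolding onto_def by blast
        then show ?thesis using z by (auto simp: zero_on_def)
      next
        assume id: "\<forall>i. \<forall>x\<in>sp k i. h i (q i x) = x"
        have "f i y = 0" if "y \<in> sp Y i" for i y
          using id hom_in[OF f that] qf[OF that] hom_0[OF h sesD(3)[OF S], of i] by force
        then show ?thesis using nz by (simp add: zero_on_def)
      qed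
    qed
  qed
  then have "Ext0 Y k"
  proof
    assume "monic Y f"
    then obtain C q where "ses Y k C f q" using monic_coker[OF Yr kr f] by blast
    then show ?thesis using Ext0_sub excD(2)[OF k] kr by blast
  next
    assume "onto Y k f"
    then show ?thesis using Ext0_quot[OF ses_ker[OF Yr kr f]] Yr excD(2)[OF Y] by blast
  qed
  then show False using nE by blast
qed

text \<open>Rigidity of \<open>k\<close> bounds the cocycle of the last extension, and the bounding
  cochain turns the first projection into a homomorphism onto \<open>k\<close>.\<close>

lemma Filt_quot:
  assumes k: "exc k" and F: "Filt k (Suc r) P" shows "\<exists>h. hom P k h \<and> onto P k h"
  using F
proof cases
  case (Filt_Suc P1 g)
  note kr = excD(3)[OF k]
  note P1 = Filt_props(1)[OF Filt_Suc(2) kr]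
  obtain v where v: "C0 P1 k v" "\<And>i j c x. c < Q i j \<Longrightarrow> x \<in> sp P1 i \<Longrightarrow> g i j c x = del P1 k v i j c x"
    using Ext0D[OF Filt_props(5)[OF Filt_Suc(2) kr kr excD(2)[OF k]] Filt_Suc(3)] by blast
  let ?h = "\<lambda>i z. fs z + v i (sn z)"
  have "hom P k ?h" unfolding hom_def
  proof (intro conjI allI impI)
    show "C0 P k ?h"
      unfolding C0_def lin_def Filt_Suc(1) using C0_in[OF v(1)] C0_add[OF v(1)] rep_add[OF kr]
      by (simp add: ac_simps)
    fix i j c z assume c: "c < Q i j" and z: "z \<in> sp P i"
    then have "fs z \<in> sp k i" "sn z \<in> sp P1 i" by (simp_all add: Filt_Suc(1))
    then show "?h j (ac P i j c z) = ac k i j c (?h i z)"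
      using v(2)[OF c] ac_add[OF kr c] C0_in[OF v(1)] by (simp add: Filt_Suc(1) del_def ac_simps)
  qed
  moreover have "onto P k ?h" unfolding onto_def
  proof (intro allI ballI)
    fix i y assume "y \<in> sp k i"
    then show "\<exists>x\<in>sp P i. fs x + v i (sn x) = y"
      using rep_zero[OF P1] C0_0[OF v(1) P1] by (intro bexI[of _ "pr y 0"]) (simp_all add: Filt_Suc(1))
  qed
  ultimately show ?thesis by blast
qed

text \<open>The kinds: 0 a red module not mapping to \<open>k\<close>; 2 and 3 a red module replaced by the kernel,
  respectively cokernel, of its approximation; 4 and 5 a green module before, respectively after, \<open>k\<close>.
  The number 1 is left for \<open>k\<close> itself, so that the kinds give the new order.\<close>

definition outcome :: "rep list \<Rightarrow> rep \<Rightarrow> rep \<Rightarrow> (nat \<Rightarrow> int) \<Rightarrow> nat \<Rightarrow> rep \<Rightarrow> bool" where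
  "outcome Ms k Y v kd L \<longleftrightarrow> exc L \<and>
    (kd \<in> {3, 4, 5} \<longrightarrow> v = dv L \<and> orth (Ms @ [k]) L \<and> Splus (Ms @ [k]) L) \<and>
    (kd \<in> {0, 2} \<longrightarrow> v = (\<lambda>i. - dv L i) \<and> (\<forall>N. orth (Ms @ [k]) N \<longrightarrow> Hom0 N L) \<and> Sminus (Ms @ [k]) L) \<and>
    (\<forall>W. is_rep W \<and> perp W Y \<and> perp W k \<longrightarrow> perp W L) \<and>
    (\<forall>W. is_rep W \<and> perp Y W \<and> perp k W \<longrightarrow> perp L W) \<and>
    (kd \<noteq> 0 \<longrightarrow> perp L k) \<and> (kd \<in> {0, 5} \<longrightarrow> L = Y) \<and> (kd = 0 \<longrightarrow> Hom0 Y k) \<and>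
    (kd = 2 \<longrightarrow> (\<forall>W. is_rep W \<and> Ext0 W Y \<longrightarrow> Ext0 W k)) \<and>
    (kd = 3 \<longrightarrow> (\<forall>W. is_rep W \<and> Ext0 k W \<longrightarrow> Ext0 Y W)) \<and>
    (kd \<in> {0, 2} \<longrightarrow> (\<forall>W. is_rep W \<and> Hom0 W Y \<longrightarrow> Hom0 W L) \<and>
      (\<forall>W. is_rep W \<and> Hom0 Y W \<and> perp k W \<longrightarrow> Hom0 L W)) \<and>
    (kd \<in> {4, 5} \<longrightarrow> (\<forall>W. is_rep W \<and> Hom0 W Y \<and> Hom0 W k \<longrightarrow> Hom0 W L)) \<and>
    (kd \<in> {3, 4, 5} \<longrightarrow> (\<forall>W. is_rep W \<and> Hom0 k W \<and> (kd \<noteq> 3 \<longrightarrow> Hom0 Y W) \<longrightarrow> Hom0 L W)) \<and>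
    (kd = 3 \<longrightarrow> (\<forall>W. is_rep W \<and> Hom0 W k \<and> Ext0 W Y \<longrightarrow> Hom0 W L) \<and>
      (\<forall>W. is_rep W \<and> Hom0 Y W \<and> perp k W \<longrightarrow> Ext0 L W))"

text \<open>The relevant value of \<open>om\<close> is \<open>eul (dv Y) (dv k)\<close>, and by
  \<open>exc_pair\<close> Hom and Ext from \<open>Y\<close> to \<open>k\<close> are not both
  nonzero. If Hom vanishes, the value is nonpositive and nothing changes. Otherwise it equals the
  number \<open>r\<close> of factors of the approximation, and \<open>r\<close> copies of
  \<open>k\<close> minus \<open>Y\<close> is minus the kernel or plus the cokernel.\<close>

lemma outcome_red:
  assumes k: "exc k" and ok: "orth Ms k" and Sk: "Splus Ms k" and Ms: "\<And>M. M \<in> set Ms \<Longrightarrow> is_rep M"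
    and Y: "exc Y" and kY: "perp k Y" and SY: "Sminus Ms Y" and oY: "\<And>N. orth Ms N \<Longrightarrow> Hom0 N Y"
  shows "\<exists>kd L. kd \<in> {0, 2, 3} \<and>
    outcome Ms k Y (\<lambda>i. - dv Y i + max 0 (om (\<lambda>i. - dv Y i) (dv k)) * dv k i) kd L"
proof -
  note kr = excD(3)[OF k] and Yr = excD(3)[OF Y]
  have om: "om (\<lambda>i. - dv Y i) (dv k) = eul (dv Y) (dv k)"
    using eul_perp[OF kr Yr kY] by (simp add: om_def eul_neg_left eul_neg_right)
  show ?thesis
  proof (cases "Hom0 Y k \<or> \<not> Ext0 Y k")
    case True
    then have H: "Hom0 Y k" using exc_pair[OF k Y] kY by blast
    have "eul (dv Y) (dv k) \<le> 0" by (rule eul_Hom0[OF Yr kr H])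
    then have "outcome Ms k Y (\<lambda>i. - dv Y i + max 0 (om (\<lambda>i. - dv Y i) (dv k)) * dv k i) 0 Y"
      unfolding outcome_def om
      using Y H oY Sminus_snoc_unchanged[OF SY Yr H] by (auto simp: orth_snoc)
    then show ?thesis by blast
  next
    case False
    then have E: "Ext0 Y k" and nH: "\<not> Hom0 Y k" by auto
    obtain r P u where P: "Filt k r P" "hom Y P u" "indep k Y P u" "\<forall>f. hom Y k f \<longrightarrow> factors k Y P u f"
      and alt: "onto Y P u \<and> mutd k Y (ker Y u) \<or> \<not> onto Y P u \<and> (\<exists>C q. ses Y P C u q \<and> mutd k Y C)"
      using red_mutation[OF k Y kY E] by blast
    note FP = Filt_props[OF P(1) kr]
    note Pr = FP(1)
    have kk: "eul (dv k) (dv k) = 1" using eul_brick excD[OF k] by blast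
    from alt show ?thesis
    proof
      assume a: "onto Y P u \<and> mutd k Y (ker Y u)"
      define K where "K = ker Y u"
      have S: "ses K Y P (\<lambda>i x. x) u" unfolding K_def using ses_ker[OF Yr Pr P(2)] a by blast
      have m: "exc K" "perp K k" using a by (auto simp: mutd_def K_def)
      have m3: "\<forall>W. is_rep W \<and> perp W Y \<and> perp W k \<longrightarrow> perp W K"
        and m4: "\<forall>W. is_rep W \<and> perp Y W \<and> perp k W \<longrightarrow> perp K W"
        using a unfolding mutd_def K_def by blast+
      have dY: "dv Y = (\<lambda>i. dv K i + int r * dv k i)" using dv_ses[OF S] FP(2) by (simp add: fun_eq_iff)
      have "eul (dv Y) (dv k) = int r"
        unfolding dY eul_add_left using kk eul_perp[OF excD(3)[OF m(1)] kr m(2)] by simp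
      with om have e: "om (\<lambda>i. - dv Y i) (dv k) = int r" by simp
      have v: "(\<lambda>i. - dv Y i + max 0 (om (\<lambda>i. - dv Y i) (dv k)) * dv k i) = (\<lambda>i. - dv K i)"
        unfolding e by (simp add: dY fun_eq_iff)
      \<comment> \<open>A surjection from \<open>Y\<close> to \<open>k\<close> lets
        \<open>Ext0 W Y\<close> pass to \<open>Ext0 W k\<close>, the property of kind 2 that fixes
        the new order. The case \<open>r = 0\<close> would force \<open>Hom0 Y k\<close>.\<close>
      have "\<exists>h. hom Y k h \<and> onto Y k h"
      proof (cases r)
        case 0
        with P(1) have P0: "zrep P" by (auto elim: Filt.cases)
        have "Hom0 Y k"
        proof (rule Hom0I)
          fix f i x assume f: "hom Y k f" and x: "x \<in> sp Y i"
          obtain h where h: "hom P k h" "\<forall>i. \<forall>y\<in>sp Y i. h i (u i y) = f i y"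
            using P(4) f unfolding factors_def by blast
          have "h i (u i x) = 0" by (rule Hom0D[OF zrep_Hom0(1)[OF P0 kr] h(1) hom_in[OF P(2) x]])
          then show "f i x = 0" using h(2) x by simp
        qed
        then show ?thesis using nH by blast
      next
        case (Suc r')
        then obtain h where h: "hom P k h" "onto P k h" using Filt_quot[OF k] P(1) by blast
        have "onto Y k (\<lambda>i y. h i (u i y))" unfolding onto_def
        proof (intro allI ballI)
          fix i y assume "y \<in> sp k i"
          then obtain b where b: "b \<in> sp P i" "h i b = y" using h(2) unfolding onto_def by blast
          then obtain x where "x \<in> sp Y i" "u i x = b" using a unfolding onto_def by blast
          then show "\<exists>x\<in>sp Y i. h i (u i x) = y" using b by blast
        qed
        then show ?thesis using hom_comp[OF P(2) h(1)] by blast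
      qed
      then obtain h where h: "hom Y k h" "onto Y k h" by blast
      have q2: "\<forall>W. is_rep W \<and> Ext0 W Y \<longrightarrow> Ext0 W k"
        using Ext0_quot[OF ses_ker[OF Yr kr h]] by blast
      have r1: "\<forall>W. is_rep W \<and> Hom0 W Y \<longrightarrow> Hom0 W K" using Hom0_sub[OF sesD(4,6)[OF S]] by blast
      have r2: "\<forall>W. is_rep W \<and> Hom0 Y W \<and> perp k W \<longrightarrow> Hom0 K W"
        using Hom0_start_left[OF S] FP(5) by blast
      have "Sminus (Ms @ [k]) K" unfolding K_def
        using Sminus_snoc_ker[OF excD(1)[OF k] Sk SY Yr P(2) _ P(1,3)] a m(2) by (simp add: K_def)
      moreover have "\<forall>N. orth (Ms @ [k]) N \<longrightarrow> Hom0 N K" unfolding orth_snoc using oY r1 orth_rep by blast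
      ultimately have "outcome Ms k Y (\<lambda>i. - dv Y i + max 0 (om (\<lambda>i. - dv Y i) (dv k)) * dv k i) 2 K"
        unfolding outcome_def v using m m3 m4 q2 r1 r2 by simp
      then show ?thesis by blast
    next
      assume "\<not> onto Y P u \<and> (\<exists>C q. ses Y P C u q \<and> mutd k Y C)"
      then obtain C q where S: "ses Y P C u q" and a: "mutd k Y C" by blast
      have m: "exc C" "perp C k" using a by (auto simp: mutd_def)
      have m3: "\<forall>W. is_rep W \<and> perp W Y \<and> perp W k \<longrightarrow> perp W C"
        and m4: "\<forall>W. is_rep W \<and> perp Y W \<and> perp k W \<longrightarrow> perp C W"
        using a unfolding mutd_def by blast+
      have dY: "dv C = (\<lambda>i. (int r * dv k i) + (-1) * dv Y i)" using dv_ses[OF S] FP(2) by (simp add: fun_eq_iff)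
      have "(\<lambda>i. int r * dv k i) = (\<lambda>i. 0 + int r * dv k i)" by simp
      then have "eul (\<lambda>i. int r * dv k i) (dv k) = int r" using kk eul_add_left[of "\<lambda>_. 0"] by (simp add: eul_def)
      then have "eul (dv Y) (dv k) = int r"
        using eul_perp[OF excD(3)[OF m(1)] kr m(2)] unfolding dY eul_add_left by simp
      with om have e: "om (\<lambda>i. - dv Y i) (dv k) = int r" by simp
      have v: "(\<lambda>i. - dv Y i + max 0 (om (\<lambda>i. - dv Y i) (dv k)) * dv k i) = dv C"
        unfolding e dY by (simp add: fun_eq_iff)
      have q3: "\<forall>W. is_rep W \<and> Ext0 k W \<longrightarrow> Ext0 Y W" using Ext0_sub[OF S] FP(5) by blast
      have g2: "\<forall>W. is_rep W \<and> Hom0 k W \<longrightarrow> Hom0 C W" using Hom0_quot[OF sesD(5,7)[OF S]] FP(3) by blast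
      have g3: "\<forall>W. is_rep W \<and> Hom0 W k \<and> Ext0 W Y \<longrightarrow> Hom0 W C" using Hom0_end_right[OF S] FP(4) by blast
      have g4: "\<forall>W. is_rep W \<and> Hom0 Y W \<and> perp k W \<longrightarrow> Ext0 C W" using Ext0_end_left_Hom0[OF S] FP(5) by blast
      have "orth (Ms @ [k]) C" using ok Ms g2 m by (auto simp: orth_def excD)
      moreover have "Splus (Ms @ [k]) C"
        by (rule Splus_snoc_coker[OF excD(1)[OF k] Sk SY S P(1,3) m(2)])
      ultimately have "outcome Ms k Y (\<lambda>i. - dv Y i + max 0 (om (\<lambda>i. - dv Y i) (dv k)) * dv k i) 3 C"
        unfolding outcome_def v using m m3 m4 q3 g2 g3 g4 by simp
      then show ?thesis by blast
    qed
  qed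
qed

text \<open>As \<open>E\<close> is perpendicular to \<open>k\<close>, the Euler pairing of
  \<open>X\<close> with \<open>k\<close> is minus the number of factors \<open>k\<close> in the
  universal extension; so the recursion adds exactly those.\<close>

lemma outcome_before:
  assumes k: "exc k" and ok: "orth Ms k" and Sk: "Splus Ms k" and Ms: "\<And>M. M \<in> set Ms \<Longrightarrow> is_rep M"
    and X: "exc X" and kX: "perp k X" and H: "Hom0 X k" and SX: "Splus Ms X" and oX: "orth Ms X"
  shows "\<exists>L. outcome Ms k X (\<lambda>i. dv X i + max 0 (om (dv X) (dv k)) * dv k i) 4 L"
proof -
  note kr = excD(3)[OF k] and Xr = excD(3)[OF X]
  obtain E p r where E: "is_rep E" "hom E X p" "onto E X p" "Filt k r (ker E p)" and a: "mutd k X E"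
    using green_mutation[OF k X H kX] by blast
  note FP = Filt_props[OF E(4) kr]
  have S: "ses (ker E p) E X (\<lambda>i x. x) p" by (rule ses_ker[OF E(1) Xr E(2,3)])
  have m: "exc E" "perp E k" using a by (auto simp: mutd_def)
  have m3: "\<forall>W. is_rep W \<and> perp W X \<and> perp W k \<longrightarrow> perp W E"
    and m4: "\<forall>W. is_rep W \<and> perp X W \<and> perp k W \<longrightarrow> perp E W"
    using a unfolding mutd_def by blast+
  have kk: "eul (dv k) (dv k) = 1" using eul_brick excD[OF k] by blast
  have dE: "dv E = (\<lambda>i. dv X i + int r * dv k i)" using dv_ses[OF S] FP(2) by (simp add: fun_eq_iff)
  have "eul (dv X) (dv k) = - int r"
    using eul_perp[OF E(1) kr m(2)] kk unfolding dE eul_add_left by simp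
  then have e: "om (dv X) (dv k) = int r" using eul_perp[OF kr Xr kX] by (simp add: om_def)
  have v: "(\<lambda>i. dv X i + max 0 (om (dv X) (dv k)) * dv k i) = dv E"
    unfolding e dE by (simp add: fun_eq_iff)
  have g1: "\<forall>W. is_rep W \<and> Hom0 W X \<and> Hom0 W k \<longrightarrow> Hom0 W E"
    using Hom0_middle_right[OF S] FP(4) by blast
  have g2: "\<forall>W. is_rep W \<and> Hom0 k W \<and> Hom0 X W \<longrightarrow> Hom0 E W"
    using Hom0_middle_left[OF S] FP(3) by blast
  have "orth (Ms @ [k]) E" using ok oX Ms g2 m E(1) by (auto simp: orth_def)
  moreover have "Splus (Ms @ [k]) E"
    by (rule Splus_snoc_green[OF excD(1)[OF k] Sk Xr SX E m(2)])
  ultimately have "outcome Ms k X (\<lambda>i. dv X i + max 0 (om (dv X) (dv k)) * dv k i) 4 E"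
    unfolding outcome_def v using m m3 m4 g1 g2 by simp
  then show ?thesis by blast
qed

text \<open>Here \<open>om\<close> reduces to an Euler number of a pair without homomorphisms, which
  is nonpositive; the coefficient is zero.\<close>

lemma outcome_after:
  assumes k: "exc k" and X: "exc X" and Xk: "perp X k" and H: "Hom0 k X" and SX: "Splus Ms X" and oX: "orth Ms X"
  shows "outcome Ms k X (\<lambda>i. dv X i + max 0 (om (dv X) (dv k)) * dv k i) 5 X"
proof -
  note kr = excD(3)[OF k] and Xr = excD(3)[OF X]
  have "om (dv X) (dv k) \<le> 0" using eul_Hom0[OF kr Xr H] eul_perp[OF Xr kr Xk] by (simp add: om_def)
  then show ?thesis unfolding outcome_def
    using X Xk oX Splus_snoc_unchanged[OF SX Xr kr] by (simp add: orth_snoc)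
qed

text \<open>\<open>d j\<close> is minus the c-vector at \<open>j\<close>; it is the dimension vector of \<open>Z j\<close>, up to a sign that is
  negative for the red vertices. Ordered by \<open>pos\<close>, the modules form an exceptional sequence in which
  the red ones come first. \<open>Ms\<close> collects the modules at which the sequence has mutated so far.\<close>

definition seed :: "rep list \<Rightarrow> (nat \<Rightarrow> rep) \<Rightarrow> (nat \<Rightarrow> bool) \<Rightarrow> (nat \<Rightarrow> nat) \<Rightarrow> (nat \<Rightarrow> nat \<Rightarrow> int) \<Rightarrow> bool" where
  "seed Ms Z red pos d \<longleftrightarrow> (\<forall>M\<in>set Ms. is_rep M) \<and> (\<forall>j<n. exc (Z j)) \<and>
    (\<forall>i<n. \<forall>j<n. pos i < pos j \<longrightarrow> perp (Z j) (Z i)) \<and> inj_on pos {..<n} \<and>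
    (\<forall>i<n. \<forall>j<n. red i \<and> \<not> red j \<longrightarrow> pos i < pos j) \<and>
    (\<forall>i<n. \<forall>j<n. i \<noteq> j \<and> red i = red j \<longrightarrow> Hom0 (Z i) (Z j)) \<and>
    (\<forall>j<n. d j = (if red j then (\<lambda>i. - dv (Z j) i) else dv (Z j))) \<and>
    (\<forall>j<n. \<not> red j \<longrightarrow> orth Ms (Z j) \<and> Splus Ms (Z j)) \<and>
    (\<forall>j<n. red j \<longrightarrow> (\<forall>N. orth Ms N \<longrightarrow> Hom0 N (Z j)) \<and> Sminus Ms (Z j))"

lemma seedD:
  assumes "seed Ms Z red pos d"
  shows "\<And>M. M \<in> set Ms \<Longrightarrow> is_rep M" "\<And>j. j < n \<Longrightarrow> exc (Z j)"
    "\<And>i j. i < n \<Longrightarrow> j < n \<Longrightarrow> pos i < pos j \<Longrightarrow> perp (Z j) (Z i)"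
    "\<And>i j. i < n \<Longrightarrow> j < n \<Longrightarrow> i \<noteq> j \<Longrightarrow> pos i < pos j \<or> pos j < pos i"
    "\<And>i j. i < n \<Longrightarrow> j < n \<Longrightarrow> red i \<Longrightarrow> \<not> red j \<Longrightarrow> pos i < pos j"
    "\<And>i j. i < n \<Longrightarrow> j < n \<Longrightarrow> i \<noteq> j \<Longrightarrow> red i = red j \<Longrightarrow> Hom0 (Z i) (Z j)"
    "\<And>j. j < n \<Longrightarrow> d j = (if red j then (\<lambda>i. - dv (Z j) i) else dv (Z j))"
    "\<And>j. j < n \<Longrightarrow> \<not> red j \<Longrightarrow> orth Ms (Z j)" "\<And>j. j < n \<Longrightarrow> \<not> red j \<Longrightarrow> Splus Ms (Z j)"
    "\<And>j N. j < n \<Longrightarrow> red j \<Longrightarrow> orth Ms N \<Longrightarrow> Hom0 N (Z j)" "\<And>j. j < n \<Longrightarrow> red j \<Longrightarrow> Sminus Ms (Z j)"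
proof -
  show "pos i < pos j \<or> pos j < pos i" if "i < n" "j < n" "i \<noteq> j" for i j
  proof -
    have "inj_on pos {..<n}" using assms unfolding seed_def by blast
    then have "pos i \<noteq> pos j" using that by (auto dest: inj_onD)
    then show ?thesis by linarith
  qed
qed (use assms in \<open>simp_all add: seed_def\<close>)

lemma outcomeD:
  assumes "outcome Ms k Y v kd L"
  shows "exc L" "kd \<in> {3, 4, 5} \<Longrightarrow> v = dv L \<and> orth (Ms @ [k]) L \<and> Splus (Ms @ [k]) L"
    "kd \<in> {0, 2} \<Longrightarrow> v = (\<lambda>i. - dv L i) \<and> (\<forall>N. orth (Ms @ [k]) N \<longrightarrow> Hom0 N L) \<and> Sminus (Ms @ [k]) L"
    "\<And>W. is_rep W \<Longrightarrow> perp W Y \<Longrightarrow> perp W k \<Longrightarrow> perp W L"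
    "\<And>W. is_rep W \<Longrightarrow> perp Y W \<Longrightarrow> perp k W \<Longrightarrow> perp L W"
    "kd \<noteq> 0 \<Longrightarrow> perp L k" "kd \<in> {0, 5} \<Longrightarrow> L = Y" "kd = 0 \<Longrightarrow> Hom0 Y k"
    "\<And>W. kd = 2 \<Longrightarrow> is_rep W \<Longrightarrow> Ext0 W Y \<Longrightarrow> Ext0 W k"
    "\<And>W. kd = 3 \<Longrightarrow> is_rep W \<Longrightarrow> Ext0 k W \<Longrightarrow> Ext0 Y W"
    "\<And>W. kd \<in> {0, 2} \<Longrightarrow> is_rep W \<Longrightarrow> Hom0 W Y \<Longrightarrow> Hom0 W L"
    "\<And>W. kd \<in> {0, 2} \<Longrightarrow> is_rep W \<Longrightarrow> Hom0 Y W \<Longrightarrow> perp k W \<Longrightarrow> Hom0 L W"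
    "\<And>W. kd \<in> {4, 5} \<Longrightarrow> is_rep W \<Longrightarrow> Hom0 W Y \<Longrightarrow> Hom0 W k \<Longrightarrow> Hom0 W L"
    "\<And>W. kd \<in> {3, 4, 5} \<Longrightarrow> is_rep W \<Longrightarrow> Hom0 k W \<Longrightarrow> (kd \<noteq> 3 \<Longrightarrow> Hom0 Y W) \<Longrightarrow> Hom0 L W"
    "\<And>W. kd = 3 \<Longrightarrow> is_rep W \<Longrightarrow> Hom0 W k \<Longrightarrow> Ext0 W Y \<Longrightarrow> Hom0 W L"
    "\<And>W. kd = 3 \<Longrightarrow> is_rep W \<Longrightarrow> Hom0 Y W \<Longrightarrow> perp k W \<Longrightarrow> Ext0 L W"
  using assms by (simp_all add: outcome_def)

text \<open>Each module other than \<open>Z k\<close> is replaced by its \<open>outcome\<close>; the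
  work lies in a new linear order. \<open>k\<close> becomes red and moves in front of the green
  modules, and the old red ones have to be divided into those before and those after it.\<close>

lemma seed_step:
  assumes I: "seed Ms Z red pos d" and k: "k < n" and gk: "\<not> red k"
  shows "\<exists>Z' red' pos'. seed (Ms @ [Z k]) Z' red' pos' (dstep k d)"
proof -
  note I = seedD[OF I]
  define K where "K = Z k"
  have excK: "exc K" and oK: "orth Ms K" and SK: "Splus Ms K" using I k gk by (auto simp: K_def)
  have dk: "d k = dv K" using I(7)[OF k] gk by (simp add: K_def)
  note Kr = excD(3)[OF excK]
  define P where "P = (\<lambda>j kd L. outcome Ms K (Z j) (dstep k d j) kd L \<and> kd \<in> {0, 2, 3, 4, 5} \<and>
    (red j \<longleftrightarrow> kd \<in> {0, 2, 3}) \<and> (kd = 4 \<longrightarrow> pos j < pos k) \<and> (kd = 5 \<longrightarrow> pos k < pos j))"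
  have "\<exists>kd L. P j kd L" if j: "j < n" "j \<noteq> k" for j
  proof (cases "red j")
    case True
    have kj: "perp K (Z j)" using I(3)[OF j(1) k] I(5)[OF j(1) k True gk] by (simp add: K_def)
    have "dstep k d j = (\<lambda>i. - dv (Z j) i + max 0 (om (\<lambda>i. - dv (Z j) i) (dv K)) * dv K i)"
      using j I(7)[OF j(1)] True dk by (auto simp: dstep_def)
    then show ?thesis
      using outcome_red[OF excK oK SK I(1) I(2)[OF j(1)] kj I(11)[OF j(1) True] I(10)[OF j(1) True]] True
      unfolding P_def by fastforce
  next
    case False
    have ds: "dstep k d j = (\<lambda>i. dv (Z j) i + max 0 (om (dv (Z j)) (dv K)) * dv K i)"
      using j I(7)[OF j(1)] False dk by (auto simp: dstep_def)
    have H: "Hom0 K (Z j)" "Hom0 (Z j) K"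
      using I(6)[OF k j(1)] I(6)[OF j(1) k] j(2) gk False by (auto simp: K_def)
    show ?thesis
    proof (cases "pos j < pos k")
      case True
      then have kj: "perp K (Z j)" using I(3)[OF j(1) k] by (simp add: K_def)
      show ?thesis
        using outcome_before[OF excK oK SK I(1) I(2)[OF j(1)] kj H(2) I(9)[OF j(1) False] I(8)[OF j(1) False]]
          ds True False unfolding P_def by fastforce
    next
      case F: False
      then have kj: "pos k < pos j" using I(4)[OF j(1) k j(2)] by blast
      then have "perp (Z j) K" using I(3)[OF k j(1)] by (simp add: K_def)
      then show ?thesis
        using outcome_after[OF excK I(2)[OF j(1)] _ H(1) I(9)[OF j(1) False] I(8)[OF j(1) False]]
          ds kj False unfolding P_def by fastforce
    qed
  qed
  then have "\<forall>j. \<exists>kL. j < n \<and> j \<noteq> k \<longrightarrow> P j (fst kL) (snd kL)" by auto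
  from choice[OF this] obtain kL where kL: "\<And>j. j < n \<Longrightarrow> j \<noteq> k \<Longrightarrow> P j (fst (kL j)) (snd (kL j))" by blast
  define kd L where "kd = (\<lambda>j. fst (kL j))" and "L = (\<lambda>j. snd (kL j))"
  have O: "outcome Ms K (Z j) (dstep k d j) (kd j) (L j)" and kds: "kd j \<in> {0, 2, 3, 4, 5}"
    and redk: "red j \<longleftrightarrow> kd j \<in> {0, 2, 3}" and k4: "kd j = 4 \<Longrightarrow> pos j < pos k" and k5: "kd j = 5 \<Longrightarrow> pos k < pos j"
    if "j < n" "j \<noteq> k" for j
    using kL[OF that] by (auto simp: P_def kd_def L_def)
  note O = outcomeD[OF O]
  \<comment> \<open>A kind 0 module with nonzero Ext to \<open>K\<close> must stand before
    \<open>K\<close>. The condition \<open>pos j \<le> pos i\<close> moves all kind 0 modules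
    preceding such a module along with it, so that their mutual order is kept.\<close>
  define early where "early = (\<lambda>j. \<exists>i<n. red i \<and> \<not> Ext0 (Z i) K \<and> pos j \<le> pos i)"
  define rk where "rk = (\<lambda>j. if j = k then 1 else if kd j = 0 then (if early j then 0 else 2) else kd j)"
  \<comment> \<open>\<open>B\<close> exceeds all old positions, so \<open>pos'\<close> compares
    ranks first and old positions second.\<close>
  define B where "B = Suc (\<Sum>j<n. pos j)"
  define pos' where "pos' = (\<lambda>j. rk j * B + pos j)"
  define Z' where "Z' = (\<lambda>j. if j = k then K else L j)"
  define red' where "red' = (\<lambda>j. j = k \<or> kd j \<in> {0, 2})"
  have posB: "pos j < B" if "j < n" for j
    using member_le_sum[of j "{..<n}" pos] that by (simp add: B_def less_Suc_eq_le)
  have pos': "pos' i < pos' j \<longleftrightarrow> rk i < rk j \<or> rk i = rk j \<and> pos i < pos j" if "i < n" "j < n" for i j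
    unfolding pos'_def by (rule lex_nat_less[OF posB posB, OF that])
  have Lr: "is_rep (L j)" if "j < n" "j \<noteq> k" for j using O(1)[OF that] excD(3) by blast
  have Zr: "is_rep (Z j)" if "j < n" for j using I(2)[OF that] excD(3) by blast
  have KZ: "perp K (Z j)" if "j < n" "j \<noteq> k" "kd j \<noteq> 5" for j
  proof -
    have "pos j < pos k"
      using k4[OF that(1,2)] I(5)[OF that(1) k] redk[OF that(1,2)] gk kds[OF that(1,2)] that(3) by auto
    then show ?thesis using I(3)[OF that(1) k] by (simp add: K_def)
  qed
  have Lk: "perp (L j) K" if j: "j < n" "j \<noteq> k" and r: "rk j \<noteq> 0" for j
  proof (cases "kd j = 0")
    case True
    then have "\<not> early j" using r j by (auto simp: rk_def)
    then have "Ext0 (Z j) K" using j redk[OF j] True by (auto simp: early_def)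
    then show ?thesis using O(7,8)[OF j] True by simp
  next
    case False then show ?thesis using O(6)[OF j] by blast
  qed
  have core: "perp (Z j) (Z i)" if i: "i < n" "i \<noteq> k" and j: "j < n" "j \<noteq> k" and lt: "pos' i < pos' j" for i j
  proof (cases "pos i < pos j")
    case True then show ?thesis using I(3)[OF i(1) j(1)] by blast
  next
    case False
    have "i \<noteq> j" using lt by auto
    then have pji: "pos j < pos i" using False I(4)[OF i(1) j(1)] by blast
    then have rl: "rk i < rk j" using lt pos'[OF i(1) j(1)] by auto
    have p: "perp (Z i) (Z j)" using I(3)[OF j(1) i(1) pji] .
    have "\<not> (red i \<and> \<not> red j)" using I(5)[OF i(1) j(1)] pji by auto
    moreover have "red i" "red j"
    proof -
      show "red j"
      proof (rule ccontr)
        assume nj: "\<not> red j"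
        then have "\<not> red i" using calculation by blast
        then have "kd i \<in> {4, 5}" "kd j \<in> {4, 5}" using nj kds[OF i] kds[OF j] redk[OF i] redk[OF j] by auto
        then have "kd i = 4" "kd j = 5" using rl i(2) j(2) by (auto simp: rk_def)
        then show False using k4[OF i] k5[OF j] pji by simp
      qed
      then show "red i" using I(5)[OF j(1) i(1)] redk[OF i] redk[OF j] kds[OF i] rl i(2) j(2)
        by (auto simp: rk_def split: if_splits)
    qed
    ultimately have ki: "kd i \<in> {0, 2, 3}" and kj: "kd j \<in> {0, 2, 3}" using redk[OF i] redk[OF j] by auto
    have H: "Hom0 (Z j) (Z i)" using I(6)[OF j(1) i(1)] \<open>i \<noteq> j\<close> \<open>red i\<close> \<open>red j\<close> by auto
    have Ki: "perp K (Z i)" using KZ[OF i] ki by auto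
    show ?thesis
    proof (cases "kd j = 3")
      case True
      then show ?thesis using O(10)[OF j True Zr[OF i(1)]] Ki H by blast
    next
      case False
      \<comment> \<open>The remaining reversal puts an early kind 0 module \<open>i\<close> before a
        kind 2 module \<open>j\<close> that used to precede it. It is impossible: the witness
        \<open>i0\<close> of earliness has no Ext to \<open>Z j\<close>, hence by kind 2 none to
        \<open>K\<close>.\<close>
      have "rk i = 0 \<and> rk j = 2"
        using rl ki kj False i(2) j(2) by (auto simp: rk_def split: if_splits)
      then have "early i" and rj: "kd j = 0 \<Longrightarrow> \<not> early j"
        using i(2) j(2) ki by (auto simp: rk_def split: if_splits)
      then obtain i0 where i0: "i0 < n" "red i0" "\<not> Ext0 (Z i0) K" "pos i \<le> pos i0" by (auto simp: early_def)
      then have "early j" using pji by (auto simp: early_def intro: exI[of _ i0])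
      then have "kd j = 2" using rj kj False by auto
      moreover have "perp (Z i0) (Z j)" using I(3)[OF j(1) i0(1)] pji i0(4) by simp
      ultimately have "Ext0 (Z i0) K" using O(9)[OF j _ Zr[OF i0(1)]] by blast
      then show ?thesis using i0(3) by blast
    qed
  qed
  have order: "perp (Z' j) (Z' i)" if ij: "i < n" "j < n" and lt: "pos' i < pos' j" for i j
  proof -
    have rle: "rk i \<le> rk j" using lt pos'[OF ij] by auto
    show ?thesis
    proof (cases "i = k")
      case True
      then have "j \<noteq> k" using lt by auto
      moreover have "rk j \<noteq> 0" using rle True by (auto simp: rk_def)
      ultimately show ?thesis using Lk[OF ij(2)] True by (simp add: Z'_def)
    next
      case ik: False
      show ?thesis
      proof (cases "j = k")
        case True
        then have "rk i \<le> 1" using rle by (simp add: rk_def)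
        then have "kd i = 0" using kds[OF ij(1) ik] ik by (auto simp: rk_def split: if_splits)
        then show ?thesis using KZ[OF ij(1) ik] O(7)[OF ij(1) ik] ik True by (simp add: Z'_def)
      next
        case jk: False
        note c = core[OF ij(1) ik ij(2) jk lt]
        note jn = ij(2) jk and "in" = ij(1) ik
        have LZ: "perp (L j) (Z i)"
        proof (cases "kd i = 5")
          case True
          then have "kd j = 5" using rle kds[OF jn] ik jk by (auto simp: rk_def split: if_splits)
          then show ?thesis using O(7)[OF jn] c by simp
        next
          case False
          then show ?thesis using O(5)[OF jn Zr[OF ij(1)] c] KZ[OF "in"] by blast
        qed
        have "perp (L j) (L i)"
        proof (cases "rk j = 0")
          case True
          then have "rk i = 0" using rle by simp
          then have "kd i = 0" using ik by (auto simp: rk_def split: if_splits)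
          then show ?thesis using O(7)[OF "in"] LZ by simp
        next
          case False
          then show ?thesis using O(4)[OF "in" Lr[OF jn] LZ] Lk[OF jn] by blast
        qed
        then show ?thesis using ik jk by (simp add: Z'_def)
      qed
    qed
  qed
  have inj': "inj_on pos' {..<n}"
  proof (rule inj_onI)
    fix i j assume i: "i \<in> {..<n}" and j: "j \<in> {..<n}" and e: "pos' i = pos' j"
    then have "\<not> pos' i < pos' j" "\<not> pos' j < pos' i" by auto
    then have "\<not> pos i < pos j" "\<not> pos j < pos i" using i j pos'[of i j] pos'[of j i] by auto
    then show "i = j" using I(4)[of i j] i j by blast
  qed
  have rg: "pos' i < pos' j" if ij: "i < n" "j < n" "red' i" "\<not> red' j" for i j
  proof -
    have "rk i \<le> 2" using that by (auto simp: red'_def rk_def)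
    moreover have "rk j \<ge> 3" using that kds[OF ij(2)] by (auto simp: red'_def rk_def)
    ultimately show ?thesis using pos'[OF ij(1,2)] by auto
  qed
  have homs: "Hom0 (Z' i) (Z' j)" if ij: "i < n" "j < n" "i \<noteq> j" "red' i = red' j" for i j
  proof (cases "red' i")
    case True
    then have rj: "red' j" using ij by simp
    show ?thesis
    proof (cases "i = k")
      case True
      then have j: "j < n" "j \<noteq> k" "kd j \<in> {0, 2}" using rj ij by (auto simp: red'_def)
      then show ?thesis using O(11)[OF j(1,2,3) Kr] KZ[OF j(1,2)] True by (auto simp: Z'_def)
    next
      case ik: False
      then have ki: "kd i \<in> {0, 2}" using True by (auto simp: red'_def)
      note "in" = ij(1) ik
      show ?thesis
      proof (cases "j = k")
        case True
        then show ?thesis using ki O(6,7,8)[OF "in"] ik by (auto simp: Z'_def)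
      next
        case jk: False
        then have kj: "kd j \<in> {0, 2}" using rj by (auto simp: red'_def)
        note jn = ij(2) jk
        have "red i" "red j" using ki kj redk[OF "in"] redk[OF jn] by auto
        then have "Hom0 (Z i) (Z j)" using I(6)[OF ij(1,2,3)] by simp
        then have "Hom0 (L i) (Z j)" using O(12)[OF "in" ki Zr[OF ij(2)]] KZ[OF jn] kj by auto
        then have "Hom0 (L i) (L j)" using O(11)[OF jn kj Lr[OF "in"]] by blast
        then show ?thesis using ik jk by (simp add: Z'_def)
      qed
    qed
  next
    case False
    then have ik: "i \<noteq> k" "kd i \<in> {3, 4, 5}" and jk: "j \<noteq> k" "kd j \<in> {3, 4, 5}"
      using ij kds[of i] kds[of j] by (auto simp: red'_def)
    note "in" = ij(1) ik(1) and jn = ij(2) jk(1)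
    have LiK: "perp (L i) K" using O(6)[OF "in"] ik by auto
    have "Hom0 (L i) (L j)"
    proof (cases "kd j = 3")
      case False
      then have kj: "kd j \<in> {4, 5}" using jk by auto
      have "\<not> red j" using redk[OF jn] kj by auto
      then have "Hom0 K (Z j)" using I(6)[OF k ij(2)] jk(1) gk by (simp add: K_def)
      moreover have "Hom0 (Z i) (Z j)" if "kd i \<noteq> 3"
      proof -
        have "\<not> red i" using redk[OF "in"] ik(2) that by auto
        then show ?thesis using I(6)[OF ij(1,2,3)] \<open>\<not> red j\<close> by simp
      qed
      ultimately have "Hom0 (L i) (Z j)" using O(14)[OF "in" ik(2) Zr[OF ij(2)]] by blast
      then show ?thesis using O(13)[OF jn kj Lr[OF "in"]] LiK by blast
    next
      case j3: True
      show ?thesis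
      proof (cases "kd i = 3")
        case True
        have "red i" "red j" using True j3 redk[OF "in"] redk[OF jn] by auto
        then have "Hom0 (Z i) (Z j)" using I(6)[OF ij(1,2,3)] by simp
        then have "Ext0 (L i) (Z j)" using O(16)[OF "in" True Zr[OF ij(2)]] KZ[OF jn] j3 by auto
        then show ?thesis using O(15)[OF jn j3 Lr[OF "in"]] LiK by blast
      next
        case False
        then have "pos' j < pos' i" using ik jk j3 pos'[OF ij(2,1)] by (auto simp: rk_def)
        then show ?thesis using order[OF ij(2,1)] ik jk by (simp add: Z'_def)
      qed
    qed
    then show ?thesis using ik jk by (simp add: Z'_def)
  qed
  have "seed (Ms @ [K]) Z' red' pos' (dstep k d)"
    unfolding seed_def
  proof (intro conjI allI impI ballI)
    show "is_rep M" if "M \<in> set (Ms @ [K])" for M using that I(1) Kr by auto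
    show "exc (Z' j)" if "j < n" for j using O(1)[OF that] excK by (simp add: Z'_def)
    show "Hom0 (Z' j) (Z' i)" "Ext0 (Z' j) (Z' i)" if "i < n" "j < n" "pos' i < pos' j" for i j
      using order[OF that] by auto
    show "inj_on pos' {..<n}" by (rule inj')
    show "pos' i < pos' j" if "i < n" "j < n" "red' i \<and> \<not> red' j" for i j using rg that by blast
    show "Hom0 (Z' i) (Z' j)" if "i < n" "j < n" "i \<noteq> j \<and> red' i = red' j" for i j using homs that by blast
    fix j assume j: "j < n"
    show "dstep k d j = (if red' j then (\<lambda>i. - dv (Z' j) i) else dv (Z' j))"
    proof (cases "j = k")
      case True
      then show ?thesis using dk by (simp add: fun_eq_iff dstep_def red'_def Z'_def)
    next
      case False
      then show ?thesis using O(2,3)[OF j False] kds[OF j False] by (auto simp: red'_def Z'_def)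
    qed
    { assume g: "\<not> red' j"
      then have jk: "j \<noteq> k" "kd j \<in> {3, 4, 5}" using kds[OF j] by (auto simp: red'_def)
      then show "orth (Ms @ [K]) (Z' j)" "Splus (Ms @ [K]) (Z' j)"
        using O(2)[OF j jk] by (auto simp: Z'_def) }
    { assume r: "red' j"
      show "Sminus (Ms @ [K]) (Z' j)"
        using O(3)[OF j] r Sminus_snoc_self[OF excD(1)[OF excK] oK] by (auto simp: red'_def Z'_def)
      fix N assume "orth (Ms @ [K]) N"
      then show "Hom0 N (Z' j)" using O(3)[OF j] r by (auto simp: red'_def Z'_def orth_snoc) }
  qed
  then show ?thesis unfolding K_def by blast
qed

section \<open>The acyclic order and the initial seed of simple modules\<close>

definition arrow_rel :: "(nat \<times> nat) set" where "arrow_rel = {(i, j). 0 < Q i j}"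

lemma no_cycle: "(i, j) \<in> arrow_rel\<^sup>* \<Longrightarrow> c < Q j i \<Longrightarrow> False"
proof -
  assume "(i, j) \<in> arrow_rel\<^sup>*" "c < Q j i"
  moreover from this(2) have "(j, i) \<in> arrow_rel" by (auto simp: arrow_rel_def)
  ultimately have "(j, j) \<in> arrow_rel\<^sup>+" using rtrancl_into_trancl2 by metis
  then show False using acy by (simp add: acyclic_quiver_def acyclic_def arrow_rel_def)
qed

definition anc :: "nat \<Rightarrow> nat set" where "anc j = {i. (i, j) \<in> arrow_rel\<^sup>+}"

lemma anc_less: assumes "0 < Q i j" shows "card (anc i) < card (anc j)"
proof (rule psubset_card_mono)
  have e: "(i, j) \<in> arrow_rel" using assms by (simp add: arrow_rel_def)
  have "anc j \<subseteq> {..<n}"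
  proof
    fix l assume "l \<in> anc j"
    then obtain l' where "(l, l') \<in> arrow_rel" unfolding anc_def by (auto dest: tranclD)
    then show "l \<in> {..<n}" using arrow_less by (auto simp: arrow_rel_def)
  qed
  then show "finite (anc j)" by (rule finite_subset) simp
  have "anc i \<subseteq> anc j" using e unfolding anc_def by (auto intro: trancl_into_trancl)
  moreover have "i \<in> anc j" using e unfolding anc_def by auto
  moreover have "i \<notin> anc i" using acy by (simp add: anc_def acyclic_quiver_def acyclic_def arrow_rel_def)
  ultimately show "anc i \<subset> anc j" by blast
qed

text \<open>The number of ancestors grows along arrows, and the vertex index breaks ties, so this is
  an injective linear extension of the arrow order.\<close>

definition topo :: "nat \<Rightarrow> nat" where "topo j = card (anc j) * n + j"

lemma topo_less: "0 < Q i j \<Longrightarrow> topo i < topo j"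
  using anc_less[of i j] arrow_less[of 0 i j] by (simp add: topo_def lex_nat_less)

definition one_vec :: vec where "one_vec = Abs_vec (\<lambda>_. True)"

lemma one_vec_nonzero: "one_vec \<noteq> 0"
proof
  assume "one_vec = 0"
  then have "Rep_vec one_vec 0 = Rep_vec 0 0" by simp
  then show False by (simp add: Rep_vec_zero) (simp add: one_vec_def Abs_vec_inverse)
qed

definition simple :: "nat \<Rightarrow> rep" where
  "simple j = Rep (\<lambda>i. if i = j then {0, one_vec} else {0}) (\<lambda>_ _ _ _. 0)"

lemma sp_simple [simp]: "sp (simple j) i = (if i = j then {0, one_vec} else {0})"
  and ac_simple [simp]: "ac (simple j) i i' c x = 0"
  by (simp_all add: simple_def)

lemma rep_simple: "j < n \<Longrightarrow> is_rep (simple j)"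
  unfolding is_rep_def by (auto simp: lin_def)

lemma dv_simple: "dv (simple j) i = (if i = j then 1 else 0)"
  using dimv_pair[OF one_vec_nonzero] by (simp add: dv_def)

lemma Q_loop: "Q i i = 0" using cq by (simp add: cluster_quiver_def)

lemma Ext0_simple:
  assumes "i < n" "j < n" "Q i j = 0" shows "Ext0 (simple i) (simple j)"
proof (rule Ext0I)
  fix g assume g: "C1 (simple i) (simple j) g"
  have "C0 (simple i) (simple j) (\<lambda>i x. 0)" by (simp add: C0_def lin_def)
  moreover have "g i' j' c x = del (simple i) (simple j) (\<lambda>i x. 0) i' j' c x"
    if c: "c < Q i' j'" and x: "x \<in> sp (simple i) i'" for i' j' c x
  proof -
    have "g i' j' c x = 0"
    proof (cases "i' = i \<and> j' = j")
      case True then show ?thesis using c assms by simp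
    next
      case False
      then show ?thesis
        using C1_in[OF g c x] x C1_0[OF g rep_simple[OF assms(1)] c] by (auto split: if_splits)
    qed
    then show ?thesis by (simp add: del_def)
  qed
  ultimately show "\<exists>f. C0 (simple i) (simple j) f \<and>
    (\<forall>i' j' c. c < Q i' j' \<longrightarrow> (\<forall>x\<in>sp (simple i) i'. g i' j' c x = del (simple i) (simple j) f i' j' c x))"
    by blast
qed

lemma Hom0_simple: "i < n \<Longrightarrow> i \<noteq> j \<Longrightarrow> Hom0 (simple i) (simple j)"
proof (rule Hom0I)
  fix f i' x assume "i < n" "i \<noteq> j" and f: "hom (simple i) (simple j) f" and x: "x \<in> sp (simple i) i'"
  then show "f i' x = 0"
    using hom_in[OF f x] hom_0[OF f rep_simple[OF \<open>i < n\<close>], of i'] by (cases "i' = i") (auto split: if_splits)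
qed

lemma exc_simple: assumes "j < n" shows "exc (simple j)"
proof -
  have "zero_on (simple j) f \<or> (\<forall>i. \<forall>x\<in>sp (simple j) i. f i x = x)" if f: "hom (simple j) (simple j) f" for f
  proof -
    have 0: "f i 0 = 0" for i by (rule hom_0[OF f rep_simple[OF assms]])
    have "f j one_vec \<in> {0, one_vec}" using hom_in[OF f, of one_vec j] by simp
    then show ?thesis using 0 by (auto simp: zero_on_def)
  qed
  moreover have "nonzero (simple j)" using one_vec_nonzero by (auto simp: nonzero_def intro: exI[of _ j])
  ultimately show ?thesis
    using Ext0_simple[OF assms assms] Q_loop rep_simple[OF assms] by (simp add: exc_def brick_def)
qed

definition unitv :: "nat \<Rightarrow> nat \<Rightarrow> int" where "unitv j i = (if i = j then 1 else 0)"

text \<open>Ext between two simples needs an arrow from the first to the second, so later simples in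
  the order \<open>topo\<close> have no Ext to earlier ones. All vertices are green and the torsion
  class is the whole category, where a nonzero map to a simple is onto.\<close>

lemma seed_init: "seed [] simple (\<lambda>_. False) topo unitv"
  unfolding seed_def
proof (intro conjI allI impI ballI)
  show "exc (simple j)" if "j < n" for j by (rule exc_simple[OF that])
  show "Hom0 (simple j) (simple i)" if "i < n" "j < n" "topo i < topo j" for i j
    using Hom0_simple that by (metis less_irrefl)
  show "Ext0 (simple j) (simple i)" if "i < n" "j < n" "topo i < topo j" for i j
    using Ext0_simple[OF that(2,1)] topo_less[of j i] that(3) by (cases "Q j i = 0") auto
  show "inj_on topo {..<n}"
  proof (rule inj_onI)
    fix i j assume "i \<in> {..<n}" "j \<in> {..<n}" "topo i = topo j"
    moreover have "topo i mod n = i" if "i < n" for i using that by (simp add: topo_def)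
    ultimately show "i = j" by (metis lessThan_iff)
  qed
  show "Hom0 (simple i) (simple j)" if "i < n" "j < n" "i \<noteq> j \<and> False = False" for i j
    using Hom0_simple that by blast
  show "unitv j = (if False then \<lambda>i. - dv (simple j) i else dv (simple j))" if "j < n" for j
    by (auto simp: unitv_def dv_simple)
  show "orth [] (simple j)" if "j < n" for j using rep_simple[OF that] by (simp add: orth_def)
  show "Splus [] (simple j)" if "j < n" for j
    unfolding Splus_def
  proof (intro allI impI)
    fix N f assume *: "orth [] N \<and> hom N (simple j) f \<and> \<not> zero_on N f"
    then have Nr: "is_rep N" and f: "hom N (simple j) f" by (auto simp: orth_def)
    obtain i x where x: "x \<in> sp N i" "f i x \<noteq> 0" using * by (auto simp: zero_on_def)
    then have ij: "i = j" "f j x = one_vec" using hom_in[OF f x(1)] by (auto split: if_splits)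
    have "onto N (simple j) f" unfolding onto_def
    proof (intro allI ballI)
      fix i' y assume "y \<in> sp (simple j) i'"
      then have "y = 0 \<or> i' = j \<and> y = one_vec" by (auto split: if_splits)
      then show "\<exists>x\<in>sp N i'. f i' x = y" using x ij rep_zero[OF Nr] hom_0[OF f Nr] by metis
    qed
    then show "onto N (simple j) f \<and> orth [] (ker N f)"
      using rep_ker[OF Nr rep_simple[OF that] f] by (simp add: orth_def)
  qed
qed auto

section \<open>Green sequences and the modules along them\<close>

definition dd :: "nat list \<Rightarrow> nat \<Rightarrow> nat \<Rightarrow> int" where "dd ks = fold dstep ks unitv"

lemma dd_Nil: "dd [] = unitv" and dd_snoc: "dd (ks @ [k]) = dstep k (dd ks)"
  by (simp_all add: dd_def)

definition greenseq :: "nat list \<Rightarrow> bool" where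
  "greenseq ks \<longleftrightarrow> (\<forall>t<length ks. ks ! t < n \<and> (\<forall>i<n. 0 \<le> dd (take t ks) (ks ! t) i))"

text \<open>A seed describes only the final state, whereas the argument about bad mutations needs
  the modules and torsion classes at each time \<open>t\<close>. The last clause keeps the other
  green modules of that time, which survive into the next torsion class.\<close>

definition hist :: "nat list \<Rightarrow> rep list \<Rightarrow> bool" where
  "hist ks Ms \<longleftrightarrow> length Ms = length ks \<and> (\<forall>t<length ks. exc (Ms ! t) \<and> dv (Ms ! t) = dd (take t ks) (ks ! t) \<and>
    orth (take t Ms) (Ms ! t) \<and> Splus (take t Ms) (Ms ! t) \<and>
    (\<forall>j<n. (\<forall>i<n. 0 \<le> dd (take t ks) j i) \<and> j \<noteq> ks ! t \<longrightarrow>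
      (\<exists>X. orth (take (Suc t) Ms) X \<and> dv X = dd (take t ks) j)))"

lemma greenseq_snoc: "greenseq (ks @ [k]) \<longleftrightarrow> greenseq ks \<and> k < n \<and> (\<forall>i<n. 0 \<le> dd ks k i)"
  by (auto simp: greenseq_def nth_append less_Suc_eq all_conj_distrib)

lemma seed_not_red:
  assumes I: "seed Ms Z red pos d" and j: "j < n" and "\<forall>i<n. 0 \<le> d j i" shows "\<not> red j"
proof
  assume r: "red j"
  note e = excD(3)[OF seedD(2)[OF I j]]
  have "dv (Z j) i = 0" for i
    using assms(3) seedD(7)[OF I j] r dv_nonneg[of "Z j" i] dv_outside[OF e] by (cases "i < n") force+
  then show False using nonzero_dv[OF e] brickD(2)[OF excD(1)[OF seedD(2)[OF I j]]] by blast
qed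

lemma hist_exists:
  "greenseq ks \<Longrightarrow> \<exists>Ms Z red pos. hist ks Ms \<and> seed Ms Z red pos (dd ks)"
proof (induction ks rule: rev_induct)
  case Nil
  have "hist [] []" by (simp add: hist_def)
  then show ?case using seed_init unfolding dd_Nil by blast
next
  case (snoc k ks)
  then have g: "greenseq ks" "k < n" "\<forall>i<n. 0 \<le> dd ks k i" by (auto simp: greenseq_snoc)
  from snoc.IH[OF g(1)] obtain Ms Z red pos where H: "hist ks Ms" and I: "seed Ms Z red pos (dd ks)" by blast
  have gk: "\<not> red k" by (rule seed_not_red[OF I g(2,3)])
  obtain Z' red' pos' where I': "seed (Ms @ [Z k]) Z' red' pos' (dd (ks @ [k]))"
    using seed_step[OF I g(2) gk] unfolding dd_snoc by blast
  have len: "length Ms = length ks" using H by (simp add: hist_def)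
  have dk: "dd ks k = dv (Z k)" using seedD(7)[OF I g(2)] gk by simp
  have new: "\<exists>X. orth (Ms @ [Z k]) X \<and> dv X = dd ks j" if "j < n" "\<forall>i<n. 0 \<le> dd ks j i" "j \<noteq> k" for j
  proof -
    have "\<not> red j" by (rule seed_not_red[OF I that(1,2)])
    then have "orth (Ms @ [Z k]) (Z j)" "dv (Z j) = dd ks j"
      using seedD(6)[OF I that(1) g(2) that(3)] seedD(7,8)[OF I that(1)] gk by (auto simp: orth_snoc)
    then show ?thesis by blast
  qed
  have "hist (ks @ [k]) (Ms @ [Z k])"
    unfolding hist_def
  proof (intro conjI allI impI)
    fix t assume t: "t < length (ks @ [k])"
    have "t < length ks \<or> t = length ks" using t by auto
    then have "exc ((Ms @ [Z k]) ! t) \<and> dv ((Ms @ [Z k]) ! t) = dd (take t (ks @ [k])) ((ks @ [k]) ! t) \<and>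
      orth (take t (Ms @ [Z k])) ((Ms @ [Z k]) ! t) \<and> Splus (take t (Ms @ [Z k])) ((Ms @ [Z k]) ! t) \<and>
      (\<forall>j<n. (\<forall>i<n. 0 \<le> dd (take t (ks @ [k])) j i) \<and> j \<noteq> (ks @ [k]) ! t \<longrightarrow>
        (\<exists>X. orth (take (Suc t) (Ms @ [Z k])) X \<and> dv X = dd (take t (ks @ [k])) j))"
    proof
      assume "t < length ks"
      then show ?thesis using H len unfolding hist_def by (simp add: nth_append)
    next
      assume "t = length ks"
      then show ?thesis
        using len seedD(2)[OF I g(2)] seedD(8,9)[OF I g(2) gk] dk new by (simp add: nth_append)
    qed
    then show "exc ((Ms @ [Z k]) ! t)" "dv ((Ms @ [Z k]) ! t) = dd (take t (ks @ [k])) ((ks @ [k]) ! t)"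
      "orth (take t (Ms @ [Z k])) ((Ms @ [Z k]) ! t)" "Splus (take t (Ms @ [Z k])) ((Ms @ [Z k]) ! t)"
      "\<And>j. j < n \<Longrightarrow> (\<forall>i<n. 0 \<le> dd (take t (ks @ [k])) j i) \<and> j \<noteq> (ks @ [k]) ! t \<Longrightarrow>
        \<exists>X. orth (take (Suc t) (Ms @ [Z k])) X \<and> dv X = dd (take t (ks @ [k])) j"
      by blast+
  qed (simp add: len)
  then show ?case using I' by blast
qed

section \<open>Multiple edges\<close>

lemma eul_sum: "eul x (unitv i) = x i - (\<Sum>l<n. int (Q l i) * x l)" if "i < n"
  using that by (simp add: eul_def unitv_def if_distrib[of "(*) _"] sum.delta cong: if_cong)

text \<open>In the order \<open>topo\<close> the matrix of the Euler form is unitriangular, so the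
  entries of \<open>x\<close> vanish one after the other.\<close>

lemma eul_unit_zero:
  assumes "\<And>i. i < n \<Longrightarrow> eul x (unitv i) = 0" "i < n" shows "x i = 0"
  using assms(2)
proof (induction "topo i" arbitrary: i rule: less_induct)
  case less
  have "int (Q l i) * x l = 0" if "l < n" for l
    using less(1)[OF topo_less that] by (cases "Q l i = 0") auto
  then have "(\<Sum>l<n. int (Q l i) * x l) = 0" by (intro sum.neutral) blast
  then show ?case using eul_sum[OF less(2), of x] assms(1)[OF less(2)] by simp
qed

text \<open>Undo the last step: the pairing with \<open>dd ks k\<close> vanishes because mutation
  only changes its sign, and then the other old vectors differ from the new ones by multiples of
  it.\<close>

lemma eul_dd_zero:
  assumes "\<And>j. j < n \<Longrightarrow> eul x (dd ks j) = 0" "set ks \<subseteq> {..<n}" "i < n" shows "eul x (unitv i) = 0"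
  using assms(1,2)
proof (induction ks rule: rev_induct)
  case Nil then show ?case using assms(3) by (simp add: dd_Nil)
next
  case (snoc k ks)
  have k: "k < n" using snoc(3) by simp
  have "dd (ks @ [k]) k = (\<lambda>i. - dd ks k i)" by (simp add: dd_snoc dstep_def fun_eq_iff)
  then have 0: "eul x (dd ks k) = 0" using snoc(2)[OF k] by (simp add: eul_neg_right)
  have "eul x (dd ks j) = 0" if "j < n" for j
  proof (cases "j = k")
    case False
    then have "dd (ks @ [k]) j = (\<lambda>i. dd ks j i + max 0 (om (dd ks j) (dd ks k)) * dd ks k i)"
      by (simp add: dd_snoc dstep_def fun_eq_iff)
    then show ?thesis using snoc(2)[OF that] 0 by (simp add: eul_add_right)
  qed (use 0 in simp)
  then show ?case using snoc.IH snoc(3) by simp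
qed

text \<open>A module without maps to the red modules is made left perpendicular to all of them by
  successive universal extensions; if all vertices are red, it then vanishes.\<close>

lemma end_zero:
  assumes I: "seed Ms Z red pos (dd ks)" and ks: "set ks \<subseteq> {..<n}" and r: "\<And>j. j < n \<Longrightarrow> red j"
    and N: "orth Ms N" shows "\<not> nonzero N"
proof
  assume nz: "nonzero N"
  note I = seedD[OF I]
  have "\<exists>E. is_rep E \<and> nonzero E \<and> (\<forall>l<n. Hom0 E (Z l)) \<and> (\<forall>j<n. pos j < m \<longrightarrow> perp E (Z j))" for m
  proof (induction m)
    case 0
    then show ?case using nz orth_rep[OF N] I(10)[OF _ r N] by blast
  next
    case (Suc m)
    then obtain E where E: "is_rep E" "nonzero E" "\<And>l. l < n \<Longrightarrow> Hom0 E (Z l)"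
      "\<And>j. j < n \<Longrightarrow> pos j < m \<Longrightarrow> perp E (Z j)" by blast
    show ?case
    proof (cases "\<exists>j<n. pos j = m")
      case False
      then have "pos j < m" if "j < n" "pos j < Suc m" for j using that by (metis less_antisym)
      then show ?thesis using E by (intro exI[of _ E]) blast
    next
      case True
      then obtain j where j: "j < n" "pos j = m" by blast
      obtain E' p q where E': "is_rep E'" "hom E' E p" "onto E' E p" "Filt (Z j) q (ker E' p)" "perp E' (Z j)"
        using universal_ext[OF I(2)[OF j(1)] E(1) E(3)[OF j(1)]] by blast
      have S: "ses (ker E' p) E' E (\<lambda>i x. x) p" by (rule ses_ker[OF E'(1) E(1) E'(2,3)])
      have zr: "is_rep (Z l)" if "l < n" for l using excD(3)[OF I(2)[OF that]] .
      have "Hom0 E' (Z l)" if "l < n" for l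
      proof (cases "l = j")
        case False
        then have "Hom0 (Z j) (Z l)" using I(6)[OF j(1) that] r[OF that] r[OF j(1)] by simp
        then show ?thesis
          using Hom0_middle_left[OF S _ E(3)[OF that]] Filt_props(3)[OF E'(4) zr[OF j(1)] zr[OF that]] by blast
      qed (use E' in simp)
      moreover have "perp E' (Z l)" if l: "l < n" "pos l < Suc m" for l
      proof (cases "l = j")
        case False
        then have "pos l < m" using I(4)[OF l(1) j(1)] l(2) j(2) by auto
        then have "perp (Z j) (Z l)" using I(3)[OF l(1) j(1)] j(2) by simp
        then show ?thesis
          using perp_left_B[OF S zr[OF l(1)]] perp_Filt(1)[OF E'(4) zr[OF j(1)] zr[OF l(1)]]
            E(4)[OF l(1) \<open>pos l < m\<close>] by blast
      qed (use E' in simp)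
      moreover have "nonzero E'"
      proof -
        obtain i x where x: "x \<in> sp E i" "x \<noteq> 0" using E(2) by (auto simp: nonzero_def)
        then obtain e where e: "e \<in> sp E' i" "p i e = x" using E'(3) unfolding onto_def by blast
        then have "e \<noteq> 0" using x hom_0[OF E'(2,1), of i] by auto
        then show ?thesis using e unfolding nonzero_def by blast
      qed
      ultimately show ?thesis using E'(1) by blast
    qed
  qed
  from this[of "Suc (\<Sum>j<n. pos j)"] obtain E where E: "is_rep E" "nonzero E"
    "\<And>j. j < n \<Longrightarrow> pos j < Suc (\<Sum>j<n. pos j) \<Longrightarrow> perp E (Z j)" by blast
  have "eul (dv E) (dd ks j) = 0" if "j < n" for j
  proof -
    have "pos j \<le> (\<Sum>j<n. pos j)" using that by (intro member_le_sum) auto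
    then have "perp E (Z j)" using E(3)[OF that] by simp
    then have "eul (dv E) (dv (Z j)) = 0" using eul_perp[OF E(1) excD(3)[OF I(2)[OF that]]] by blast
    then show ?thesis using I(7)[OF that] r[OF that] by (simp add: eul_neg_right)
  qed
  then have "dv E i = 0" if "i < n" for i
    using eul_unit_zero[of "dv E" i] eul_dd_zero[of "dv E" ks] ks that by blast
  then have "dv E i = 0" for i using dv_outside[OF E(1), of i] by (cases "i < n") auto
  then show False using nonzero_dv[OF E(1)] E(2) by blast
qed

section \<open>Submodules, and a module that never leaves the torsion classes\<close>

definition reach :: "nat \<Rightarrow> nat \<Rightarrow> bool" where "reach i j \<longleftrightarrow> (i, j) \<in> arrow_rel\<^sup>*"

lemma reach_refl: "reach i i" by (simp add: reach_def)

lemma reach_step: "reach i j \<Longrightarrow> c < Q j l \<Longrightarrow> reach i l"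
proof -
  assume "reach i j" "c < Q j l"
  moreover have "(j, l) \<in> arrow_rel" using calculation by (auto simp: arrow_rel_def)
  ultimately show ?thesis unfolding reach_def by (rule_tac rtrancl_into_rtrancl)
qed

lemma reach_no_arrow: "reach i j \<Longrightarrow> \<not> c < Q j i"
  using no_cycle unfolding reach_def by blast

text \<open>A submodule containing \<open>v\<close> whose space at \<open>i\<close> is cut down to
  \<open>v\<close> alone, while everything downstream is kept. Acyclicity prevents a path from
  \<open>i\<close> from returning and enlarging that space.\<close>

definition gen :: "rep \<Rightarrow> nat \<Rightarrow> vec \<Rightarrow> nat \<Rightarrow> vec set" where
  "gen M i v j = (if j = i then {0, v} else if reach i j then sp M j else {0})"

lemma subfam_gen:
  assumes M: "is_rep M" and v: "v \<in> sp M i" shows "subfam M (gen M i v)"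
  unfolding subfam_def
proof (intro conjI allI impI ballI)
  show "subg (gen M i v j)" for j using rep_subg[OF M] by (simp add: gen_def)
  show "gen M i v j \<subseteq> sp M j" for j using v rep_zero[OF M] by (auto simp: gen_def)
  fix l j c x assume c: "c < Q l j" and x: "x \<in> gen M i v l"
  show "ac M l j c x \<in> gen M i v j"
  proof (cases "reach i l")
    case True
    have "x \<in> sp M l" using x v rep_zero[OF M] by (auto simp: gen_def split: if_splits)
    moreover have "j \<noteq> i" using reach_no_arrow[OF True] c by blast
    ultimately show ?thesis using ac_in[OF M c] reach_step[OF True c] by (simp add: gen_def)
  next
    case False
    then have "x = 0" using x reach_refl[of i] by (auto simp: gen_def split: if_splits)
    then show ?thesis using ac_0[OF M c] rep_zero[OF M] by (simp add: gen_def)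
  qed
qed

definition sz :: "rep \<Rightarrow> nat" where "sz M = (\<Sum>i<n. dimv (sp M i))"

lemma sz_ses: "ses A B C p q \<Longrightarrow> sz B = sz A + sz C"
proof -
  assume "ses A B C p q"
  then have "dimv (sp B i) = dimv (sp A i) + dimv (sp C i)" for i
    using dv_ses[of A B C p q i] by (simp add: dv_def)
  then show ?thesis by (simp add: sz_def sum.distrib)
qed

lemma sz_nonzero: "is_rep M \<Longrightarrow> nonzero M \<Longrightarrow> 0 < sz M"
proof -
  assume M: "is_rep M" "nonzero M"
  then obtain i where i: "dv M i \<noteq> 0" using nonzero_dv by blast
  then have "i < n" using dv_outside[OF M(1), of i] by (cases "i < n") auto
  then have "dimv (sp M i) \<le> sz M" unfolding sz_def by (intro member_le_sum) auto
  then show ?thesis using i by (simp add: dv_def)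
qed

lemma sub_eq_of_dv:
  assumes M: "is_rep M" and U: "subfam M U" and "dv (Rep U (ac M)) i = dv M i" shows "U i = sp M i"
proof -
  have "subg (U i)" "U i \<subseteq> sp M i" using U by (auto simp: subfam_def)
  moreover have "dimv (U i) = dimv (sp M i)" using assms(3) by (simp add: dv_def)
  ultimately show ?thesis
    using card_dimv[of "U i"] card_dimv[OF rep_subg[OF M, of i]] subgD(1)[OF rep_subg[OF M]]
    by (intro card_subset_eq) auto
qed

lemma orth_quot: "orth Ms B \<Longrightarrow> is_rep C \<Longrightarrow> hom B C q \<Longrightarrow> onto B C q \<Longrightarrow> orth Ms C"
  using Hom0_quot by (auto simp: orth_def)

text \<open>A nonzero map from \<open>G\<close> to \<open>M\<close> is onto with torsion kernel, and
  the kernel inherits the assumption on submodules. Peeling off copies of \<open>M\<close> ends at a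
  module without maps to \<open>M\<close>, which is itself excluded unless zero.\<close>

lemma dv_multiple:
  assumes M: "brick M" and SM: "Splus Ms M" and G: "orth Ms G"
    and nosub: "\<And>V. subfam G V \<Longrightarrow> orth (Ms @ [M]) (Rep V (ac G)) \<Longrightarrow> \<forall>i. V i = {0}"
  shows "\<exists>r. \<forall>i. dv G i = int r * dv M i"
  using G nosub
proof (induction "sz G" arbitrary: G rule: less_induct)
  case less
  note Gr = orth_rep[OF less(2)] and Mr = brickD(1)[OF M]
  show ?case
  proof (cases "Hom0 G M")
    case True
    have "subfam G (sp G)" unfolding subfam_def using rep_subg[OF Gr] ac_in[OF Gr] by auto
    moreover have "orth (Ms @ [M]) (Rep (sp G) (ac G))" using True less(2) by (simp add: orth_snoc)
    ultimately have "\<forall>i. sp G i = {0}" by (rule less(3))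
    then show ?thesis by (intro exI[of _ 0]) (simp add: dv_def)
  next
    case False
    then obtain f where f: "hom G M f" "\<not> zero_on G f" unfolding Hom0_def by blast
    from SplusD[OF SM less(2) f] have o: "onto G M f" and K: "orth Ms (ker G f)" by auto
    have S: "ses (ker G f) G M (\<lambda>i x. x) f" by (rule ses_ker[OF Gr Mr f(1) o])
    have "sz (ker G f) < sz G" using sz_ses[OF S] sz_nonzero[OF Mr brickD(2)[OF M]] by simp
    moreover have "\<forall>i. V i = {0}" if V: "subfam (ker G f) V" "orth (Ms @ [M]) (Rep V (ac (ker G f)))" for V
    proof (rule less(3))
      show "subfam G V" using V(1) unfolding subfam_def by auto
      show "orth (Ms @ [M]) (Rep V (ac G))" using V(2) by simp
    qed
    ultimately obtain r where r: "\<forall>i. dv (ker G f) i = int r * dv M i" using less(1)[OF _ K] by blast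
    have "dv G i = int (Suc r) * dv M i" for i using dv_ses[OF S, of i] r by (simp add: algebra_simps)
    then show ?thesis by blast
  qed
qed

lemma minimal_subfam:
  assumes M: "is_rep M" and w: "w \<in> sp M b"
  shows "\<exists>U. subfam M U \<and> w \<in> U b \<and> (\<forall>U'. subfam M U' \<and> w \<in> U' b \<and> (\<forall>i. U' i \<subseteq> U i) \<longrightarrow> (\<forall>i. U' i = U i))"
proof -
  define m where "m = (\<lambda>U :: nat \<Rightarrow> vec set. \<Sum>i<n. card (U i))"
  have "subfam M (sp M) \<and> w \<in> sp M b" unfolding subfam_def using rep_subg[OF M] ac_in[OF M] w by auto
  from ex_has_least_nat[of "\<lambda>U. subfam M U \<and> w \<in> U b", OF this, of m]
  obtain U where U: "subfam M U" "w \<in> U b" "\<And>U'. subfam M U' \<Longrightarrow> w \<in> U' b \<Longrightarrow> m U \<le> m U'" by blast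
  have "U' i = U i" if U': "subfam M U'" "w \<in> U' b" "\<And>i. U' i \<subseteq> U i" for U' i
  proof (cases "i < n")
    case True
    have fin: "finite (U i)" for i using U(1) by (simp add: subfam_def subgD)
    show ?thesis
    proof (rule ccontr)
      assume "U' i \<noteq> U i"
      then have "card (U' i) < card (U i)" using U'(3) fin by (intro psubset_card_mono) auto
      then have "m U' < m U" unfolding m_def
        using True U'(3) fin by (intro sum_strict_mono_ex1) (auto intro: card_mono)
      then show False using U(3)[OF U'(1,2)] by simp
    qed
  next
    case False
    then have "sp M i = {0}" using M by (simp add: is_rep_def)
    then have "U i \<subseteq> {0}" "0 \<in> U i" "0 \<in> U' i" using U(1) U'(1) unfolding subfam_def by (auto simp: subgD)
    then show ?thesis using U'(3)[of i] by auto
  qed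
  then show ?thesis using U(1,2) by blast
qed

lemma subfam_Int: "is_rep M \<Longrightarrow> subfam M U \<Longrightarrow> subfam M W \<Longrightarrow> subfam M (\<lambda>i. U i \<inter> W i)"
  unfolding subfam_def subg_def by auto

text \<open>A minimal quotient of \<open>Z\<close> containing \<open>a\<close> has socle \<open>a\<close>, and a minimal submodule of \<open>Ms ! t\<close>
  containing \<open>b\<close> has top \<open>b\<close>. Gluing the former onto the latter along a single arrow \<open>a \<rightarrow> b\<close> gives a
  module \<open>N\<close> that cannot leave the torsion classes: a quotient of \<open>N\<close> containing both \<open>a\<close> and \<open>b\<close> is
  deformed by the second arrow, hence not rigid.\<close>

lemma torsion_stuck:
  assumes ab: "2 \<le> Q a b"
    and lenM: "length Ms = m"
    and H: "\<And>t. t < m \<Longrightarrow> exc (Ms ! t)" "\<And>t. t < m \<Longrightarrow> Splus (take t Ms) (Ms ! t)"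
    and t: "t < m" "dv (Ms ! t) b \<noteq> 0"
    and Z: "orth (take (Suc t) Ms) Z" "dv Z a \<noteq> 0"
  shows "\<exists>N. orth Ms N \<and> nonzero N"
proof (rule ccontr)
  assume none: "\<not> (\<exists>N. orth Ms N \<and> nonzero N)"
  have tm: "take (Suc s) Ms = take s Ms @ [Ms ! s]" if "s < m" for s
    using that lenM by (simp add: take_Suc_conv_app_nth)
  have Qab: "0 < Q a b" "1 < Q a b" using ab by auto
  have neab: "a \<noteq> b" using Qab Q_loop by auto
  \<comment> \<open>\<open>S u\<close> says that after \<open>u\<close> mutations some torsion
    module is still supported at \<open>a\<close>. The last such stage lies strictly before the end,
    since the final torsion class is assumed to be zero.\<close>
  define S where "S = (\<lambda>u. u \<le> m \<and> (\<exists>N. orth (take u Ms) N \<and> dv N a \<noteq> 0))"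
  have St: "S (Suc t)" using t(1) Z unfolding S_def by auto
  have "\<forall>y. S y \<longrightarrow> y < Suc m" by (simp add: S_def less_Suc_eq_le)
  from ex_has_greatest_nat[of S _ "\<lambda>x. x", OF St this]
  obtain u where u: "S u" "\<And>y. S y \<Longrightarrow> y \<le> u" by auto
  have ut: "Suc t \<le> u" by (rule u(2)[OF St])
  have um: "u < m"
  proof (rule ccontr)
    assume "\<not> u < m"
    then have "u = m" using u(1) by (simp add: S_def)
    then obtain N where "orth Ms N" "dv N a \<noteq> 0" using u(1) lenM by (auto simp: S_def)
    then show False using none nonzero_dv[OF orth_rep] by blast
  qed
  have next0: "dv N a = 0" if "orth (take (Suc u) Ms) N" for N
  proof (rule ccontr)
    assume "dv N a \<noteq> 0"
    then have "S (Suc u)" using that um unfolding S_def by auto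
    then show False using u(2) by fastforce
  qed
  define T where "T = (\<lambda>N. orth (take u Ms) N)"
  have "\<exists>N. T N \<and> dv N a \<noteq> 0" using u(1) by (auto simp: S_def T_def)
  then obtain N0 where "T N0 \<and> dv N0 a \<noteq> 0" by blast
  \<comment> \<open>Torsion classes are closed under quotients, so by minimality the quotient of
    \<open>X\<close> by any nonzero submodule misses \<open>a\<close>; every nonzero submodule thus
    contains all of \<open>sp X a\<close>.\<close>
  from ex_has_least_nat[of "\<lambda>N. T N \<and> dv N a \<noteq> 0", OF this, of sz]
  obtain X where X: "T X" "dv X a \<noteq> 0" and least: "\<And>N. T N \<Longrightarrow> dv N a \<noteq> 0 \<Longrightarrow> sz X \<le> sz N" by blast
  have Xr: "is_rep X" using X(1) orth_rep by (simp add: T_def)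
  have socle: "L a = sp X a" if L: "subfam X L" "L i \<noteq> {0}" for L i
  proof -
    obtain C q where S0: "ses (Rep L (ac X)) X C (\<lambda>i x. x) q" using subfam_quotient[OF Xr L(1)] by blast
    have "T C" using orth_quot[OF X(1)[unfolded T_def] sesD(3,5,7)[OF S0]] by (simp add: T_def)
    moreover have "nonzero (Rep L (ac X))"
      using L unfolding subfam_def nonzero_def by (auto simp: subgD intro!: exI[of _ i] dest: subgD(2))
    then have "sz C < sz X" using sz_ses[OF S0] sz_nonzero[OF sesD(1)[OF S0]] by simp
    ultimately have "dv C a = 0" using least by fastforce
    then show ?thesis using dv_ses[OF S0, of a] by (intro sub_eq_of_dv[OF Xr L(1)]) simp
  qed
  obtain v where v: "v \<in> sp X a" "v \<noteq> 0" using X(2) dv_eq_0[OF Xr, of a] rep_zero[OF Xr, of a] by auto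
  have Xa: "sp X a = {0, v}"
    using socle[OF subfam_gen[OF Xr v(1)], of a] v(2) by (simp add: gen_def)
  have Xarrow: "ac X a j c x = 0" if c: "c < Q a j" and x: "x \<in> sp X a" for j c x
  proof (rule ccontr)
    assume nz: "ac X a j c x \<noteq> 0"
    have aj: "a \<noteq> j" using c Q_loop by auto
    have "\<not> reach j a" using reach_no_arrow c by blast
    then have "gen X j (ac X a j c x) a = {0}" using aj by (simp add: gen_def)
    moreover have "gen X j (ac X a j c x) j \<noteq> {0}" using nz by (simp add: gen_def)
    ultimately show False using socle[OF subfam_gen[OF Xr ac_in[OF Xr c x]]] Xa v(2) by auto
  qed
  have nrba: "\<not> reach b a" using reach_no_arrow Qab by blast
  have Xb: "sp X b = {0}"
  proof (rule ccontr)
    assume "sp X b \<noteq> {0}"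
    then obtain w where w: "w \<in> sp X b" "w \<noteq> 0" using rep_zero[OF Xr, of b] by auto
    have "gen X b w a = {0}" using nrba neab by (simp add: gen_def)
    moreover have "gen X b w b \<noteq> {0}" using w(2) by (simp add: gen_def)
    ultimately show False using socle[OF subfam_gen[OF Xr w(1)]] Xa v(2) by auto
  qed
  define M where "M = Ms ! t"
  have Mr: "is_rep M" using excD(3)[OF H(1)[OF t(1)]] by (simp add: M_def)
  obtain w where w: "w \<in> sp M b" "w \<noteq> 0"
    using t(2) dv_eq_0[OF Mr, of b] rep_zero[OF Mr, of b] by (auto simp: M_def)
  from minimal_subfam[OF Mr w(1)]
  obtain U where UU: "subfam M U \<and> w \<in> U b \<and>
    (\<forall>U'. subfam M U' \<and> w \<in> U' b \<and> (\<forall>i. U' i \<subseteq> U i) \<longrightarrow> (\<forall>i. U' i = U i))" ..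
  then have U: "subfam M U" "w \<in> U b" by simp_all
  have Umin: "\<forall>i. U' i = U i" if "subfam M U' \<and> w \<in> U' b \<and> (\<forall>i. U' i \<subseteq> U i)" for U'
    using UU[THEN conjunct2, THEN conjunct2, THEN spec, THEN mp, OF that] .
  have Ugen: "U i \<subseteq> gen M b w i" for i
  proof -
    have "\<forall>i. U i \<inter> gen M b w i = U i"
      using subfam_Int[OF Mr U(1) subfam_gen[OF Mr w(1)]] U(2)
      by (intro Umin[of "\<lambda>i. U i \<inter> gen M b w i"]) (simp add: gen_def)
    then show ?thesis by blast
  qed
  have U0: "0 \<in> U i" "U i \<subseteq> sp M i" for i using U(1) subgD(2) unfolding subfam_def by blast+
  have Ub: "U b = {0, w}" using Ugen[of b] U(2) U0 by (auto simp: gen_def)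
  have Ua: "U a = {0}" using Ugen[of a] nrba neab U0 by (auto simp: gen_def)
  define M' where "M' = Rep U (ac M)"
  have M'r: "is_rep M'" unfolding M'_def by (rule subfam_rep[OF Mr U(1)])
  have spM': "sp M' = U" "ac M' = ac M" by (simp_all add: M'_def)
  \<comment> \<open>Only arrow number 0 from \<open>a\<close> to \<open>b\<close> glues
    \<open>v\<close> to \<open>w\<close>; arrow number 1 acts on \<open>v\<close> as zero in
    \<open>N\<close>, and this is the slack used against rigidity.\<close>
  define g where "g = (\<lambda>i j c (x :: vec). if i = a \<and> j = b \<and> c = (0::nat) \<and> x \<noteq> 0 then w else 0 :: vec)"
  have g: "C1 X M' g"
    unfolding C1_def
  proof (intro allI impI)
    fix i j c assume "c < Q i j"
    show "lin (sp X i) (sp M' j) (g i j c)"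
    proof (cases "i = a \<and> j = b \<and> c = 0")
      case True
      then show ?thesis using U(2) U0 v(2) by (simp add: lin_def g_def Xa spM')
    next
      case False
      then have "g i j c = (\<lambda>x. 0)" by (auto simp: g_def fun_eq_iff)
      then show ?thesis using U0 by (simp add: lin_def spM')
    qed
  qed
  define N where "N = ext M' X g"
  have SN: "ses M' N X (\<lambda>i x. pr x 0) (\<lambda>i. sn)" unfolding N_def by (rule ses_ext[OF M'r Xr g])
  note Nr = sesD(2)[OF SN]
  have Na: "sp N a = {0, pr 0 v}"
  proof -
    have "z = 0 \<or> z = pr 0 v" if "fs z = 0" "sn z = 0 \<or> sn z = v" for z
      using that pr_fs_sn[of z] by auto
    then show ?thesis unfolding N_def by (auto simp: spM' Ua Xa)
  qed
  have Nb: "sp N b = {0, pr w 0}"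
  proof -
    have "z = 0 \<or> z = pr w 0" if "fs z = 0 \<or> fs z = w" "sn z = 0" for z
      using that pr_fs_sn[of z] by auto
    then show ?thesis unfolding N_def by (auto simp: spM' Ub Xb)
  qed
  have M0: "ac M a b c 0 = 0" if "c < Q a b" for c by (rule ac_0[OF Mr that])
  have act0: "ac N a b 0 (pr 0 v) = pr w 0"
    using M0[OF Qab(1)] Xarrow[OF Qab(1) v(1)] v(2) by (simp add: N_def spM' g_def)
  have act1: "ac N a b 1 (pr 0 v) = 0"
    using M0[OF Qab(2)] Xarrow[OF Qab(2) v(1)] by (simp add: N_def spM' g_def)
  have vN: "pr 0 v \<in> sp N a" using Na by simp
  have TN: "s \<le> u \<Longrightarrow> orth (take s Ms) N" for s
  proof (induction s)
    case 0 then show ?case using Nr by (simp add: orth_def)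
  next
    case (Suc s)
    then have o: "orth (take s Ms) N" and su: "s < u" and sm: "s < m" using um by auto
    define B where "B = Ms ! s"
    have excB: "exc B" using H(1)[OF sm] by (simp add: B_def)
    note Br = excD(3)[OF excB]
    have HX: "Hom0 X B"
    proof -
      have "B \<in> set (take u Ms)" unfolding B_def using su um lenM by (auto simp: in_set_conv_nth)
      then show ?thesis using X(1) by (simp add: T_def orth_def)
    qed
    have "Hom0 N B"
    proof (rule ccontr)
      assume "\<not> Hom0 N B"
      then obtain f where f: "hom N B f" and nz: "\<not> zero_on N f" unfolding Hom0_def by blast
      have on: "onto N B f" using SplusD[OF H(2)[OF sm, folded B_def] o f nz] by blast
      have fM': "hom M' B (\<lambda>i x. f i (pr x 0))" by (rule hom_comp[OF sesD(4)[OF SN] f])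
      \<comment> \<open>If \<open>f\<close> killed \<open>w\<close>, its kernel inside
        \<open>M'\<close> would be all of \<open>U\<close> by minimality. Then \<open>f\<close>
        would factor through \<open>X\<close>, which has no maps to \<open>B\<close>.\<close>
      have fw: "f b (pr w 0) \<noteq> 0"
      proof
        assume fw: "f b (pr w 0) = 0"
        have sub: "subfam M (\<lambda>i. {x \<in> U i. f i (pr x 0) = 0})"
          using subfam_ker[OF M'r Br fM'] U(1) unfolding subfam_def spM' by (simp add: subset_iff)
        have "\<forall>i. {x \<in> U i. f i (pr x 0) = 0} = U i"
          using sub U(2) fw by (intro Umin[of "\<lambda>i. {x \<in> U i. f i (pr x 0) = 0}"]) auto
        then have "f i (pr x 0) = 0" if "x \<in> sp M' i" for i x using that by (auto simp: spM')
        then obtain h where h: "hom X B h" "\<forall>i. \<forall>z\<in>sp N i. h i (sn z) = f i z"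
          using ses_factor_right[OF SN f] by blast
        have "f i z = 0" if "z \<in> sp N i" for i z
          using Hom0D[OF HX h(1) hom_in[OF sesD(5)[OF SN] that]] h(2) that by simp
        then show False using nz by (simp add: zero_on_def)
      qed
      have f0: "f i 0 = 0" for i by (rule hom_0[OF f Nr])
      let ?v = "f a (pr 0 v)" and ?w = "f b (pr w 0)"
      have Ba: "sp B a = {0, ?v}"
        using on hom_in[OF f vN] rep_zero[OF Br] f0 unfolding onto_def Na[symmetric]
        by (auto simp: Na) (metis Na empty_iff insert_iff)
      have Bb: "?w \<in> sp B b" using hom_in[OF f, of "pr w 0" b] Nb by simp
      have b0: "ac B a b 0 ?v = ?w" using hom_ac[OF f Qab(1) vN] act0 by simp
      have b1: "ac B a b 1 ?v = 0" using hom_ac[OF f Qab(2) vN] act1 f0 by simp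
      have v0: "?v \<noteq> 0" using b0 fw ac_0[OF Br Qab(1)] by auto
      \<comment> \<open>Switching on arrow number 1 of \<open>B\<close>. Rigidity would make
        \<open>h\<close> a boundary, but the space at \<open>a\<close> is spanned by the image of
        \<open>v\<close>, which arrow 1 kills, so every boundary vanishes there.\<close>
      define h where "h = (\<lambda>i j c (x :: vec). if i = a \<and> j = b \<and> c = (1::nat) \<and> x \<noteq> 0 then ?w else 0)"
      have "C1 B B h"
        unfolding C1_def
      proof (intro allI impI)
        fix i j c assume "c < Q i j"
        show "lin (sp B i) (sp B j) (h i j c)"
        proof (cases "i = a \<and> j = b \<and> c = 1")
          case True
          then show ?thesis using Bb rep_zero[OF Br] v0 by (simp add: lin_def h_def Ba)
        next
          case False
          then have "h i j c = (\<lambda>x. 0)" by (auto simp: h_def fun_eq_iff)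
          then show ?thesis using rep_zero[OF Br] by (simp add: lin_def)
        qed
      qed
      from Ext0D[OF excD(2)[OF excB] this]
      obtain y where y: "C0 B B y" "\<And>i j c x. c < Q i j \<Longrightarrow> x \<in> sp B i \<Longrightarrow> h i j c x = del B B y i j c x" by blast
      have vB: "?v \<in> sp B a" using Ba by simp
      have "?w = ac B a b 1 (y a ?v) + y b (ac B a b 1 ?v)"
        using y(2)[OF Qab(2) vB] v0 by (simp add: h_def del_def)
      moreover have "y a ?v = 0 \<or> y a ?v = ?v" using C0_in[OF y(1) vB] Ba by simp
      then have "ac B a b 1 (y a ?v) = 0" using b1 ac_0[OF Br Qab(2)] by auto
      ultimately show False using b1 C0_0[OF y(1) Br] fw by simp
    qed
    then show ?case using o tm[OF sm] by (simp add: orth_snoc B_def)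
  qed
  define Mu where "Mu = Ms ! u"
  have Mu: "brick Mu" "Splus (take u Ms) Mu" using H[OF um] excD(1) by (auto simp: Mu_def)
  have tmu: "take u Ms @ [Mu] = take (Suc u) Ms" using tm[OF um] by (simp add: Mu_def)
  have subX: "V i = {0}" if V: "subfam X V" "V a = {0}" for V i
    using socle[OF V(1), of i] V(2) Xa v(2) by auto
  have Va: "V a = {0}" if "subfam G V" "is_rep G" "orth (take u Ms @ [Mu]) (Rep V (ac G))" for G V
    using next0[OF that(3)[unfolded tmu]] dv_eq_0[OF subfam_rep[OF that(2,1)]] by simp
  have "\<exists>r. \<forall>i. dv X i = int r * dv Mu i"
    by (rule dv_multiple[OF Mu X(1)[unfolded T_def]]) (use subX Va[OF _ Xr] in blast)
  then obtain r where r: "\<And>i. dv X i = int r * dv Mu i" by blast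
  \<comment> \<open>A submodule of \<open>N\<close> in the next torsion class misses
    \<open>a\<close>, so its image in \<open>X\<close> is zero and it lies in \<open>M'\<close>,
    hence in \<open>M\<close>. But \<open>M\<close> has already been mutated at, so that torsion
    class has no maps to \<open>M\<close>.\<close>
  have "\<exists>r. \<forall>i. dv N i = int r * dv Mu i"
  proof (rule dv_multiple[OF Mu TN[OF order_refl]])
    fix V assume V: "subfam N V" "orth (take u Ms @ [Mu]) (Rep V (ac N))"
    note Vr = orth_rep[OF V(2)]
    have hi: "hom (Rep V (ac N)) N (\<lambda>i x. x)" by (rule subfam_incl[OF V(1)])
    have hX: "hom (Rep V (ac N)) X (\<lambda>i. sn)" using hom_comp[OF hi sesD(5)[OF SN]] .
    have "sn ` V a = {0}" using Va[OF V(1) Nr V(2)] by simp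
    then have sn0: "sn z = 0" if "z \<in> V i" for z i
      using subX[OF subfam_image[OF Vr Xr hX], of i] that by auto
    have VN: "V i \<subseteq> sp N i" for i using V(1) by (simp add: subfam_def)
    have "hom (Rep V (ac N)) M (\<lambda>i. fs)"
      unfolding hom_def C0_def lin_def
    proof (intro conjI allI ballI impI)
      fix i z assume z: "z \<in> sp (Rep V (ac N)) i"
      then show "fs z \<in> sp M i" using VN[of i] U0(2)[of i] by (auto simp: N_def spM')
      show "fs (z + y) = fs z + fs y" for y by simp
      show "fs (ac (Rep V (ac N)) i j c z) = ac M i j c (fs z)" if "c < Q i j" for j c
        using sn0[of z i] z by (simp add: N_def spM' g_def)
    qed
    moreover have "M \<in> set (take (Suc u) Ms)" unfolding M_def using ut um lenM by (auto simp: in_set_conv_nth intro!: exI[of _ t])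
    then have "Hom0 (Rep V (ac N)) M" using V(2) unfolding tmu by (simp add: orth_def)
    ultimately have "fs z = 0" if "z \<in> V i" for z i using Hom0D[of _ M "\<lambda>i. fs" z i] that by simp
    then have "z = 0" if "z \<in> V i" for z i using that sn0 pr_fs_sn[of z] by (metis pr_0)
    then show "\<forall>i. V i = {0}" using rep_zero[OF Vr] by auto
  qed
  then obtain r' where r': "\<And>i. dv N i = int r' * dv Mu i" by blast
  \<comment> \<open>Both dimension vectors are multiples of \<open>dv Mu\<close> with entry 1 at
    \<open>a\<close>, hence equal; yet at \<open>b\<close> their entries are 0 and 1.\<close>
  have "dv X a = 1" using dimv_pair[OF v(2)] by (simp add: dv_def Xa)
  then have "int r * dv Mu a = 1" using r[of a] by simp
  then have "dv Mu a = 1" "r = 1" using dv_nonneg[of Mu a] by (auto simp: zmult_eq_1_iff)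
  moreover have "dv N a = 1" using dimv_pair[of "pr 0 v"] v(2) by (simp add: dv_def Na)
  ultimately have "r' = 1" using r'[of a] by simp
  then have "dv N b = dv X b" using r[of b] r'[of b] \<open>r = 1\<close> by simp
  moreover have "dv N b = 1" using dimv_pair[of "pr w 0"] w(2) by (simp add: dv_def Nb)
  moreover have "dv X b = 0" by (simp add: dv_def Xb)
  ultimately show False by simp
qed

text \<open>\<open>torsion_stuck\<close> needs a module supported at \<open>a\<close> in the torsion
  class after step \<open>t\<close>. For \<open>j\<close> different from the mutated vertex,
  \<open>hist\<close> provides the green module at \<open>j\<close>. Otherwise the mutated module
  itself contains \<open>a\<close> and \<open>b\<close>, and a quotient of it serves. The stuck
  module contradicts \<open>end_zero\<close>.\<close>

theorem no_bad:
  assumes g: "greenseq ks" and fin: "\<And>j. j < n \<Longrightarrow> \<exists>i<n. dd ks j i < 0"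
    and ab: "2 \<le> Q a b" and t: "t < length ks" and b: "dd (take t ks) (ks ! t) b \<noteq> 0"
    and j: "j < n" "\<forall>i<n. 0 \<le> dd (take t ks) j i" and a: "dd (take t ks) j a \<noteq> 0"
  shows False
proof -
  obtain Ms Z red pos where H: "hist ks Ms" and I: "seed Ms Z red pos (dd ks)" using hist_exists[OF g] by blast
  have len: "length Ms = length ks" using H by (simp add: hist_def)
  have Ht: "exc (Ms ! t)" "dv (Ms ! t) = dd (take t ks) (ks ! t)" "orth (take t Ms) (Ms ! t)" "Splus (take t Ms) (Ms ! t)"
    if "t < length ks" for t using H that by (auto simp: hist_def)
  define M where "M = Ms ! t"
  have excM: "exc M" and dM: "dv M = dd (take t ks) (ks ! t)" and oM: "orth (take t Ms) M"
    using Ht[OF t] by (auto simp: M_def)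
  note Mr = excD(3)[OF excM]
  have tm: "take (Suc t) Ms = take t Ms @ [M]" using t len by (simp add: take_Suc_conv_app_nth M_def)
  have neab: "a \<noteq> b" using ab Q_loop by auto
  have nrba: "\<not> reach b a" using reach_no_arrow[of b a 0] ab by auto
  have "\<exists>X. orth (take (Suc t) Ms) X \<and> dv X a \<noteq> 0"
  proof (cases "j = ks ! t")
    case False
    then obtain X where "orth (take (Suc t) Ms) X" "dv X = dd (take t ks) j"
      using H t j unfolding hist_def by blast
    then show ?thesis using a by metis
  next
    case True
    \<comment> \<open>Everything downstream of \<open>b\<close> is divided out. This keeps
      \<open>a\<close>, as no path leads from \<open>b\<close> to \<open>a\<close>. A map from the
      quotient to \<open>M\<close> gives an endomorphism of the brick \<open>M\<close> that vanishes
      at \<open>b\<close>, so it is not the identity and must be zero.\<close>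
    define W where "W = (\<lambda>i. if reach b i then sp M i else {0})"
    have W: "subfam M W" unfolding subfam_def
    proof (intro conjI allI impI ballI)
      show "subg (W i)" for i using rep_subg[OF Mr] by (simp add: W_def)
      show "W i \<subseteq> sp M i" for i using rep_zero[OF Mr] by (simp add: W_def)
      show "ac M i l c x \<in> W l" if "c < Q i l" "x \<in> W i" for i l c x
        using that reach_step[of b i c l] ac_in[OF Mr that(1)] ac_0[OF Mr that(1)] rep_zero[OF Mr]
        by (auto simp: W_def split: if_splits)
    qed
    obtain C q where S: "ses (Rep W (ac M)) M C (\<lambda>i x. x) q" using subfam_quotient[OF Mr W] by blast
    have "dv (Rep W (ac M)) a = 0" using nrba by (simp add: dv_def W_def)
    then have "dv C a \<noteq> 0" using dv_ses[OF S, of a] a True dM by simp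
    moreover have "orth (take t Ms) C" by (rule orth_quot[OF oM sesD(3,5,7)[OF S]])
    moreover have "Hom0 C M"
    proof (rule Hom0I)
      fix f i x assume f: "hom C M f" and x: "x \<in> sp C i"
      obtain y where y: "y \<in> sp M b" "y \<noteq> 0" using b dM dv_eq_0[OF Mr, of b] rep_zero[OF Mr, of b] by auto
      have "q b y = 0" using ses_qp[OF S, of y b] y(1) reach_refl by (simp add: W_def)
      then have "f b (q b y) = 0" using hom_0[OF f sesD(3)[OF S]] by simp
      then have "\<not> (\<forall>i. \<forall>x\<in>sp M i. f i (q i x) = x)" using y by metis
      then have z: "zero_on M (\<lambda>i x. f i (q i x))"
        using brickD(3)[OF excD(1)[OF excM] hom_comp[OF sesD(5)[OF S] f]] by blast
      obtain y where "y \<in> sp M i" "q i y = x" using sesD(7)[OF S] x unfolding onto_def by blast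
      then show "f i x = 0" using z by (auto simp: zero_on_def)
    qed
    ultimately show ?thesis unfolding tm orth_snoc by blast
  qed
  then obtain X where X: "orth (take (Suc t) Ms) X" "dv X a \<noteq> 0" by blast
  have "dv (Ms ! t) b \<noteq> 0" using b dM by (simp add: M_def)
  from torsion_stuck[OF ab len Ht(1,4) t this X] obtain N where N: "orth Ms N" "nonzero N" by blast
  have r: "red j" if "j < n" for j
  proof (rule ccontr)
    assume "\<not> red j"
    then have "dd ks j = dv (Z j)" using seedD(7)[OF I that] by simp
    then show False using fin[OF that] dv_nonneg[of "Z j"] by (metis not_le)
  qed
  have "set ks \<subseteq> {..<n}" using g unfolding greenseq_def by (auto simp: in_set_conv_nth)
  then show False using end_zero[OF I _ r N(1)] N(2) by blast
qed

section \<open>Green sequences as a recursion on c-vectors\<close>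

lemma sign_coherent: "greenseq ks \<Longrightarrow> j < n \<Longrightarrow> (\<forall>i. 0 \<le> dd ks j i) \<or> (\<forall>i. dd ks j i \<le> 0)"
proof -
  assume "greenseq ks" "j < n"
  moreover obtain Ms Z red pos where "hist ks Ms" "seed Ms Z red pos (dd ks)" using hist_exists calculation by blast
  ultimately show ?thesis using seedD(7)[of Ms Z red pos "dd ks" j] dv_nonneg by (cases "red j") auto
qed

lemma dd_outside: "greenseq ks \<Longrightarrow> j < n \<Longrightarrow> n \<le> i \<Longrightarrow> dd ks j i = 0"
proof -
  assume a: "greenseq ks" "j < n" "n \<le> i"
  moreover obtain Ms Z red pos where I: "hist ks Ms" "seed Ms Z red pos (dd ks)" using hist_exists calculation by blast
  ultimately show ?thesis using seedD(7)[OF I(2), of j] dv_outside[OF excD(3)[OF seedD(2)[OF I(2)]], of j i] by simp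
qed

lemma green_pair:
  assumes "greenseq ks" "j < n" "l < n" "j \<noteq> l" "\<forall>i<n. 0 \<le> dd ks j i" "\<forall>i<n. 0 \<le> dd ks l i"
  shows "eul (dd ks j) (dd ks l) \<le> 0" "eul (dd ks j) (dd ks l) = 0 \<or> eul (dd ks l) (dd ks j) = 0"
proof -
  obtain Ms Z red pos where I: "seed Ms Z red pos (dd ks)" using hist_exists[OF assms(1)] by blast
  have g: "\<not> red j" "\<not> red l" using seed_not_red[OF I] assms by auto
  have d: "dd ks j = dv (Z j)" "dd ks l = dv (Z l)" using seedD(7)[OF I] g assms by auto
  have r: "is_rep (Z j)" "is_rep (Z l)" using excD(3) seedD(2)[OF I] assms by auto
  show "eul (dd ks j) (dd ks l) \<le> 0"
    unfolding d using seedD(6)[OF I assms(2,3,4)] g by (intro eul_Hom0 r) simp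
  show "eul (dd ks j) (dd ks l) = 0 \<or> eul (dd ks l) (dd ks j) = 0"
    unfolding d using seedD(3,4)[OF I] assms eul_perp r by metis
qed

lemma om_antisym: "om x y = - om y x" by (simp add: om_def)

lemma om_add_left: "om (\<lambda>i. x i + m * y i) z = om x z + m * om y z"
  by (simp add: om_def eul_add_left eul_add_right algebra_simps)

lemma om_add_right: "om z (\<lambda>i. x i + m * y i) = om z x + m * om z y"
  by (simp add: om_def eul_add_left eul_add_right algebra_simps)

lemma om_unit:
  assumes "x < n" "y < n" shows "om (unitv x) (unitv y) = int (Q x y) - int (Q y x)"
proof -
  have "eul (unitv x) (unitv y) = (if x = y then 1 else 0) - int (Q x y)" if "x < n" "y < n" for x y
    using eul_sum[OF that(2), of "unitv x"] that(1) by (simp add: unitv_def if_distrib[of "(*) _"] cong: if_cong)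
  then show ?thesis using assms by (simp add: om_def)
qed

lemma dstep_same: "dstep k d k = (\<lambda>i. - d k i)"
  by (simp add: dstep_def fun_eq_iff)

lemma dstep_other: "j \<noteq> k \<Longrightarrow> dstep k d j = (\<lambda>i. d j i + max 0 (om (d j) (d k)) * d k i)"
  by (simp add: dstep_def fun_eq_iff)

text \<open>The invariant behind the recursion: the exchange matrix is the matrix of the fixed form
  \<open>om\<close> in the moving family \<open>d\<close>, and the arrows to frozen vertices record
  \<open>d\<close> itself. Absence of 2-cycles recovers arrow counts from their differences.\<close>

definition linked :: "quiver \<Rightarrow> (nat \<Rightarrow> nat \<Rightarrow> int) \<Rightarrow> bool" where
  "linked R d \<longleftrightarrow> (\<forall>x y. R x y = 0 \<or> R y x = 0) \<and>
    (\<forall>x<n. \<forall>y<n. int (R x y) - int (R y x) = om (d x) (d y)) \<and>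
    (\<forall>j<n. \<forall>i<n. int (R j (n + i)) - int (R (n + i) j) = d j i)"

lemma linked_init: "linked (framed n Q) unitv"
  using cq om_unit by (auto simp: linked_def framed_def cluster_quiver_def unitv_def)

lemma linkedD:
  assumes "linked R d"
  shows "\<And>x y. R x y = 0 \<or> R y x = 0" "\<And>x. R x x = 0"
    "\<And>x y. x < n \<Longrightarrow> y < n \<Longrightarrow> int (R x y) = max 0 (om (d x) (d y))"
    "\<And>j i. j < n \<Longrightarrow> i < n \<Longrightarrow> int (R j (n + i)) = max 0 (d j i)"
    "\<And>j i. j < n \<Longrightarrow> i < n \<Longrightarrow> int (R (n + i) j) = max 0 (- d j i)"
proof -
  show a: "\<And>x y. R x y = 0 \<or> R y x = 0" using assms by (simp add: linked_def)
  show "R x x = 0" for x using a[of x x] by simp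
  show "int (R x y) = max 0 (om (d x) (d y))" if "x < n" "y < n" for x y
  proof -
    have "int (R x y) - int (R y x) = om (d x) (d y)" using assms that by (simp add: linked_def)
    then show ?thesis using a[of x y] by auto
  qed
  fix j i assume "j < n" "i < n"
  then have "int (R j (n + i)) - int (R (n + i) j) = d j i" using assms by (simp add: linked_def)
  then show "int (R j (n + i)) = max 0 (d j i)" "int (R (n + i) j) = max 0 (- d j i)"
    using a[of j "n + i"] by auto
qed

text \<open>Deleting 2-cycles does not change signed arrow counts, so in these terms only the first
  two mutation steps are visible.\<close>

lemma mutate_diff:
  assumes "R k k = 0"
  shows "int (mutate k R x y) - int (mutate k R y x) = (if x = k \<or> y = k then int (R y x) - int (R x y)
    else int (R x y) - int (R y x) + (int (R x k) * int (R k y) - int (R y k) * int (R k x)))"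
proof -
  have "int (a - min a b) - int (b - min b a) = int a - int b" for a b :: nat
    by (cases "a \<le> b") auto
  then have "int (mutate k R x y) - int (mutate k R y x) =
      int (mut_step2 k (mut_step1 k R) x y) - int (mut_step2 k (mut_step1 k R) y x)"
    unfolding mutate_def mut_step3_def .
  also have "\<dots> = (if x = k \<or> y = k then int (R y x) - int (R x y)
    else int (R x y) - int (R y x) + (int (R x k) * int (R k y) - int (R y k) * int (R k x)))"
    using assms by (auto simp: mut_step2_def mut_step1_def)
  finally show ?thesis .
qed

text \<open>At a green vertex matrix mutation is the base change \<open>dstep\<close> for the form
  \<open>om\<close>: expanding bilinearly, the product of the two positive parts cancels and leaves
  the count of paths through \<open>k\<close>.\<close>

lemma linked_step:
  assumes L: "linked R d" and k: "k < n" and g: "\<forall>i<n. 0 \<le> d k i"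
  shows "linked (mutate k R) (dstep k d)"
  unfolding linked_def
proof (intro conjI allI impI)
  note L = linkedD[OF L]
  show "mutate k R x y = 0 \<or> mutate k R y x = 0" for x y
    by (auto simp: mutate_def mut_step3_def min_def)
  { fix x y assume xy: "x < n" "y < n"
    have b: "int (R u v) - int (R v u) = om (d u) (d v)" if "u < n" "v < n" for u v
      using assms(1) that by (simp add: linked_def)
    have neg: "om (\<lambda>i. - u i) v = - om u v" "om v (\<lambda>i. - u i) = - om v u" for u v
      by (simp_all add: om_def eul_neg_left eul_neg_right)
    have kk: "om u u = 0" for u by (simp add: om_def)
    show "int (mutate k R x y) - int (mutate k R y x) = om (dstep k d x) (dstep k d y)"
    proof (cases "x = k \<or> y = k")
      case True
      then show ?thesis
        unfolding mutate_diff[of R k, OF L(2)]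
        using b[OF xy] by (cases "x = k"; cases "y = k")
          (auto simp: dstep_same dstep_other neg kk om_add_left om_add_right)
    next
      case False
      have R: "int (R x k) = max 0 (om (d x) (d k))" "int (R k y) = max 0 (om (d k) (d y))"
        "int (R y k) = max 0 (om (d y) (d k))" "int (R k x) = max 0 (om (d k) (d x))"
        using L(3) xy k by auto
      have m: "om (d x) (d k) = max 0 (om (d x) (d k)) - max 0 (om (d k) (d x))"
        "om (d k) (d y) = max 0 (om (d k) (d y)) - max 0 (om (d y) (d k))"
        using om_antisym[of "d k" "d x"] om_antisym[of "d k" "d y"] by auto
      have aux: "w + D * p + A * q = w + (A * C - D * B)" if "p = A - B" "q = C - D" for w p q A B C D :: int
        by (simp add: that algebra_simps)
      have "om (dstep k d x) (dstep k d y) = om (d x) (d y) + max 0 (om (d y) (d k)) * om (d x) (d k)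
          + max 0 (om (d x) (d k)) * om (d k) (d y)"
      proof -
        have dx: "dstep k d x = (\<lambda>i. d x i + max 0 (om (d x) (d k)) * d k i)"
          "dstep k d y = (\<lambda>i. d y i + max 0 (om (d y) (d k)) * d k i)"
          using False by (simp_all add: dstep_other)
        show ?thesis unfolding dx om_add_left om_add_right kk by (simp add: algebra_simps)
      qed
      also have "\<dots> = om (d x) (d y) + (max 0 (om (d x) (d k)) * max 0 (om (d k) (d y))
          - max 0 (om (d y) (d k)) * max 0 (om (d k) (d x)))"
        by (rule aux[OF m])
      finally show ?thesis
        unfolding mutate_diff[of R k, OF L(2)] using False b[OF xy] R by simp
    qed }
  fix j i assume ji: "j < n" "i < n"
  have b: "int (R j (n + i)) - int (R (n + i) j) = d j i" using assms(1) ji by (simp add: linked_def)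
  have "n + i \<noteq> k" using k by simp
  then show "int (mutate k R j (n + i)) - int (mutate k R (n + i) j) = dstep k d j i"
    unfolding mutate_diff[of R k, OF L(2)]
    using b L(3)[OF ji(1) k] L(4,5)[OF k ji(2)] g ji by (auto simp: dstep_def)
qed

lemma mut_trace_nth: "t \<le> length ks \<Longrightarrow> mut_trace R ks ! t = fold mutate (take t ks) R"
  by (induction ks arbitrary: R t) (auto simp: nth_Cons' take_Cons')

lemma length_mut_trace: "length (mut_trace R ks) = Suc (length ks)"
  by (induction ks arbitrary: R) auto

lemma linked_fold: "greenseq ks \<Longrightarrow> linked (fold mutate ks (framed n Q)) (dd ks)"
proof (induction ks rule: rev_induct)
  case Nil then show ?case using linked_init by (simp add: dd_Nil)
next
  case (snoc k ks)
  then show ?case using linked_step[of _ "dd ks" k] by (simp add: greenseq_snoc dd_snoc)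
qed

lemma green_linked: "linked R d \<Longrightarrow> j < n \<Longrightarrow> green n R j \<longleftrightarrow> (\<forall>i<n. 0 \<le> d j i)"
proof -
  assume *: "linked R d" "j < n"
  have "R (n + i) j = 0 \<longleftrightarrow> 0 \<le> d j i" if "i < n" for i
    using linkedD(5)[OF * that] by linarith
  then show ?thesis by (auto simp: green_def)
qed

lemma cvec_linked: "linked R d \<Longrightarrow> j < n \<Longrightarrow> cvec n R j = map (\<lambda>i. - d j i) [0..<n]"
  unfolding cvec_def cmat_def linked_def by (intro map_cong) force+

lemma greenseq_take: "greenseq ks \<Longrightarrow> greenseq (take t ks)"
  by (auto simp: greenseq_def min_def)

lemma take_Suc_snoc: "t < length ks \<Longrightarrow> take (Suc t) ks = take t ks @ [ks ! t]"
  by (rule take_Suc_conv_app_nth)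

lemma linked_take:
  "greenseq ks \<Longrightarrow> t \<le> length ks \<Longrightarrow> linked (quiver_seq n Q ks ! t) (dd (take t ks))"
  unfolding quiver_seq_def using linked_fold[OF greenseq_take] by (simp add: mut_trace_nth)

lemma is_MGS_iff: "is_MGS n Q ks \<longleftrightarrow> greenseq ks \<and> (\<forall>j<n. \<exists>i<n. dd ks j i < 0)"
proof -
  let ?Rs = "quiver_seq n Q ks"
  have last: "last ?Rs = ?Rs ! length ks"
    using length_mut_trace[of "framed n Q" ks] by (simp add: quiver_seq_def last_conv_nth flip: length_0_conv)
  have g: "greenseq ks" if M: "\<forall>t<length ks. ks ! t < n \<and> green n (?Rs ! t) (ks ! t)"
  proof -
    \<comment> \<open>Greenness in the quiver matches positivity of \<open>dd\<close> only after the
      preceding prefix is known to be green, hence the induction over prefixes.\<close>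
    have "greenseq (take t ks)" if "t \<le> length ks" for t
      using that
    proof (induction t)
      case 0 then show ?case by (simp add: greenseq_def)
    next
      case (Suc t)
      then have t: "t < length ks" and gt: "greenseq (take t ks)" by auto
      have "linked (?Rs ! t) (dd (take t ks))"
        unfolding quiver_seq_def using linked_fold[OF gt] t by (simp add: mut_trace_nth)
      then show ?case unfolding take_Suc_snoc[OF t] greenseq_snoc
        using gt M t green_linked by blast
    qed
    from this[of "length ks"] show ?thesis by simp
  qed
  have "(\<forall>t<length ks. ks ! t < n \<and> green n (?Rs ! t) (ks ! t)) \<longleftrightarrow> greenseq ks"
    using g green_linked[OF linked_take] unfolding greenseq_def[of ks] by (auto simp: greenseq_def)
  moreover have "(\<forall>j<n. \<not> green n (last ?Rs) j) \<longleftrightarrow> (\<forall>j<n. \<exists>i<n. dd ks j i < 0)" if "greenseq ks"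
    using green_linked[OF linked_take[OF that order_refl]] unfolding last by (auto simp: not_le)
  ultimately show ?thesis unfolding is_MGS_def Let_def by blast
qed

lemma cvec_seq_dd:
  assumes "greenseq ks"
  shows "cvec_seq n Q ks = map (\<lambda>t. map (\<lambda>i. - dd (take t ks) (ks ! t) i) [0..<n]) [0..<length ks]"
proof -
  have "cvec n (quiver_seq n Q ks ! t) (ks ! t) = map (\<lambda>i. - dd (take t ks) (ks ! t) i) [0..<n]"
    if "t < length ks" for t
    using cvec_linked[OF linked_take[OF assms]] assms that by (simp add: greenseq_def)
  then show ?thesis unfolding cvec_seq_def Let_def by simp
qed

section \<open>Supports of green and red vectors along a green sequence\<close>

lemma supp_cvec:
  "linked R d \<Longrightarrow> j < n \<Longrightarrow> i \<in> supp (cvec n R j) \<longleftrightarrow> i < n \<and> d j i \<noteq> 0"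
  by (auto simp: cvec_linked supp_def)

lemma neg_cvec: "linked R d \<Longrightarrow> j < n \<Longrightarrow> neg_vec (cvec n R j) \<longleftrightarrow> (\<forall>i<n. 0 \<le> d j i)"
  by (auto simp: cvec_linked neg_vec_def)

text \<open>A mutation adds only multiples of the mutated vector, which is itself green, so no
  vertex newly enters the supports of the green vectors.\<close>

lemma support_shrinks:
  assumes g: "greenseq (ks @ [k])" and j: "j < n" "\<forall>i<n. 0 \<le> dd (ks @ [k]) j i" and a: "dd (ks @ [k]) j a \<noteq> 0"
  shows "\<exists>l<n. (\<forall>i<n. 0 \<le> dd ks l i) \<and> dd ks l a \<noteq> 0"
proof -
  have gk: "greenseq ks" "k < n" "\<forall>i<n. 0 \<le> dd ks k i" using g by (auto simp: greenseq_snoc)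
  have an: "a < n" using dd_outside[OF g j(1), of a] a by (cases "a < n") auto
  show ?thesis
  proof (cases "dd ks k a = 0")
    case False then show ?thesis using gk by blast
  next
    case True
    then have "j \<noteq> k" using a by (auto simp: dd_snoc dstep_same)
    then have e: "dd (ks @ [k]) j a = dd ks j a" using True by (simp add: dd_snoc dstep_other)
    then have "0 < dd ks j a" using a j(2) an by (metis order_le_less)
    then have "\<forall>i. 0 \<le> dd ks j i" using sign_coherent[OF gk(1) j(1)] by (metis leD)
    then show ?thesis using j(1) a e by auto
  qed
qed

lemma support_earlier:
  assumes g: "greenseq ks" and st: "s \<le> t" "t \<le> length ks"
    and j: "j < n" "\<forall>i<n. 0 \<le> dd (take t ks) j i" "dd (take t ks) j a \<noteq> 0"
  shows "\<exists>l<n. (\<forall>i<n. 0 \<le> dd (take s ks) l i) \<and> dd (take s ks) l a \<noteq> 0"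
  using st j
proof (induction t arbitrary: j)
  case 0 then show ?case by auto
next
  case (Suc t)
  show ?case
  proof (cases "s = Suc t")
    case True then show ?thesis using Suc(4-6) by blast
  next
    case False
    have t: "t < length ks" using Suc(3) by simp
    note e = take_Suc_snoc[OF t]
    obtain l where "l < n" "\<forall>i<n. 0 \<le> dd (take t ks) l i" "dd (take t ks) l a \<noteq> 0"
      using support_shrinks[OF greenseq_take[OF g, of "Suc t", unfolded e] Suc(4)] Suc(5,6) unfolding e by blast
    then show ?thesis using Suc.IH[of l] False Suc(2,3) by simp
  qed
qed

text \<open>A mutation elsewhere can only raise the entries of a vector, so its negative entries go
  back to the moment when it was itself mutated and changed sign; both entries were present
  then.\<close>

lemma negative_origin:
  assumes g: "greenseq ks" and "t \<le> length ks" "j < n" "dd (take t ks) j a < 0" "dd (take t ks) j b < 0"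
  shows "\<exists>s<t. dd (take s ks) (ks ! s) a \<noteq> 0 \<and> dd (take s ks) (ks ! s) b \<noteq> 0"
  using assms(2-5)
proof (induction t arbitrary: j)
  case 0 then show ?case by (auto simp: dd_Nil unitv_def split: if_splits)
next
  case (Suc t)
  have t: "t < length ks" using Suc(2) by simp
  note e = take_Suc_snoc[OF t]
  let ?k = "ks ! t"
  have gt: "greenseq (take t ks @ [?k])" using greenseq_take[OF g, of "Suc t"] unfolding e .
  then have k: "?k < n" and kg: "\<forall>i<n. 0 \<le> dd (take t ks) ?k i" by (auto simp: greenseq_snoc)
  have kp: "0 \<le> dd (take t ks) ?k i" for i
    using kg dd_outside[OF greenseq_take[OF g] k, of i] by (cases "i < n") auto
  show ?case
  proof (cases "j = ?k")
    case True
    then show ?thesis using Suc(4,5) unfolding e dd_snoc by (intro exI[of _ t]) (simp add: dstep_same)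
  next
    case False
    have "dd (take t ks) j i \<le> dd (take (Suc t) ks) j i" for i
      unfolding e dd_snoc using False kp[of i] by (simp add: dstep_other)
    then have "dd (take t ks) j a < 0" "dd (take t ks) j b < 0" using Suc(4,5) by (meson le_less_trans)+
    then show ?thesis using Suc.IH[OF _ Suc(3)] t by (meson less_SucI less_imp_le)
  qed
qed

text \<open>Until it is mutated, a green vector only grows and keeps its support; since nothing is
  green at the end, its mutation must come.\<close>

lemma positive_future:
  assumes g: "greenseq ks" and fin: "\<And>j. j < n \<Longrightarrow> \<exists>i<n. dd ks j i < 0"
    and t: "t \<le> length ks" and j: "j < n" "\<forall>i<n. 0 \<le> dd (take t ks) j i"
    and ab: "dd (take t ks) j a \<noteq> 0" "dd (take t ks) j b \<noteq> 0"
  shows "\<exists>s<length ks. dd (take s ks) (ks ! s) a \<noteq> 0 \<and> dd (take s ks) (ks ! s) b \<noteq> 0"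
  using t j ab
proof (induction "length ks - t" arbitrary: t)
  case 0
  then have "take t ks = ks" by simp
  then show ?case using fin[OF j(1)] 0 by (auto simp: not_less[symmetric])
next
  case (Suc m)
  have t: "t < length ks" using Suc(2) by simp
  note e = take_Suc_snoc[OF t]
  let ?k = "ks ! t"
  have gt: "greenseq (take t ks @ [?k])" using greenseq_take[OF g, of "Suc t"] unfolding e .
  then have k: "?k < n" and kg: "\<forall>i<n. 0 \<le> dd (take t ks) ?k i" by (auto simp: greenseq_snoc)
  have kp: "0 \<le> dd (take t ks) ?k i" for i
    using kg dd_outside[OF greenseq_take[OF g] k, of i] by (cases "i < n") auto
  have jp: "0 \<le> dd (take t ks) j i" for i
    using Suc(5) dd_outside[OF greenseq_take[OF g] j(1), of i] by (cases "i < n") auto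
  show ?case
  proof (cases "j = ?k")
    case True
    then show ?thesis using Suc(6,7) t by blast
  next
    case False
    have ge: "dd (take t ks) j i \<le> dd (take (Suc t) ks) j i" for i
      unfolding e dd_snoc using False kp[of i] by (simp add: dstep_other)
    have "0 \<le> dd (take (Suc t) ks) j i" for i using ge[of i] jp[of i] by simp
    moreover have "dd (take (Suc t) ks) j a \<noteq> 0" "dd (take (Suc t) ks) j b \<noteq> 0"
      using ge[of a] ge[of b] jp[of a] jp[of b] Suc(6,7) by auto
    ultimately show ?thesis using Suc(1)[of "Suc t"] Suc(2) t j(1) by simp
  qed
qed

end

section \<open>Comparison with the ME-free version\<close>

lemma ME_free_cluster: "cluster_quiver n Q \<Longrightarrow> cluster_quiver n (ME_free_version Q)"
  unfolding cluster_quiver_def ME_free_version_def by (auto split: if_splits)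

lemma ME_free_acyclic: "acyclic_quiver Q \<Longrightarrow> acyclic_quiver (ME_free_version Q)"
  unfolding acyclic_quiver_def ME_free_version_def by (rule acyclic_subset) (auto split: if_splits)

locale ME_pair =
  fixes n :: nat and Q :: quiver
  assumes cq: "cluster_quiver n Q" and acy: "acyclic_quiver Q"
begin

abbreviation Q' :: quiver where "Q' \<equiv> ME_free_version Q"

sublocale A: acyclic_reps n Q by unfold_locales (rule cq, rule acy)
sublocale B: acyclic_reps n Q' by unfold_locales (rule ME_free_cluster[OF cq], rule ME_free_acyclic[OF acy])

definition mult :: "nat \<Rightarrow> nat \<Rightarrow> int" where
  "mult a b = (if multiple_edge Q a b then int (Q a b) else 0)"

definition emu :: "(nat \<Rightarrow> int) \<Rightarrow> (nat \<Rightarrow> int) \<Rightarrow> int" where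
  "emu x y = (\<Sum>a<n. \<Sum>b<n. mult a b * x a * y b)"

lemma Q_split: "int (Q a b) = int (Q' a b) + mult a b"
proof -
  have "Q a b = 0 \<or> Q b a = 0" using cq by (simp add: cluster_quiver_def)
  then show ?thesis by (auto simp: ME_free_version_def mult_def multiple_edge_def)
qed

lemma eul_split: "A.eul x y = B.eul x y - emu x y"
  by (simp add: A.eul_def B.eul_def emu_def Q_split algebra_simps sum.distrib)

lemma om_split: "A.om x y = B.om x y + emu x y - emu y x"
  by (simp add: A.om_def B.om_def eul_split)

lemma emu_neg: "emu (\<lambda>i. - x i) y = - emu x y" "emu x (\<lambda>i. - y i) = - emu x y"
  by (simp_all add: emu_def sum_negf)

lemma emu_nonneg: "\<forall>i<n. 0 \<le> x i \<Longrightarrow> \<forall>i<n. 0 \<le> y i \<Longrightarrow> 0 \<le> emu x y"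
  unfolding emu_def by (intro sum_nonneg mult_nonneg_nonneg) (auto simp: mult_def)

lemma emu_witness:
  assumes "emu x y \<noteq> 0"
  shows "\<exists>a<n. \<exists>b<n. multiple_edge Q a b \<and> x a \<noteq> 0 \<and> y b \<noteq> 0"
proof (rule ccontr)
  assume c: "\<not> ?thesis"
  have "mult a b * x a * y b = 0" if "a < n" "b < n" for a b
    using c that by (auto simp: mult_def)
  then have "emu x y = 0" unfolding emu_def by (intro sum.neutral ballI) simp
  then show False using assms by simp
qed

text \<open>The two forms differ by terms \<open>emu\<close>. The hypotheses \<open>green\<close>
  and \<open>red\<close> remove one of them, and the other makes \<open>A.om\<close> the smaller
  value; so a disagreement needs \<open>B.om\<close> positive. For a red vector this would give
  mixed signs, for a green one \<open>alt\<close> excludes it. \<open>alt\<close> is a disjunction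
  because its users know that the next vectors are ME-free for different quivers.\<close>

lemma step_agree:
  assumes gA: "A.greenseq (ks @ [k])" and gB: "B.greenseq (ks @ [k])"
    and eq: "\<And>j. j < n \<Longrightarrow> A.dd ks j = B.dd ks j"
    and green: "\<And>j a b. j < n \<Longrightarrow> multiple_edge Q a b \<Longrightarrow> \<forall>i<n. 0 \<le> A.dd ks j i \<Longrightarrow> A.dd ks j a \<noteq> 0 \<Longrightarrow> A.dd ks k b = 0"
    and red: "\<And>j a b. j < n \<Longrightarrow> multiple_edge Q a b \<Longrightarrow> A.dd ks j b < 0 \<Longrightarrow> A.dd ks k a = 0"
    and free: "\<And>j a b. j < n \<Longrightarrow> multiple_edge Q a b \<Longrightarrow> A.dd ks j a = 0 \<or> A.dd ks j b = 0"
    and alt: "(\<forall>j<n. \<forall>a b. multiple_edge Q a b \<longrightarrow> A.dd (ks @ [k]) j a = 0 \<or> A.dd (ks @ [k]) j b = 0) \<or>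
      (\<forall>j<n. \<forall>a b. multiple_edge Q a b \<longrightarrow> B.dd (ks @ [k]) j a = 0 \<or> B.dd (ks @ [k]) j b = 0)"
    and j: "j < n"
  shows "A.dd (ks @ [k]) j = B.dd (ks @ [k]) j"
proof -
  have k: "k < n" and kg: "\<forall>i<n. 0 \<le> A.dd ks k i" and gA': "A.greenseq ks" and gB': "B.greenseq ks"
    using gA gB by (auto simp: A.greenseq_snoc B.greenseq_snoc)
  define x y where "x = A.dd ks j" and "y = A.dd ks k"
  have xB: "B.dd ks j = x" "B.dd ks k = y" using eq[OF j] eq[OF k] by (simp_all add: x_def y_def)
  have yp: "\<forall>i<n. 0 \<le> y i" using kg by (simp add: y_def)
  show ?thesis
  proof (cases "j = k")
    case True
    then show ?thesis using eq[OF k] by (simp add: A.dd_snoc B.dd_snoc A.dstep_same B.dstep_same)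
  next
    case jk: False
    have dA: "A.dd (ks @ [k]) j = (\<lambda>i. x i + max 0 (A.om x y) * y i)"
      using jk by (simp add: A.dd_snoc A.dstep_other x_def y_def)
    have dB: "B.dd (ks @ [k]) j = (\<lambda>i. x i + max 0 (B.om x y) * y i)"
      using jk xB by (simp add: B.dd_snoc B.dstep_other)
    have free_y: "y a = 0 \<or> y b = 0" if "multiple_edge Q a b" for a b using free[OF k that] by (simp add: y_def)
    have free_x: "x a = 0 \<or> x b = 0" if "multiple_edge Q a b" for a b using free[OF j that] by (simp add: x_def)
    have "max 0 (A.om x y) = max 0 (B.om x y)"
    proof (cases "\<forall>i. 0 \<le> x i")
      case xp: True
      have e0: "emu x y = 0"
        using emu_witness[of x y] green[OF j] xp by (auto simp: x_def y_def)
      have om: "A.om x y = B.om x y - emu y x" using e0 om_split[of x y] by simp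
      show ?thesis
      proof (cases "emu y x = 0")
        case False
        then have ep: "emu y x > 0" using emu_nonneg[OF yp, of x] xp by simp
        obtain a b where ab: "a < n" "b < n" "multiple_edge Q a b" "y a \<noteq> 0" "x b \<noteq> 0"
          using emu_witness[OF False] by blast
        have both: "x i + m * y i \<noteq> 0" if "0 < m" "i < n" "x i \<noteq> 0 \<or> y i \<noteq> 0" for m i
        proof -
          have "0 \<le> x i" "0 \<le> m * y i" using xp yp that by auto
          moreover have "0 < x i \<or> 0 < m * y i"
            using that xp yp by (auto simp: less_le)
          ultimately show ?thesis by linarith
        qed
        from alt show ?thesis
        proof
          assume *: "\<forall>j<n. \<forall>a b. multiple_edge Q a b \<longrightarrow> A.dd (ks @ [k]) j a = 0 \<or> A.dd (ks @ [k]) j b = 0"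
          have le: "A.om x y \<le> 0"
          proof (rule ccontr)
            assume "\<not> A.om x y \<le> 0"
            then have m: "0 < max 0 (A.om x y)" by simp
            show False using *[rule_format, OF j ab(3)] both[OF m ab(1)] both[OF m ab(2)] ab(4,5) unfolding dA by blast
          qed
          \<comment> \<open>Knowing only that \<open>A.om\<close> is nonpositive is not enough.
            Since one of the two Euler pairings is zero and both are nonpositive, it forces
            \<open>A.eul x y = 0\<close>; this value is shared by \<open>B\<close>, which bounds
            \<open>B.om\<close>.\<close>
          have gp: "A.eul x y \<le> 0" "A.eul x y = 0 \<or> A.eul y x = 0"
            using A.green_pair[OF gA' j k jk] xp yp by (simp_all add: x_def y_def)
          have "A.eul x y = 0" using gp le by (auto simp: A.om_def)
          then have "B.eul x y = 0" using eul_split[of x y] e0 by simp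
          moreover have "B.eul y x \<le> 0"
            using B.green_pair(1)[OF gB' k j] jk xp yp xB by auto
          ultimately have "B.om x y \<le> 0" by (simp add: B.om_def)
          then show ?thesis using le by simp
        next
          assume *: "\<forall>j<n. \<forall>a b. multiple_edge Q a b \<longrightarrow> B.dd (ks @ [k]) j a = 0 \<or> B.dd (ks @ [k]) j b = 0"
          have "B.om x y \<le> 0"
          proof (rule ccontr)
            assume "\<not> B.om x y \<le> 0"
            then have m: "0 < max 0 (B.om x y)" by simp
            show False using *[rule_format, OF j ab(3)] both[OF m ab(1)] both[OF m ab(2)] ab(4,5) unfolding dB by blast
          qed
          then show ?thesis using om ep by simp
        qed
      qed (simp add: om)
    next
      case False
      then have xn: "\<forall>i. x i \<le> 0" using A.sign_coherent[OF gA' j] by (auto simp: x_def)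
      define f where "f = (\<lambda>i. - x i)"
      have xf: "x = (\<lambda>i. - f i)" by (simp add: f_def)
      have fp: "\<forall>i<n. 0 \<le> f i" using xn by (simp add: f_def)
      have "emu y f = 0"
      proof (rule ccontr)
        assume "emu y f \<noteq> 0"
        then obtain a b where ab: "multiple_edge Q a b" "y a \<noteq> 0" "f b \<noteq> 0" using emu_witness by blast
        then have "x b < 0" using xn[rule_format, of b] by (simp add: f_def)
        then show False using red[OF j ab(1)] ab(2) by (simp add: x_def y_def)
      qed
      then have om: "A.om x y = B.om x y - emu f y"
        using om_split[of x y] unfolding xf by (simp add: emu_neg)
      show ?thesis
      proof (cases "emu f y = 0")
        case False
        then have ep: "emu f y > 0" using emu_nonneg[OF fp yp] by simp
        obtain a b where ab: "a < n" "b < n" "multiple_edge Q a b" "f a \<noteq> 0" "y b \<noteq> 0"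
          using emu_witness[OF False] by blast
        have ya: "y a = 0" using free_y[OF ab(3)] ab(5) by blast
        have xb: "x b = 0" using free_x[OF ab(3)] ab(4) by (simp add: f_def)
        \<comment> \<open>Otherwise the next vector for the ME-free quiver would be negative at
          \<open>a\<close>, where \<open>y\<close> vanishes, and positive at \<open>b\<close>, where
          \<open>x\<close> vanishes, against sign-coherence.\<close>
        have "B.om x y \<le> 0"
        proof (rule ccontr)
          assume m: "\<not> B.om x y \<le> 0"
          have "B.dd (ks @ [k]) j a < 0" unfolding dB using ya ab(4) xn[rule_format, of a] by (simp add: f_def)
          moreover have "B.dd (ks @ [k]) j b > 0"
            unfolding dB using xb ab(5) yp[rule_format, OF ab(2)] m by (simp add: mult_pos_pos)
          ultimately show False using B.sign_coherent[OF gB j] by (metis leD)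
        qed
        then show ?thesis using om ep by simp
      qed (simp add: om)
    qed
    then show ?thesis unfolding dA dB by simp
  qed
qed

section \<open>The two conditions, and agreement of the recursions for both quivers\<close>

definition avoids :: "(nat list \<Rightarrow> nat \<Rightarrow> nat \<Rightarrow> int) \<Rightarrow> nat list \<Rightarrow> bool" where
  "avoids D ks \<longleftrightarrow> (\<forall>a b. multiple_edge Q a b \<longrightarrow> (\<forall>t<length ks. \<forall>j<n.
    (\<forall>i<n. 0 \<le> D (take t ks) j i) \<and> D (take t ks) j a \<noteq> 0 \<longrightarrow> D (take t ks) (ks ! t) b = 0))"

definition ME_free :: "(nat list \<Rightarrow> nat \<Rightarrow> nat \<Rightarrow> int) \<Rightarrow> nat list \<Rightarrow> bool" where
  "ME_free D ks \<longleftrightarrow> (\<forall>a b. multiple_edge Q a b \<longrightarrow> (\<forall>t\<le>length ks. \<forall>j<n. D (take t ks) j a = 0 \<or> D (take t ks) j b = 0))"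

lemma ME_free_MGS_iff:
  assumes "B.greenseq ks" shows "ME_free_MGS n Q Q' ks \<longleftrightarrow> ME_free B.dd ks"
proof -
  let ?Rs = "quiver_seq n Q' ks"
  have len: "length ?Rs = Suc (length ks)" by (simp add: quiver_seq_def B.length_mut_trace)
  have "ME_free_cvec Q (cvec n (?Rs ! t) j) \<longleftrightarrow>
      (\<forall>a b. multiple_edge Q a b \<longrightarrow> B.dd (take t ks) j a = 0 \<or> B.dd (take t ks) j b = 0)"
    if t: "t \<le> length ks" and j: "j < n" for t j
  proof -
    have "multiple_edge Q a b \<Longrightarrow> a < n \<and> b < n" for a b
      using A.arrow_less[of 0 a b] by (auto simp: multiple_edge_def)
    then show ?thesis
      unfolding ME_free_cvec_def using B.supp_cvec[OF B.linked_take[OF assms t] j] by blast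
  qed
  then show ?thesis
    unfolding ME_free_MGS_def ME_free_def set_conv_nth len by (auto simp: less_Suc_eq_le)
qed

lemma ME_condition_iff:
  assumes "B.greenseq ks" shows "ME_condition n Q Q' ks \<longleftrightarrow> avoids B.dd ks"
proof -
  let ?Rs = "quiver_seq n Q' ks"
  have sup: "a \<in> supp (cvec n (?Rs ! t) j) \<longleftrightarrow> B.dd (take t ks) j a \<noteq> 0"
    if "t < length ks" "j < n" "a < n" for t j a
    using B.supp_cvec[OF B.linked_take[OF assms, of t] that(2)] that by auto
  have neg: "neg_vec (cvec n (?Rs ! t) j) \<longleftrightarrow> (\<forall>i<n. 0 \<le> B.dd (take t ks) j i)"
    if "t < length ks" "j < n" for t j
    using B.neg_cvec[OF B.linked_take[OF assms, of t] that(2)] that by auto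
  have k: "ks ! t < n \<and> (\<forall>i<n. 0 \<le> B.dd (take t ks) (ks ! t) i)" if "t < length ks" for t
    using assms that by (simp add: B.greenseq_def)
  have n: "a < n" "b < n" if "multiple_edge Q a b" for a b
    using A.arrow_less[of 0 a b] that by (auto simp: multiple_edge_def)
  have "(\<exists>l<n. neg_vec (cvec n (?Rs ! t) l) \<and> a \<in> supp (cvec n (?Rs ! t) l)) \<longleftrightarrow>
      (\<exists>l<n. (\<forall>i<n. 0 \<le> B.dd (take t ks) l i) \<and> B.dd (take t ks) l a \<noteq> 0)"
    "neg_vec (cvec n (?Rs ! t) (ks ! t)) \<and> b \<in> supp (cvec n (?Rs ! t) (ks ! t)) \<longleftrightarrow>
      B.dd (take t ks) (ks ! t) b \<noteq> 0"
    if ab: "multiple_edge Q a b" and t: "t < length ks" for a b t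
    using sup[OF t _ n(1)[OF ab]] sup[OF t _ n(2)[OF ab]] neg[OF t] k[OF t] by auto
  then show ?thesis
    unfolding ME_condition_def avoids_def Let_def by (simp, blast)
qed

text \<open>The hypothesis \<open>red\<close> of \<open>step_agree\<close> has to be derived. A
  negative entry at \<open>b\<close> stems from an earlier mutation at a vector containing
  \<open>b\<close>, and \<open>a\<close> in the current mutated vector already occurred in a green
  vector at that time; so that mutation would have violated \<open>avoids\<close>.\<close>

lemma agree_from_B:
  assumes g: "B.greenseq ks" and nb: "avoids B.dd ks" and mf: "ME_free B.dd ks" and t: "t \<le> length ks"
  shows "A.greenseq (take t ks) \<and> (\<forall>j<n. A.dd (take t ks) j = B.dd (take t ks) j)"
  using t
proof (induction t)
  case 0 then show ?case by (simp add: A.greenseq_def A.dd_Nil B.dd_Nil A.unitv_def B.unitv_def fun_eq_iff)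
next
  case (Suc t)
  then have t: "t < length ks" and IH: "A.greenseq (take t ks)" "\<And>j. j < n \<Longrightarrow> A.dd (take t ks) j = B.dd (take t ks) j"
    by auto
  note e = A.take_Suc_snoc[OF t]
  let ?k = "ks ! t"
  have gB: "B.greenseq (take t ks @ [?k])" using B.greenseq_take[OF g, of "Suc t"] unfolding e .
  then have k: "?k < n" by (simp add: B.greenseq_snoc)
  have gA: "A.greenseq (take t ks @ [?k])" using gB IH(1) IH(2)[OF k] by (simp add: A.greenseq_snoc B.greenseq_snoc)
  have "A.dd (take t ks @ [?k]) j = B.dd (take t ks @ [?k]) j" if "j < n" for j
  proof (rule step_agree[OF gA gB IH(2) _ _ _ _ that])
    fix j a b assume j: "j < n" and ab: "multiple_edge Q a b"
    show "A.dd (take t ks) ?k b = 0" if "\<forall>i<n. 0 \<le> A.dd (take t ks) j i" "A.dd (take t ks) j a \<noteq> 0"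
      using nb ab t j that IH(2)[OF j] IH(2)[OF k] unfolding avoids_def by auto
    show "A.dd (take t ks) ?k a = 0" if neg: "A.dd (take t ks) j b < 0"
    proof (rule ccontr)
      assume a: "A.dd (take t ks) ?k a \<noteq> 0"
      obtain s where s: "s < t" "B.dd (take s ks) (ks ! s) b \<noteq> 0"
        using B.negative_origin[OF g less_imp_le[OF t] j, of b b] neg IH(2)[OF j] by auto
      have "\<forall>i<n. 0 \<le> B.dd (take t ks) ?k i" using gB by (simp add: B.greenseq_snoc)
      then obtain l where "l < n" "\<forall>i<n. 0 \<le> B.dd (take s ks) l i" "B.dd (take s ks) l a \<noteq> 0"
        using B.support_earlier[OF g _ _ k, of s t a] s(1) t a IH(2)[OF k] by auto
      then show False using nb ab s t unfolding avoids_def by (meson less_trans)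
    qed
    show "A.dd (take t ks) j a = 0 \<or> A.dd (take t ks) j b = 0"
      using mf ab t j IH(2)[OF j] unfolding ME_free_def by auto
  next
    show "(\<forall>j<n. \<forall>a b. multiple_edge Q a b \<longrightarrow> A.dd (take t ks @ [?k]) j a = 0 \<or> A.dd (take t ks @ [?k]) j b = 0) \<or>
      (\<forall>j<n. \<forall>a b. multiple_edge Q a b \<longrightarrow> B.dd (take t ks @ [?k]) j a = 0 \<or> B.dd (take t ks @ [?k]) j b = 0)"
      using mf Suc(2) unfolding ME_free_def e[symmetric] by blast
  qed
  then show ?case using gA unfolding e by blast
qed

text \<open>A vector containing both ends of a multiple edge is traced, backwards if red and
  forwards if green, to a mutation at a vector containing both ends. This mutation is bad by itself,
  since the mutated vector is one of the green ones.\<close>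

lemma MGS_avoids:
  assumes g: "A.greenseq ks" and fin: "\<And>j. j < n \<Longrightarrow> \<exists>i<n. A.dd ks j i < 0"
  shows "avoids A.dd ks" "ME_free A.dd ks"
proof -
  show nb: "avoids A.dd ks"
    unfolding avoids_def multiple_edge_def using A.no_bad[OF g fin] by blast
  have once: "A.dd (take s ks) (ks ! s) a = 0 \<or> A.dd (take s ks) (ks ! s) b = 0"
    if "multiple_edge Q a b" "s < length ks" for a b s
    using nb that g unfolding avoids_def A.greenseq_def by blast
  show "ME_free A.dd ks"
    unfolding ME_free_def
  proof (intro allI impI)
    fix a b t j assume ab: "multiple_edge Q a b" and t: "t \<le> length ks" and j: "j < n"
    show "A.dd (take t ks) j a = 0 \<or> A.dd (take t ks) j b = 0"
    proof (rule ccontr)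
      assume "\<not> ?thesis"
      then have nz: "A.dd (take t ks) j a \<noteq> 0" "A.dd (take t ks) j b \<noteq> 0" by auto
      have "\<exists>s<length ks. A.dd (take s ks) (ks ! s) a \<noteq> 0 \<and> A.dd (take s ks) (ks ! s) b \<noteq> 0"
        using A.sign_coherent[OF A.greenseq_take[OF g] j, of t]
      proof
        assume "\<forall>i. 0 \<le> A.dd (take t ks) j i"
        then show ?thesis using A.positive_future[OF g fin t j _ nz] by blast
      next
        assume "\<forall>i. A.dd (take t ks) j i \<le> 0"
        then have "A.dd (take t ks) j a < 0" "A.dd (take t ks) j b < 0" using nz by (auto simp: order_le_less)
        then show ?thesis using A.negative_origin[OF g t j] t by (meson less_le_trans)
      qed
      then show False using once[OF ab] by blast
    qed
  qed
qed

text \<open>The induction of \<open>agree_from_B\<close> with the roles of the quivers exchanged;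
  ME-freeness of the next vectors is now known for \<open>Q\<close>, the harder alternative in
  \<open>step_agree\<close>.\<close>

lemma agree_from_A:
  assumes g: "A.greenseq ks" and nb: "avoids A.dd ks" and mf: "ME_free A.dd ks" and t: "t \<le> length ks"
  shows "B.greenseq (take t ks) \<and> (\<forall>j<n. A.dd (take t ks) j = B.dd (take t ks) j)"
  using t
proof (induction t)
  case 0 then show ?case by (simp add: B.greenseq_def A.dd_Nil B.dd_Nil A.unitv_def B.unitv_def fun_eq_iff)
next
  case (Suc t)
  then have t: "t < length ks" and IH: "B.greenseq (take t ks)" "\<And>j. j < n \<Longrightarrow> A.dd (take t ks) j = B.dd (take t ks) j"
    by auto
  note e = A.take_Suc_snoc[OF t]
  let ?k = "ks ! t"
  have gA: "A.greenseq (take t ks @ [?k])" using A.greenseq_take[OF g, of "Suc t"] unfolding e .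
  then have k: "?k < n" by (simp add: A.greenseq_snoc)
  have gB: "B.greenseq (take t ks @ [?k])" using gA IH(1) IH(2)[OF k] by (simp add: A.greenseq_snoc B.greenseq_snoc)
  have "A.dd (take t ks @ [?k]) j = B.dd (take t ks @ [?k]) j" if "j < n" for j
  proof (rule step_agree[OF gA gB IH(2) _ _ _ _ that])
    fix j a b assume j: "j < n" and ab: "multiple_edge Q a b"
    show "A.dd (take t ks) ?k b = 0" if "\<forall>i<n. 0 \<le> A.dd (take t ks) j i" "A.dd (take t ks) j a \<noteq> 0"
      using nb ab t j that unfolding avoids_def by auto
    show "A.dd (take t ks) ?k a = 0" if neg: "A.dd (take t ks) j b < 0"
    proof (rule ccontr)
      assume a: "A.dd (take t ks) ?k a \<noteq> 0"
      obtain s where s: "s < t" "A.dd (take s ks) (ks ! s) b \<noteq> 0"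
        using A.negative_origin[OF g less_imp_le[OF t] j, of b b] neg by auto
      have "\<forall>i<n. 0 \<le> A.dd (take t ks) ?k i" using gA by (simp add: A.greenseq_snoc)
      then obtain l where "l < n" "\<forall>i<n. 0 \<le> A.dd (take s ks) l i" "A.dd (take s ks) l a \<noteq> 0"
        using A.support_earlier[OF g _ _ k, of s t a] s(1) t a by auto
      then show False using nb ab s t unfolding avoids_def by (meson less_trans)
    qed
    show "A.dd (take t ks) j a = 0 \<or> A.dd (take t ks) j b = 0"
      using mf ab t j unfolding ME_free_def by auto
  next
    show "(\<forall>j<n. \<forall>a b. multiple_edge Q a b \<longrightarrow> A.dd (take t ks @ [?k]) j a = 0 \<or> A.dd (take t ks @ [?k]) j b = 0) \<or>
      (\<forall>j<n. \<forall>a b. multiple_edge Q a b \<longrightarrow> B.dd (take t ks @ [?k]) j a = 0 \<or> B.dd (take t ks @ [?k]) j b = 0)"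
      using mf Suc(2) unfolding ME_free_def e[symmetric] by blast
  qed
  then show ?case using gB unfolding e by blast
qed

lemma agree_conditions:
  assumes gA: "A.greenseq ks" and gB: "B.greenseq ks"
    and eq: "\<And>t j. t \<le> length ks \<Longrightarrow> j < n \<Longrightarrow> A.dd (take t ks) j = B.dd (take t ks) j"
  shows "cvec_seq n Q ks = cvec_seq n Q' ks" "is_MGS n Q ks \<longleftrightarrow> is_MGS n Q' ks"
    "avoids A.dd ks \<longleftrightarrow> avoids B.dd ks" "ME_free A.dd ks \<longleftrightarrow> ME_free B.dd ks"
proof -
  have k: "ks ! t < n" if "t < length ks" for t using gA that by (simp add: A.greenseq_def)
  show "cvec_seq n Q ks = cvec_seq n Q' ks"
    unfolding A.cvec_seq_dd[OF gA] B.cvec_seq_dd[OF gB] using eq k by (intro map_cong) auto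
  have "A.dd ks j = B.dd ks j" if "j < n" for j using eq[of "length ks" j] that by simp
  then show "is_MGS n Q ks \<longleftrightarrow> is_MGS n Q' ks"
    unfolding A.is_MGS_iff B.is_MGS_iff using gA gB by simp
  show "avoids A.dd ks \<longleftrightarrow> avoids B.dd ks"
    unfolding avoids_def using eq k by (simp cong: conj_cong)
  show "ME_free A.dd ks \<longleftrightarrow> ME_free B.dd ks"
    unfolding ME_free_def using eq by simp
qed

lemma MGS_A_imp_B:
  assumes "is_MGS n Q ks"
  shows "is_MGS n Q' ks \<and> ME_free_MGS n Q Q' ks \<and> ME_condition n Q Q' ks \<and> cvec_seq n Q ks = cvec_seq n Q' ks"
proof -
  have g: "A.greenseq ks" and fin: "\<And>j. j < n \<Longrightarrow> \<exists>i<n. A.dd ks j i < 0"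
    using assms by (auto simp: A.is_MGS_iff)
  note nb = MGS_avoids[OF g fin]
  note ag = agree_from_A[OF g nb]
  have gB: "B.greenseq ks" using ag[of "length ks"] by simp
  note c = agree_conditions[OF g gB ag[THEN conjunct2, rule_format]]
  show ?thesis using c assms nb ME_free_MGS_iff[OF gB] ME_condition_iff[OF gB] by blast
qed

lemma MGS_B_imp_A:
  assumes "is_MGS n Q' ks" "ME_free_MGS n Q Q' ks" "ME_condition n Q Q' ks"
  shows "is_MGS n Q ks \<and> cvec_seq n Q ks = cvec_seq n Q' ks"
proof -
  have g: "B.greenseq ks" using assms(1) by (simp add: B.is_MGS_iff)
  note nb = assms(3)[unfolded ME_condition_iff[OF g]] assms(2)[unfolded ME_free_MGS_iff[OF g]]
  note ag = agree_from_B[OF g nb]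
  have gA: "A.greenseq ks" using ag[of "length ks"] by simp
  note c = agree_conditions[OF gA g ag[THEN conjunct2, rule_format]]
  show ?thesis using c assms(1) by blast
qed

end

text \<open>Both inclusions keep the vertex sequence \<open>ks\<close>: it is a maximal green
  sequence for both quivers at once, with the same c-vectors.\<close>

theorem theorem1p2:
  fixes n :: nat and Q :: quiver
  assumes "cluster_quiver n Q"
    and "acyclic_quiver Q"
    and "\<exists>i j. multiple_edge Q i j"
  shows "{cvec_seq n Q ks | ks. is_MGS n Q ks} =
         {cvec_seq n (ME_free_version Q) ks | ks.
            is_MGS n (ME_free_version Q) ks \<and>
            ME_free_MGS n Q (ME_free_version Q) ks \<and>
            ME_condition n Q (ME_free_version Q) ks}"
proof -
  interpret ME_pair n Q by unfold_locales (rule assms(1), rule assms(2))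
  show ?thesis
  proof (intro equalityI subsetI)
    fix x assume "x \<in> {cvec_seq n Q ks | ks. is_MGS n Q ks}"
    then obtain ks where "x = cvec_seq n Q ks" "is_MGS n Q ks" by blast
    then show "x \<in> {cvec_seq n Q' ks | ks. is_MGS n Q' ks \<and> ME_free_MGS n Q Q' ks \<and> ME_condition n Q Q' ks}"
      using MGS_A_imp_B[of ks] by blast
  next
    fix x assume "x \<in> {cvec_seq n Q' ks | ks. is_MGS n Q' ks \<and> ME_free_MGS n Q Q' ks \<and> ME_condition n Q Q' ks}"
    then obtain ks where "x = cvec_seq n Q' ks" "is_MGS n Q' ks" "ME_free_MGS n Q Q' ks" "ME_condition n Q Q' ks"
      by blast
    moreover from MGS_B_imp_A[OF this(2-4)] have "is_MGS n Q ks" "x = cvec_seq n Q ks"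
      using calculation(1) by simp_all
    ultimately show "x \<in> {cvec_seq n Q ks | ks. is_MGS n Q ks}" by blast
  qed
qed

end
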